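(* Let $P\in\mathbb{R}^{d\times d}$ be a symmetric matrix with non-negative diagonal entries, let $c\in\mathbb{R}^d$, and let $\sigma\le d$ be a positive integer. Let $W^*$ be an $\epsilon$-optimal solution to $\mathrm{SDP}(c,P)$, let $x^*$ be an optimal solution to (SBQP), and let $\bar x$ be the (random) output of Algorithm 1 with input $W^*$ and threshold constants $0<C\le 1$ and $T>0$. Put $B:=\|Q(c,P)\|_\infty$ (largest absolute value of an entry). Then $$\mathbb{E}\big(\bar x^\top P\bar x-2c^\top\bar x\big)-B\Big[f(T,C,\sigma,d)+\frac{1}{T^2}(3\sigma+\sigma^2)+\frac{\sqrt3}{\sqrt2\,T}\min\Big\{d,\frac{\sigma}{C^2}\Big\}\Big]\le\frac{1}{T^2}\operatorname{tr}\big(Q(c,P)W^*\big)\le\frac{1}{T^2}\Big[(x^* )^\top Px^*-2c^\top x^*+\epsilon\Big],$$ where $$f(T,C,\sigma,d)=\mathcal{O}\Big(\sigma e^{-C^2T^2}\big[\min\{d,\sigma/C^2\}/(CT)+T/C\big]\Big),$$ with an absolute implied constant and where inside the $\mathcal{O}$ a possible rescaling of $T$ by an absolute constant is omitted (i.e. $f(T,C,\sigma,d)=K\sigma e^{-C^2(\kappa T)^2}[\min\{d,\sigma/C^2\}/(C\kappa T)+\kappa T/C]$ for some absolute constants $K,\kappa>0$). Furthermore, with high probability, $\bar x$ is feasible to (SBQP).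
   Context: (SBQP): minimize $x^\top Px-2c^\top x$ over $x\in\{0,\pm1\}^d$ subject to $\|x\|_0\le\sigma$, where $\|x\|_0$ is the number of nonzero entries of $x$. $Q(c,P):=\begin{pmatrix}0&-c^\top\\-c&P\end{pmatrix}\in\mathbb{R}^{(1+d)\times(1+d)}$. $\mathrm{SDP}(c,P)$: minimize $\operatorname{tr}(Q(c,P)W)$ over symmetric positive semidefinite $W\in\mathbb{R}^{(1+d)\times(1+d)}$ subject to $W_{11}=1$, $\operatorname{tr}(W_x)\le\sigma$, $1_d^\top|W_x|1_d\le\sigma^2$, $\operatorname{diag}(W_x)\le 1_d$ (entrywise). Here $W_x$ is the $d\times d$ matrix obtained from $W$ by deleting its first row and column, $|W_x|$ is the entrywise absolute value, and $1_d$ is the all-ones vector. An $\epsilon$-optimal solution is a feasible $W^*$ whose objective value is at most the optimal value plus $\epsilon$. Let $h(x)=1$ if $x>1$, $h(x)=x$ if $-1\le x\le1$, $h(x)=-1$ if $x<-1$. Algorithm 1 (input: $W^*$, $0<C\le1$, $T>0$; output $\bar x\in\{0,\pm1\}^d$): 1. Let $U=(u_0,u_1,\dots,u_d)=\sqrt{W^*}$ (positive semidefinite square root, with columns $u_0,\dots,u_d\in\mathbb{R}^{d+1}$). 2. Generate $g\sim\mathcal{N}(0_{d+1},I_{d+1})$. 3. Set $z_0=u_0^\top g$, $y_0=h(z_0/T)$; sample $x_0=1$ with probability $(1+y_0)/2$ and $x_0=-1$ with probability $(1-y_0)/2$. 4. For $k=1,\dots,d$: set $p_k=\frac23\|u_k\|_2^2$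 if $\|u_k\|_2\ge C$ and $p_k=0$ otherwise; sample $\epsilon_k=1$ with probability $p_k$ and $\epsilon_k=0$ with probability $1-p_k$ (independently over $k$ and of $g$); set $\tilde u_k=\epsilon_ku_k/p_k$ (with $0/0=0$), $z_k=\tilde u_k^\top g$, $y_k=h(z_k/T)$; sample $x_k=\operatorname{sign}(y_k)$ with probability $|y_k|$ and $x_k=0$ with probability $1-|y_k|$. (The samplings of $x_0,\dots,x_d$ are independent given $y_0,\dots,y_d$.) 5. Return $\bar x=\operatorname{sign}(x_0)\cdot(x_1,\dots,x_d)^\top$. "With high probability" means with probability at least $1-\mathcal{O}(1/d)-\mathcal{O}(\exp(-c_0\sigma))$ for some absolute constant $c_0>0$. *)

theory Defs
  imports "HOL-Probability.Probability" "HOL-Probability.Product_PMF" "Jordan_Normal_Form.Determinant"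
begin

no_notation inner (infixl "\<bullet>" 70)

text \<open>Vectors in \<open>\<real>\<^sup>d\<close> are elements of \<^term>\<open>carrier_vec d\<close> and are indexed from \<open>0\<close>; the entry with
  number \<open>k\<close> of \<open>c\<close> or \<open>x\<close> is therefore \<open>vec_index c (k - 1)\<close>. Matrices of size \<open>1 + d\<close> are indexed by \<open>0, \<dots>, d\<close>,
  so that row and column \<open>0\<close> are the homogenizing ones.\<close>

definition psd :: "nat \<Rightarrow> real mat \<Rightarrow> bool" where
  "psd n A \<longleftrightarrow> A \<in> carrier_mat n n \<and> transpose_mat A = A \<and>
     (\<forall>v \<in> carrier_vec n. v \<bullet> (A *\<^sub>v v) \<ge> 0)"

definition mat_trace :: "real mat \<Rightarrow> real" where
  "mat_trace A = sum_list (diag_mat A)"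

text \<open>A positive semidefinite matrix has exactly one positive semidefinite square root, which is the
  one selected here.\<close>

definition psd_sqrt :: "real mat \<Rightarrow> real mat" where
  "psd_sqrt W = (THE U. psd (dim_row W) U \<and> U * U = W)"

definition l2_norm_vec :: "real vec \<Rightarrow> real" where
  "l2_norm_vec u = sqrt (u \<bullet> u)"

definition max_norm_mat :: "real mat \<Rightarrow> real" where
  "max_norm_mat A = Max (abs ` elements_mat A)"

definition sbqp_objective :: "real vec \<Rightarrow> real mat \<Rightarrow> real vec \<Rightarrow> real" where
  "sbqp_objective c P x = x \<bullet> (P *\<^sub>v x) - 2 * (c \<bullet> x)"

definition sbqp_feasible :: "nat \<Rightarrow> nat \<Rightarrow> real vec \<Rightarrow> bool" where
  "sbqp_feasible d \<sigma> x \<longleftrightarrow> x \<in> carrier_vec d \<and> (\<forall>i<d. vec_index x i \<in> {-1, 0, 1}) \<and>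
     card {i. i < d \<and> vec_index x i \<noteq> 0} \<le> \<sigma>"

definition sbqp_optimal :: "nat \<Rightarrow> nat \<Rightarrow> real vec \<Rightarrow> real mat \<Rightarrow> real vec \<Rightarrow> bool" where
  "sbqp_optimal d \<sigma> c P x \<longleftrightarrow> sbqp_feasible d \<sigma> x \<and>
     (\<forall>x'. sbqp_feasible d \<sigma> x' \<longrightarrow> sbqp_objective c P x \<le> sbqp_objective c P x')"

definition Q_mat :: "real vec \<Rightarrow> real mat \<Rightarrow> real mat" where
  "Q_mat c P = four_block_mat (0\<^sub>m 1 1) (mat_of_rows (dim_vec c) [- c])
                              (mat_of_cols (dim_vec c) [- c]) P"

definition sdp_objective :: "real vec \<Rightarrow> real mat \<Rightarrow> real mat \<Rightarrow> real" where
  "sdp_objective c P W = mat_trace (Q_mat c P * W)"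

definition sdp_feasible :: "nat \<Rightarrow> nat \<Rightarrow> real mat \<Rightarrow> bool" where
  "sdp_feasible d \<sigma> W \<longleftrightarrow> psd (1 + d) W \<and> W $$ (0, 0) = 1 \<and>
     (let Wx = mat_delete W 0 0 in
        mat_trace Wx \<le> real \<sigma> \<and>
        (\<Sum>i<d. \<Sum>j<d. \<bar>Wx $$ (i, j)\<bar>) \<le> (real \<sigma>)\<^sup>2 \<and>
        (\<forall>i<d. Wx $$ (i, i) \<le> 1))"

text \<open>The set of objective values is nonempty and bounded below (the feasible set is compact), so
  the infimum of reals is the optimal value.\<close>

definition sdp_value :: "nat \<Rightarrow> nat \<Rightarrow> real vec \<Rightarrow> real mat \<Rightarrow> real" where
  "sdp_value d \<sigma> c P = (INF W \<in> {W. sdp_feasible d \<sigma> W}. sdp_objective c P W)"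

definition sdp_eps_optimal ::
    "nat \<Rightarrow> nat \<Rightarrow> real vec \<Rightarrow> real mat \<Rightarrow> real \<Rightarrow> real mat \<Rightarrow> bool" where
  "sdp_eps_optimal d \<sigma> c P \<epsilon> W \<longleftrightarrow> sdp_feasible d \<sigma> W \<and>
     sdp_objective c P W \<le> sdp_value d \<sigma> c P + \<epsilon>"

definition clip :: "real \<Rightarrow> real" where
  "clip x = (if x > 1 then 1 else if x < -1 then -1 else x)"

text \<open>\<^const>\<open>bernoulli_pmf\<close> truncates its parameter to \<open>[0, 1]\<close>. This never has an effect below, since
  \<open>clip\<close> has values in \<open>[-1, 1]\<close> and feasibility of \<open>W\<close> gives \<open>keep_prob C u \<le> 2 / 3\<close>.\<close>

definition sample_binary :: "real \<Rightarrow> real pmf" where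
  "sample_binary y = map_pmf (\<lambda>b. if b then 1 else -1) (bernoulli_pmf ((1 + y) / 2))"

definition sample_ternary :: "real \<Rightarrow> real pmf" where
  "sample_ternary y = map_pmf (\<lambda>b. if b then sgn y else 0) (bernoulli_pmf \<bar>y\<bar>)"

definition keep_prob :: "real \<Rightarrow> real vec \<Rightarrow> real" where
  "keep_prob C u = (if l2_norm_vec u \<ge> C then 2 / 3 * (l2_norm_vec u)\<^sup>2 else 0)"

text \<open>The law of the output conditional on the Gaussian vector \<open>g\<close>. Division by zero in HOL yields
  \<open>0\<close>, which is the convention \<open>0/0 = 0\<close> needed when \<open>p k = 0\<close>.\<close>

definition rounding_pmf ::
    "nat \<Rightarrow> real mat \<Rightarrow> real \<Rightarrow> real \<Rightarrow> real vec \<Rightarrow> real vec pmf" where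
  "rounding_pmf d W C T g =
     (let u = col (psd_sqrt W);
          p = (\<lambda>k. keep_prob C (u k))
      in do {
        x0 \<leftarrow> sample_binary (clip ((u 0 \<bullet> g) / T));
        eps \<leftarrow> Pi_pmf {1..d} 0 (\<lambda>k. map_pmf of_bool (bernoulli_pmf (p k)));
        x \<leftarrow> Pi_pmf {1..d} 0 (\<lambda>k.
               let u' = (eps k / p k) \<cdot>\<^sub>v u k; z = u' \<bullet> g in sample_ternary (clip (z / T)));
        return_pmf (sgn x0 \<cdot>\<^sub>v vec d (\<lambda>i. x (i + 1)))
      })"

definition std_gaussian :: "nat \<Rightarrow> (nat \<Rightarrow> real) measure" where
  "std_gaussian n = (\<Pi>\<^sub>M i \<in> {..<n}. density lborel (\<lambda>t. ennreal (std_normal_density t)))"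

definition rounding_output :: "nat \<Rightarrow> real mat \<Rightarrow> real \<Rightarrow> real \<Rightarrow> real vec measure" where
  "rounding_output d W C T =
     Giry_Monad.bind (std_gaussian (d + 1))
       (\<lambda>g. measure_pmf (rounding_pmf d W C T (vec (d + 1) g)))"

text \<open>An error term of order \<open>\<sigma> exp (- C\<^sup>2 T\<^sup>2) (min {d, \<sigma> / C\<^sup>2} / (C T) + T / C)\<close>, with implied constant \<open>K\<close>
  and with \<open>T\<close> rescaled to \<open>\<kappa> T\<close>.\<close>

definition trunc_error :: "real \<Rightarrow> real \<Rightarrow> real \<Rightarrow> real \<Rightarrow> nat \<Rightarrow> nat \<Rightarrow> real" where
  "trunc_error K \<kappa> T C \<sigma> d =
     K * real \<sigma> * exp (- (C\<^sup>2 * (\<kappa> * T)\<^sup>2)) *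
       (min (real d) (real \<sigma> / C\<^sup>2) / (C * (\<kappa> * T)) + \<kappa> * T / C)"

end

theory Submission
  imports Defs
begin

text \<open>Conditionally on the Gaussian vector, \<open>x\<^sub>k\<close> has mean \<open>m\<^sub>k = p\<^sub>k h (u\<^sub>k \<cdot> g / (p\<^sub>k T))\<close>, and \<open>x\<^sub>0, \<dots>, x\<^sub>d\<close> are
  independent with \<open>E x\<^sub>k\<^sup>2 = \<bar>m\<^sub>k\<bar>\<close>. Without the truncation \<open>h\<close> the mean of \<open>m\<^sub>k m\<^sub>l\<close> would be exactly
  \<open>u\<^sub>k \<cdot> u\<^sub>l / T\<^sup>2 = W\<^sub>k\<^sub>l / T\<^sup>2\<close>. The truncation is active for \<open>u\<^sub>k\<close> only if the standard normal variable
  \<open>u\<^sub>k \<cdot> g / \<parallel>u\<^sub>k\<parallel>\<close> exceeds \<open>2 C T / 3\<close>, so by a Chernoff-type estimate it changes this mean by at most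
  \<open>\<parallel>u\<^sub>k\<parallel> \<parallel>u\<^sub>l\<parallel> / T\<^sup>2\<close> times a constant times \<open>exp (- C\<^sup>2 T\<^sup>2 / 36)\<close>. Summation over the columns of norm at least \<open>C\<close>
  uses \<open>\<Sum> \<parallel>u\<^sub>k\<parallel>\<^sup>2 \<le> \<sigma>\<close>. The entries of \<open>W\<close> with a smaller column cost at most \<open>(\<sigma>\<^sup>2 + 2 \<sigma>) / T\<^sup>2\<close>, since
  \<open>\<Sum> \<bar>W\<^sub>k\<^sub>l\<bar> \<le> \<sigma>\<^sup>2\<close> and, by positivity of \<open>W\<close>, \<open>\<Sum> \<bar>W\<^sub>0\<^sub>k\<bar> \<le> \<sigma>\<close>. The diagonal contributes
  \<open>E \<bar>m\<^sub>k\<bar> \<le> 1 / T\<close>. Sparsity is Chernoff's bound for the independent indicators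
  of \<open>x\<^sub>k \<noteq> 0\<close>, whose means add up to at most \<open>2 \<sigma> / 3\<close>.\<close>

text \<open>The root in the algorithm is a definite description, so nothing is known about
  \<open>psd_sqrt\<close> before existence and uniqueness of a positive semidefinite root are shown;
  both come from powers and quadratic forms, without eigenvalues. The probability
  \<open>2 / 3 * |u_k|^2\<close> acts twice: division by it makes a kept column unbiased, and the
  factor 2/3 keeps the expected number of nonzero entries below \<open>\<sigma>\<close> by a fixed
  proportion, which Chernoff's bound requires. Masking a ternary sample gives a ternary sample
  again, so the masks disappear from the conditional law. The product of two correlated Gaussians
  beyond a threshold is estimated by one arithmetic-geometric mean inequality and the weight
  \<open>t^2 exp (t^2 / 8)\<close>, which avoids their joint law.\<close>

unbundle no inner_syntax

subsection \<open>Square roots of positive semidefinite matrices\<close>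

lemma psdD:
  assumes "psd n A"
  shows "A \<in> carrier_mat n n" "transpose_mat A = A" "dim_row A = n" "dim_col A = n"
    "v \<in> carrier_vec n \<Longrightarrow> v \<bullet> (A *\<^sub>v v) \<ge> 0"
  using assms by (auto simp: psd_def)

lemma symmetric_mat_scalar_prod:
  fixes A :: "real mat"
  assumes "A \<in> carrier_mat n n" "transpose_mat A = A" "x \<in> carrier_vec n" "y \<in> carrier_vec n"
  shows "x \<bullet> (A *\<^sub>v y) = (A *\<^sub>v x) \<bullet> y"
  using transpose_vec_mult_scalar[of A n n y x] assms by simp

lemma bilinear_form_sum:
  fixes A :: "real mat"
  assumes "A \<in> carrier_mat n n" "x \<in> carrier_vec n" "y \<in> carrier_vec n"
  shows "x \<bullet> (A *\<^sub>v y) = (\<Sum>i<n. \<Sum>j<n. vec_index x i * A $$ (i, j) * vec_index y j)"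
  using assms
  by (auto simp: scalar_prod_def lessThan_atLeast0 sum_distrib_left mult.assoc intro!: sum.cong)

lemma symmetric_mat_index:
  assumes "A \<in> carrier_mat n n" "transpose_mat A = A" "i < n" "j < n"
  shows "A $$ (i, j) = A $$ (j, i)"
  using assms by (metis carrier_matD index_transpose_mat(1))

text \<open>The value of the form at \<open>s e_i + t e_j\<close>. The choices
  \<open>(1, 0)\<close>, \<open>(1, 1)\<close> and \<open>(1, -1)\<close> give the two bounds on
  entries that follow.\<close>

lemma psd_two_index:
  fixes s t :: real
  assumes "psd n A" "i < n" "j < n"
  shows "s * s * A $$ (i, i) + 2 * (s * t) * A $$ (i, j) + t * t * A $$ (j, j) \<ge> 0"
proof -
  note A = psdD[OF assms(1)]
  define v where "v = s \<cdot>\<^sub>v unit_vec n i + t \<cdot>\<^sub>v unit_vec n j"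
  have v: "v \<in> carrier_vec n" by (simp add: v_def)
  have "v \<bullet> (A *\<^sub>v v) = (\<Sum>k<n. \<Sum>l<n. (s * of_bool (k = i) + t * of_bool (k = j)) * A $$ (k, l) *
      (s * of_bool (l = i) + t * of_bool (l = j)))"
    using assms by (subst bilinear_form_sum[OF A(1) v v]) (auto simp: v_def intro!: sum.cong)
  also have "\<dots> = s * s * A $$ (i, i) + s * t * A $$ (i, j) + t * s * A $$ (j, i) + t * t * A $$ (j, j)"
    using assms(2,3)
    by (simp add: ring_distribs sum.distrib sum.If_cases if_distrib[of "\<lambda>x. _ * x"] of_bool_def
        if_distrib[of "\<lambda>x. x * _"] sum.delta sum.delta' cong: if_cong)
  finally show ?thesis
    using A(5)[OF v] symmetric_mat_index[OF A(1,2) assms(2,3)] by (simp add: algebra_simps)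
qed

lemma psd_diag_nonneg: "psd n A \<Longrightarrow> i < n \<Longrightarrow> A $$ (i, i) \<ge> 0"
  using psd_two_index[of n A i i 1 0] by simp

lemma psd_abs_index_le:
  assumes "psd n A" "i < n" "j < n"
  shows "\<bar>A $$ (i, j)\<bar> \<le> (A $$ (i, i) + A $$ (j, j)) / 2"
  using psd_two_index[OF assms, of 1 1] psd_two_index[OF assms, of 1 "-1"] by simp

lemma scalar_prod_self_eq_0_iff:
  fixes v :: "real vec"
  assumes "v \<in> carrier_vec n" shows "v \<bullet> v = 0 \<longleftrightarrow> v = 0\<^sub>v n"
  using assms by (auto simp: scalar_prod_def sum_nonneg_eq_0_iff intro!: eq_vecI)

text \<open>Perturb \<open>x\<close> to \<open>x - t y\<close> with \<open>y = A x\<close>: the form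
  takes the value \<open>- 2 t |y|^2 + t^2 (y . A y)\<close>, which can be nonnegative for all small
  \<open>t > 0\<close> only if \<open>y = 0\<close>.\<close>

lemma psd_form_eq_0_imp:
  assumes "psd n A" "x \<in> carrier_vec n" "x \<bullet> (A *\<^sub>v x) = 0"
  shows "A *\<^sub>v x = 0\<^sub>v n"
proof -
  note A = psdD[OF assms(1)]
  define y where "y = A *\<^sub>v x"
  have y: "y \<in> carrier_vec n" "A *\<^sub>v y \<in> carrier_vec n" using A(1) assms(2) by (auto simp: y_def)
  have ineq: "2 * (y \<bullet> y) \<le> t * (y \<bullet> (A *\<^sub>v y))" if "t > 0" for t :: real
  proof -
    have c: "t \<cdot>\<^sub>v y \<in> carrier_vec n" "x - t \<cdot>\<^sub>v y \<in> carrier_vec n" using y assms(2) by auto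
    have xy: "x \<bullet> (A *\<^sub>v y) = y \<bullet> y"
      using symmetric_mat_scalar_prod[OF A(1,2) assms(2) y(1)] by (simp add: y_def)
    have "A *\<^sub>v (x - t \<cdot>\<^sub>v y) = y - t \<cdot>\<^sub>v (A *\<^sub>v y)"
      using A(1) assms(2) y(1) by (simp add: mult_minus_distrib_mat_vec mult_mat_vec y_def)
    then have "(x - t \<cdot>\<^sub>v y) \<bullet> (A *\<^sub>v (x - t \<cdot>\<^sub>v y))
        = x \<bullet> (y - t \<cdot>\<^sub>v (A *\<^sub>v y)) - (t \<cdot>\<^sub>v y) \<bullet> (y - t \<cdot>\<^sub>v (A *\<^sub>v y))"
      using y assms(2) c by (simp add: minus_scalar_prod_distrib)
    also have "\<dots> = x \<bullet> y - t * (x \<bullet> (A *\<^sub>v y)) - t * (y \<bullet> y - t * (y \<bullet> (A *\<^sub>v y)))"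
      using y assms(2) c by (simp add: scalar_prod_minus_distrib[where n = n] algebra_simps)
    finally have "0 \<le> x \<bullet> y - t * (y \<bullet> y) - t * (y \<bullet> y - t * (y \<bullet> (A *\<^sub>v y)))"
      using A(5)[OF c(2)] xy by simp
    also have "x \<bullet> y = 0" using assms(3) by (simp add: y_def)
    finally have "t * (2 * (y \<bullet> y)) \<le> t * (t * (y \<bullet> (A *\<^sub>v y)))" by (simp add: algebra_simps)
    with that show ?thesis by simp
  qed
  have "((\<lambda>t. t * (y \<bullet> (A *\<^sub>v y))) \<longlongrightarrow> 0 * (y \<bullet> (A *\<^sub>v y))) (at_right 0)"
    by (intro tendsto_intros)
  then have "2 * (y \<bullet> y) \<le> 0"
    using ineq by (intro tendsto_lowerbound[of _ _ "at_right 0"]) (auto simp: eventually_at_filter)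
  moreover have "y \<bullet> y \<ge> 0" by (simp add: scalar_prod_def sum_nonneg)
  ultimately show ?thesis using scalar_prod_self_eq_0_iff[OF y(1)] by (simp add: y_def)
qed

lemma mult_mat_index_sum:
  fixes A B :: "real mat"
  assumes "A \<in> carrier_mat n n" "B \<in> carrier_mat n n" "i < n" "j < n"
  shows "(A * B) $$ (i, j) = (\<Sum>k<n. A $$ (i, k) * B $$ (k, j))"
  using assms by (auto simp: scalar_prod_def lessThan_atLeast0)

lemma sum_diag_mult_comm:
  fixes A B :: "real mat"
  assumes "A \<in> carrier_mat n n" "B \<in> carrier_mat n n"
  shows "(\<Sum>i<n. (A * B) $$ (i, i)) = (\<Sum>i<n. (B * A) $$ (i, i))"
proof -
  have "(\<Sum>i<n. (A * B) $$ (i, i)) = (\<Sum>i<n. \<Sum>j<n. A $$ (i, j) * B $$ (j, i))"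
    by (simp add: mult_mat_index_sum[OF assms])
  also have "\<dots> = (\<Sum>j<n. \<Sum>i<n. B $$ (j, i) * A $$ (i, j))"
    by (subst sum.swap) (simp add: mult.commute)
  also have "\<dots> = (\<Sum>i<n. (B * A) $$ (i, i))"
    by (simp add: mult_mat_index_sum[OF assms(2,1)])
  finally show ?thesis .
qed

lemma diag_conj_eq_form:
  fixes A D :: "real mat"
  assumes "A \<in> carrier_mat n n" "D \<in> carrier_mat n n" "transpose_mat D = D" "i < n"
  shows "(D * (A * D)) $$ (i, i) = col D i \<bullet> (A *\<^sub>v col D i)"
proof -
  have "row D i = col D i" using assms by (metis carrier_matD(2) row_transpose)
  then show ?thesis using assms by (simp add: col_mult2)
qed

text \<open>With \<open>D = A - B\<close> one has \<open>A D + D B = A\<^sup>2 - B\<^sup>2 = 0\<close>, so \<open>tr (D A D) + tr (D B D) = 0\<close>; both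
  traces are sums of values of the forms \<open>A\<close> and \<open>B\<close> at the columns of \<open>D\<close>.\<close>

lemma psd_root_unique:
  assumes A: "psd n A" and B: "psd n B" and eq: "A * A = B * B"
  shows "A = B"
proof -
  note a = psdD[OF A] and b = psdD[OF B]
  define D where "D = A - B"
  have D: "D \<in> carrier_mat n n" "transpose_mat D = D"
    using a(1,2) b(1,2) by (auto simp: D_def transpose_minus)
  have DA: "A * D = A * A - A * B"
    unfolding D_def using a(1) b(1) by (intro mult_minus_distrib_mat) auto
  have DB: "D * B = A * B - B * B"
    unfolding D_def using a(1) b(1) by (intro minus_mult_distrib_mat) auto
  have 0: "A * D + D * B = 0\<^sub>m n n"
    using a(1) b(1) by (auto simp: DA DB eq intro!: eq_matI)
  \<comment> \<open>Cyclicity of the trace turns \<open>D * (B * D)\<close> into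
    \<open>D * (D * B)\<close>; then \<open>D\<close> is a common left factor and the identity
    \<open>0\<close> applies.\<close>
  have "(\<Sum>i<n. (D * (A * D)) $$ (i, i)) + (\<Sum>i<n. (D * (B * D)) $$ (i, i))
      = (\<Sum>i<n. (D * (A * D)) $$ (i, i)) + (\<Sum>i<n. (D * (D * B)) $$ (i, i))"
    using sum_diag_mult_comm[of D n "D * B"] D b(1) assoc_mult_mat[of D n n B n D n] by simp
  also have "\<dots> = (\<Sum>i<n. (D * (A * D + D * B)) $$ (i, i))"
    using a(1) b(1) D by (simp add: mult_add_distrib_mat[of _ n n _ n] sum.distrib)
  also have "\<dots> = 0" using D by (simp add: 0)
  finally have tr: "(\<Sum>i<n. col D i \<bullet> (A *\<^sub>v col D i)) + (\<Sum>i<n. col D i \<bullet> (B *\<^sub>v col D i)) = 0"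
    using a(1) b(1) D diag_conj_eq_form[OF a(1) D] diag_conj_eq_form[OF b(1) D]
    by (simp del: index_mult_mat cong: sum.cong_simp)
  have nn: "col D i \<bullet> (A *\<^sub>v col D i) \<ge> 0" "col D i \<bullet> (B *\<^sub>v col D i) \<ge> 0" if "i < n" for i
    using D a(5) b(5) that by auto
  have z: "col D i \<bullet> (A *\<^sub>v col D i) = 0" "col D i \<bullet> (B *\<^sub>v col D i) = 0" if "i < n" for i
  proof -
    have "(\<Sum>i<n. col D i \<bullet> (A *\<^sub>v col D i)) \<ge> 0" "(\<Sum>i<n. col D i \<bullet> (B *\<^sub>v col D i)) \<ge> 0"
      using nn by (auto intro!: sum_nonneg)
    with tr have "(\<Sum>i<n. col D i \<bullet> (A *\<^sub>v col D i)) = 0" "(\<Sum>i<n. col D i \<bullet> (B *\<^sub>v col D i)) = 0"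
      by linarith+
    with nn that show "col D i \<bullet> (A *\<^sub>v col D i) = 0" "col D i \<bullet> (B *\<^sub>v col D i) = 0"
      using sum_nonneg_0[of "{..<n}" "\<lambda>i. col D i \<bullet> (A *\<^sub>v col D i)" i]
        sum_nonneg_0[of "{..<n}" "\<lambda>i. col D i \<bullet> (B *\<^sub>v col D i)" i] by simp_all
  qed
  \<comment> \<open>\<open>A\<close> and \<open>B\<close> annihilate the column, hence so does
    \<open>D\<close>, and \<open>|D e_i|^2 = e_i . D (D e_i) = 0\<close>.\<close>
  have col0: "col D i = 0\<^sub>v n" if i: "i < n" for i
  proof -
    have ci: "col D i \<in> carrier_vec n" using D by auto
    have "D *\<^sub>v col D i = A *\<^sub>v col D i - B *\<^sub>v col D i"
      unfolding D_def using a(1) b(1) ci[unfolded D_def] by (intro minus_mult_distrib_mat_vec) auto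
    then have "D *\<^sub>v col D i = 0\<^sub>v n"
      using psd_form_eq_0_imp[OF A ci z(1)[OF i]] psd_form_eq_0_imp[OF B ci z(2)[OF i]] by simp
    moreover have "D *\<^sub>v unit_vec n i = col D i"
      using D i by (intro eq_vecI) auto
    ultimately have "col D i \<bullet> col D i = 0"
      using symmetric_mat_scalar_prod[OF D, of "unit_vec n i" "col D i"] ci by simp
    then show ?thesis using scalar_prod_self_eq_0_iff[OF ci] by simp
  qed
  have "D $$ (i, j) = 0" if "i < n" "j < n" for i j
    using arg_cong[OF col0[OF that(2)], of "\<lambda>v. vec_index v i"] that D by auto
  then show ?thesis using a(1) b(1) by (intro eq_matI) (auto simp: D_def)
qed

section \<open>Powers of a positive semidefinite matrix, the binomial series and the root\<close>

lemma pow_mat_add: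
  fixes A :: "real mat"
  assumes "A \<in> carrier_mat n n"
  shows "A ^\<^sub>m (k + l) = A ^\<^sub>m k * A ^\<^sub>m l"
proof (induction l)
  case (Suc l)
  then show ?case using assms by (simp add: assoc_mult_mat[of _ n n _ n _ n] pow_carrier_mat)
qed (use assms in simp)

lemma transpose_pow_mat:
  fixes A :: "real mat"
  assumes "A \<in> carrier_mat n n" "transpose_mat A = A"
  shows "transpose_mat (A ^\<^sub>m k) = A ^\<^sub>m k"
proof (induction k)
  case (Suc k)
  have "transpose_mat (A ^\<^sub>m Suc k) = A * A ^\<^sub>m k"
    using assms Suc by (simp add: transpose_mult[of _ n n] pow_carrier_mat)
  also have "\<dots> = A ^\<^sub>m (1 + k)" using pow_mat_add[OF assms(1), of 1 k] assms by simp
  finally show ?case by simp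
qed (use assms in simp)

text \<open>Moving half of the factors to the other side makes an even power a squared norm and an
  odd power a value of the form \<open>A\<close>. This split by parity takes the place of a spectral
  decomposition.\<close>

lemma pow_mat_form:
  fixes A :: "real mat"
  assumes A: "A \<in> carrier_mat n n" "transpose_mat A = A" and v: "v \<in> carrier_vec n"
  shows "v \<bullet> (A ^\<^sub>m (m + m) *\<^sub>v v) = (A ^\<^sub>m m *\<^sub>v v) \<bullet> (A ^\<^sub>m m *\<^sub>v v)"
    "v \<bullet> (A ^\<^sub>m (Suc (m + m)) *\<^sub>v v) = (A ^\<^sub>m m *\<^sub>v v) \<bullet> (A *\<^sub>v (A ^\<^sub>m m *\<^sub>v v))"
proof -
  have p: "A ^\<^sub>m k \<in> carrier_mat n n" for k using A by (simp add: pow_carrier_mat)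
  have *: "v \<bullet> (A ^\<^sub>m m *\<^sub>v w) = (A ^\<^sub>m m *\<^sub>v v) \<bullet> w" if "w \<in> carrier_vec n" for w
    using symmetric_mat_scalar_prod[OF p transpose_pow_mat[OF A] v that] .
  have "A ^\<^sub>m (m + m) *\<^sub>v v = A ^\<^sub>m m *\<^sub>v (A ^\<^sub>m m *\<^sub>v v)"
    using p v A by (simp add: pow_mat_add assoc_mult_mat_vec[of _ n n _ n])
  then show "v \<bullet> (A ^\<^sub>m (m + m) *\<^sub>v v) = (A ^\<^sub>m m *\<^sub>v v) \<bullet> (A ^\<^sub>m m *\<^sub>v v)"
    using *[OF mult_mat_vec_carrier[OF p v]] by simp
  have "A ^\<^sub>m (m + (1 + m)) *\<^sub>v v = A ^\<^sub>m m *\<^sub>v (A *\<^sub>v (A ^\<^sub>m m *\<^sub>v v))"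
    using p v A unfolding pow_mat_add[OF A(1)] by (simp add: assoc_mult_mat_vec[of _ n n _ n])
  moreover have "m + (1 + m) = Suc (m + m)" by simp
  ultimately show "v \<bullet> (A ^\<^sub>m (Suc (m + m)) *\<^sub>v v) = (A ^\<^sub>m m *\<^sub>v v) \<bullet> (A *\<^sub>v (A ^\<^sub>m m *\<^sub>v v))"
    using * p v A by (metis mult_mat_vec_carrier)
qed

lemma nat_double_cases:
  fixes k :: nat
  obtains m where "k = m + m" | m where "k = Suc (m + m)"
  by (metis add.commute add_Suc_right evenE mult_2 oddE plus_1_eq_Suc)

lemma scalar_prod_self_ge_0: "(v :: real vec) \<bullet> v \<ge> 0"
  by (simp add: scalar_prod_def sum_nonneg)

lemma psd_pow_mat:
  assumes "psd n A" shows "psd n (A ^\<^sub>m k)"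
proof -
  note A = psdD[OF assms]
  have "v \<bullet> (A ^\<^sub>m k *\<^sub>v v) \<ge> 0" if v: "v \<in> carrier_vec n" for v
  proof (cases k rule: nat_double_cases)
    case (1 m)
    then show ?thesis using pow_mat_form(1)[OF A(1,2) v] by (simp add: scalar_prod_self_ge_0)
  next
    case (2 m)
    then show ?thesis using pow_mat_form(2)[OF A(1,2) v, of m] A(1) v
      by (simp add: A(5) pow_carrier_mat mult_mat_vec_carrier[of _ n n])
  qed
  then show ?thesis using A transpose_pow_mat[OF A(1,2)] by (auto simp: psd_def pow_carrier_mat)
qed

text \<open>For even \<open>k\<close> this is the hypothesis at \<open>A^m v\<close>. For odd
  \<open>k\<close> it rests on \<open>A - A^2 = (1 - A) A (1 - A) + A (1 - A) A\<close>, evaluated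
  at \<open>w = A^m v\<close>, where both summands are nonnegative.\<close>

lemma pow_mat_form_antimono:
  assumes A: "psd n A" and le: "\<And>v. v \<in> carrier_vec n \<Longrightarrow> v \<bullet> (A *\<^sub>v v) \<le> v \<bullet> v"
    and v: "v \<in> carrier_vec n"
  shows "v \<bullet> (A ^\<^sub>m Suc k *\<^sub>v v) \<le> v \<bullet> (A ^\<^sub>m k *\<^sub>v v)"
proof -
  note a = psdD[OF A]
  have w: "A ^\<^sub>m m *\<^sub>v v \<in> carrier_vec n" for m
    using a(1) v by (simp add: pow_carrier_mat mult_mat_vec_carrier[of _ n n])
  show ?thesis
  proof (cases k rule: nat_double_cases)
    case (1 m)
    show ?thesis unfolding 1 pow_mat_form[OF a(1,2) v] by (rule le[OF w])
  next
    case (2 m)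
    define w where "w = A ^\<^sub>m m *\<^sub>v v"
    define z where "z = A *\<^sub>v w"
    define y where "y = w - z"
    have c: "w \<in> carrier_vec n" "z \<in> carrier_vec n" "y \<in> carrier_vec n" "A *\<^sub>v z \<in> carrier_vec n"
      "A *\<^sub>v y \<in> carrier_vec n"
      using w a(1) by (auto simp: w_def z_def y_def)
    have Ay: "A *\<^sub>v y = z - A *\<^sub>v z"
      using a(1) c by (simp add: y_def mult_minus_distrib_mat_vec z_def)
    have "w \<bullet> z - z \<bullet> z = y \<bullet> z" using c by (simp add: y_def minus_scalar_prod_distrib)
    also have "\<dots> = y \<bullet> (A *\<^sub>v y) + y \<bullet> (A *\<^sub>v z)"
    proof -
      have "A *\<^sub>v y + A *\<^sub>v z = z" using c Ay a(3) by (intro eq_vecI) auto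
      then show ?thesis using scalar_prod_add_distrib[OF c(3,5,4)] by simp
    qed
    also have "y \<bullet> (A *\<^sub>v z) = z \<bullet> z - (A *\<^sub>v z) \<bullet> z"
      using symmetric_mat_scalar_prod[OF a(1,2) c(3,2)] c by (simp add: Ay minus_scalar_prod_distrib)
    also have "(A *\<^sub>v z) \<bullet> z = z \<bullet> (A *\<^sub>v z)" using c by (simp add: comm_scalar_prod)
    finally have "z \<bullet> z \<le> w \<bullet> z" using le[OF c(2)] a(5)[OF c(3)] by simp
    moreover have "A ^\<^sub>m Suc m *\<^sub>v v = z"
    proof -
      have "A ^\<^sub>m (1 + m) *\<^sub>v v = A *\<^sub>v (A ^\<^sub>m m *\<^sub>v v)"
        unfolding pow_mat_add[OF a(1)] using a(1) v
        by (simp add: assoc_mult_mat_vec[of _ n n _ n] pow_carrier_mat)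
      then show ?thesis by (simp add: z_def w_def)
    qed
    ultimately show ?thesis
      using pow_mat_form(1)[OF a(1,2) v, of "Suc m"] pow_mat_form(2)[OF a(1,2) v, of m]
      by (simp add: 2 w_def[symmetric] z_def[symmetric])
  qed
qed

text \<open>The coefficient of \<open>x^k\<close> in the power series of
  \<open>sqrt (1 - x)\<close>.\<close>

definition sqrt_coeff :: "nat \<Rightarrow> real" where
  "sqrt_coeff k = (1 / 2 gchoose k) * (- 1) ^ k"

lemma sqrt_coeff_0 [simp]: "sqrt_coeff 0 = 1"
  by (simp add: sqrt_coeff_def)

text \<open>In the Pochhammer product of \<open>- 1 / 2\<close> only the first factor is
  negative.\<close>

lemma sqrt_coeff_Suc_nonpos: "sqrt_coeff (Suc k) \<le> 0"
proof -
  have "sqrt_coeff (Suc k) = pochhammer (- (1 / 2)) (Suc k) / fact (Suc k)"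
    by (simp add: sqrt_coeff_def gbinomial_pochhammer flip: power_mult_distrib)
  also have "\<dots> = - (1 / 2) * pochhammer (1 / 2) k / fact (Suc k)"
    unfolding pochhammer_rec by simp
  finally show ?thesis using pochhammer_pos[of "1 / 2 :: real" k] by (simp add: field_simps)
qed

text \<open>Partial sums of coefficients are the coefficients of the series divided by
  \<open>1 - x\<close>, here of \<open>(1 - x)\<close> to the power \<open>- 1 / 2\<close>, and
  these are positive.\<close>

lemma sum_sqrt_coeff_nonneg: "(\<Sum>k\<le>m. sqrt_coeff k) \<ge> 0"
proof -
  have "(\<Sum>k\<le>m. sqrt_coeff k) = (- 1) ^ m * (- (1 / 2) gchoose m)"
    unfolding sqrt_coeff_def gbinomial_sum_lower_neg by simp
  also have "\<dots> = pochhammer (1 / 2) m / fact m"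
    by (simp add: gbinomial_pochhammer flip: power_mult_distrib)
  finally show ?thesis using pochhammer_pos[of "1 / 2 :: real" m] by simp
qed

text \<open>Only the coefficient with number 0 is positive, so a partial sum of absolute values is 2
  minus the nonnegative partial sum of the coefficients.\<close>

lemma summable_abs_sqrt_coeff: "summable (\<lambda>k. \<bar>sqrt_coeff k\<bar>)"
proof (rule bounded_imp_summable)
  fix m
  have "\<bar>sqrt_coeff k\<bar> = 2 * of_bool (k = 0) - sqrt_coeff k" for k
    using sqrt_coeff_Suc_nonpos[of "k - 1"] by (cases k) auto
  then have "(\<Sum>k\<le>m. \<bar>sqrt_coeff k\<bar>) = 2 - (\<Sum>k\<le>m. sqrt_coeff k)"
    by (simp add: sum_subtractf of_bool_def sum.delta flip: sum_distrib_left)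
  then show "(\<Sum>k\<le>m. \<bar>sqrt_coeff k\<bar>) \<le> 2" using sum_sqrt_coeff_nonneg[of m] by simp
qed simp

text \<open>The square of the series is \<open>1 - x\<close>; on coefficients this is Vandermonde's
  identity for \<open>1 / 2 + 1 / 2 = 1\<close>.\<close>

lemma sqrt_coeff_convolution:
  "(\<Sum>i\<le>k. sqrt_coeff i * sqrt_coeff (k - i)) = of_bool (k = 0) - of_bool (k = 1)"
proof -
  have "(\<Sum>i\<le>k. sqrt_coeff i * sqrt_coeff (k - i)) =
      (\<Sum>i\<le>k. (1 / 2 gchoose i) * (1 / 2 gchoose (k - i))) * (- 1) ^ k"
    by (auto simp: sqrt_coeff_def sum_distrib_right simp flip: power_add intro!: sum.cong)
  also have "(\<Sum>i\<le>k. (1 / 2 gchoose i) * (1 / 2 gchoose (k - i))) = (1 :: real) gchoose k"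
    using gbinomial_Vandermonde[of "1 / 2 :: real" "1 / 2" k] by (simp add: atMost_atLeast0)
  also have "\<dots> * (- 1) ^ k = of_bool (k = 0) - of_bool (k = 1)"
    using binomial_gbinomial[of 1 k, where 'a = real] by (cases k; cases "k - 1") auto
  finally show ?thesis .
qed

text \<open>The root of \<open>1 - X\<close> is given by the binomial series with exponent \<open>1 / 2\<close>; its coefficients after the
  first are nonpositive and their sum is nonnegative, which gives both convergence and positivity.\<close>

lemma psd_root_exists_contraction:
  assumes X: "psd n X" and le: "\<And>v. v \<in> carrier_vec n \<Longrightarrow> v \<bullet> (X *\<^sub>v v) \<le> v \<bullet> v"
  shows "\<exists>U. psd n U \<and> U * U = 1\<^sub>m n - X"
proof -
  note x = psdD[OF X]
  have pc: "X ^\<^sub>m k \<in> carrier_mat n n" for k using x(1) by (simp add: pow_carrier_mat)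
  have anti: "v \<bullet> (X ^\<^sub>m k *\<^sub>v v) \<le> v \<bullet> v" if v: "v \<in> carrier_vec n" for k v
  proof (induction k)
    case (Suc k)
    then show ?case using pow_mat_form_antimono[OF X le v, of k] by linarith
  qed (use x v in simp)
  have diag: "(X ^\<^sub>m k) $$ (i, i) \<le> 1" if "i < n" for i k
  proof -
    have "unit_vec n i \<bullet> (X ^\<^sub>m k *\<^sub>v unit_vec n i) = (X ^\<^sub>m k) $$ (i, i)"
      using that bilinear_form_sum[OF pc[of k], of "unit_vec n i" "unit_vec n i"]
      by (simp add: unit_vec_def if_distrib[of "\<lambda>x. _ * x"] if_distrib[of "\<lambda>x. x * _"] cong: if_cong)
    then show ?thesis using anti[of "unit_vec n i" k] that by simp
  qed
  \<comment> \<open>All powers are positive semidefinite with diagonal at most 1, which bounds every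
    entry; the absolutely summable coefficients then dominate each entry of the series.\<close>
  have bound: "\<bar>(X ^\<^sub>m k) $$ (i, j)\<bar> \<le> 1" if "i < n" "j < n" for i j k
    by (rule order_trans[OF psd_abs_index_le[OF psd_pow_mat[OF X] that, of k]])
      (use diag[OF that(1), of k] diag[OF that(2), of k] in simp)
  have summ: "summable (\<lambda>k. norm (sqrt_coeff k * (X ^\<^sub>m k) $$ (i, j)))" if "i < n" "j < n" for i j
    using bound[OF that] mult_left_mono[OF bound[OF that] abs_ge_zero]
    by (intro summable_comparison_test'[OF summable_abs_sqrt_coeff, of 0]) (auto simp: abs_mult)
  define U where "U = mat n n (\<lambda>(i, j). \<Sum>k. sqrt_coeff k * (X ^\<^sub>m k) $$ (i, j))"
  have U: "U \<in> carrier_mat n n" by (simp add: U_def)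
  have sums: "(\<lambda>k. sqrt_coeff k * (X ^\<^sub>m k) $$ (i, j)) sums U $$ (i, j)" if "i < n" "j < n" for i j
    using summable_norm_cancel[OF summ[OF that]] that by (simp add: U_def summable_sums)
  have "transpose_mat U = U"
    using symmetric_mat_index[OF pc transpose_pow_mat[OF x(1,2)]]
    by (intro eq_matI) (auto simp: U_def)
  moreover have "v \<bullet> (U *\<^sub>v v) \<ge> 0" if v: "v \<in> carrier_vec n" for v
  proof -
    have "(\<lambda>k. \<Sum>i<n. \<Sum>j<n. vec_index v i * (sqrt_coeff k * (X ^\<^sub>m k) $$ (i, j)) * vec_index v j)
        sums (v \<bullet> (U *\<^sub>v v))"
      unfolding bilinear_form_sum[OF U v v] by (intro sums_sum sums_mult sums_mult2 sums) auto
    also have "(\<lambda>k. \<Sum>i<n. \<Sum>j<n. vec_index v i * (sqrt_coeff k * (X ^\<^sub>m k) $$ (i, j)) * vec_index v j)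
        = (\<lambda>k. sqrt_coeff k * (v \<bullet> (X ^\<^sub>m k *\<^sub>v v)))"
      by (simp add: bilinear_form_sum[OF pc v v] sum_distrib_left mult_ac)
    finally have lim: "(\<lambda>m. \<Sum>k\<le>m. sqrt_coeff k * (v \<bullet> (X ^\<^sub>m k *\<^sub>v v))) \<longlonglongrightarrow> v \<bullet> (U *\<^sub>v v)"
      by (simp add: sums_def_le)
    have "(\<Sum>k\<le>m. sqrt_coeff k * (v \<bullet> (X ^\<^sub>m k *\<^sub>v v))) \<ge> 0" for m
    proof -
      \<comment> \<open>All coefficients but the first are nonpositive, so replacing the form of
        \<open>X^k\<close> by the larger \<open>v . v\<close> can only decrease a term; for
        \<open>k = 0\<close> the two agree.\<close>
      have "sqrt_coeff k * (v \<bullet> v) \<le> sqrt_coeff k * (v \<bullet> (X ^\<^sub>m k *\<^sub>v v))" for k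
        using anti[OF v, of k] sqrt_coeff_Suc_nonpos[of "k - 1"] x v
        by (cases k) (auto intro!: mult_left_mono_neg)
      then have "(\<Sum>k\<le>m. sqrt_coeff k) * (v \<bullet> v) \<le> (\<Sum>k\<le>m. sqrt_coeff k * (v \<bullet> (X ^\<^sub>m k *\<^sub>v v)))"
        by (simp add: sum_distrib_right sum_mono)
      with sum_sqrt_coeff_nonneg[of m] scalar_prod_self_ge_0[of v] show ?thesis
        by (meson mult_nonneg_nonneg order_trans)
    qed
    then show ?thesis using LIMSEQ_le_const[OF lim] by blast
  qed
  moreover have "U * U = 1\<^sub>m n - X"
  proof (rule eq_matI)
    fix i j assume "i < dim_row (1\<^sub>m n - X)" "j < dim_col (1\<^sub>m n - X)"
    then have ij: "i < n" "j < n" using x by auto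
    \<comment> \<open>Cauchy products of absolutely convergent entry series. Collecting equal powers
      of \<open>X\<close> leaves the convolution coefficients, which vanish from degree 2
      on.\<close>
    have "(\<lambda>k. \<Sum>l<n. \<Sum>m\<le>k. (sqrt_coeff m * (X ^\<^sub>m m) $$ (i, l)) *
          (sqrt_coeff (k - m) * (X ^\<^sub>m (k - m)) $$ (l, j)))
        sums (\<Sum>l<n. U $$ (i, l) * U $$ (l, j))"
    proof (intro sums_sum)
      fix l assume "l \<in> {..<n}"
      then have l: "l < n" by simp
      show "(\<lambda>k. \<Sum>m\<le>k. (sqrt_coeff m * (X ^\<^sub>m m) $$ (i, l)) *
          (sqrt_coeff (k - m) * (X ^\<^sub>m (k - m)) $$ (l, j))) sums (U $$ (i, l) * U $$ (l, j))"
        using Cauchy_product_sums[OF summ[OF ij(1) l] summ[OF l ij(2)]]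
        by (simp add: sums_unique[OF sums[OF ij(1) l]] sums_unique[OF sums[OF l ij(2)]])
    qed
    also have "(\<lambda>k. \<Sum>l<n. \<Sum>m\<le>k. (sqrt_coeff m * (X ^\<^sub>m m) $$ (i, l)) *
          (sqrt_coeff (k - m) * (X ^\<^sub>m (k - m)) $$ (l, j)))
        = (\<lambda>k. (of_bool (k = 0) - of_bool (k = 1)) * (X ^\<^sub>m k) $$ (i, j))"
    proof
      fix k
      have "(\<Sum>l<n. \<Sum>m\<le>k. (sqrt_coeff m * (X ^\<^sub>m m) $$ (i, l)) *
          (sqrt_coeff (k - m) * (X ^\<^sub>m (k - m)) $$ (l, j)))
        = (\<Sum>m\<le>k. sqrt_coeff m * sqrt_coeff (k - m) * (\<Sum>l<n. (X ^\<^sub>m m) $$ (i, l) * (X ^\<^sub>m (k - m)) $$ (l, j)))"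
        by (subst sum.swap) (simp add: sum_distrib_left mult_ac)
      also have "\<dots> = (\<Sum>m\<le>k. sqrt_coeff m * sqrt_coeff (k - m) * (X ^\<^sub>m k) $$ (i, j))"
      proof (intro sum.cong refl)
        fix m assume "m \<in> {..k}"
        then have "X ^\<^sub>m k = X ^\<^sub>m m * X ^\<^sub>m (k - m)" using pow_mat_add[OF x(1), of m "k - m"] by simp
        moreover have "(X ^\<^sub>m m * X ^\<^sub>m (k - m)) $$ (i, j)
            = (\<Sum>l<n. (X ^\<^sub>m m) $$ (i, l) * (X ^\<^sub>m (k - m)) $$ (l, j))"
          by (rule mult_mat_index_sum[OF pc pc ij])
        ultimately show "sqrt_coeff m * sqrt_coeff (k - m) * (\<Sum>l<n. (X ^\<^sub>m m) $$ (i, l) * (X ^\<^sub>m (k - m)) $$ (l, j))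
          = sqrt_coeff m * sqrt_coeff (k - m) * (X ^\<^sub>m k) $$ (i, j)" by simp
      qed
      also have "\<dots> = (of_bool (k = 0) - of_bool (k = 1)) * (X ^\<^sub>m k) $$ (i, j)"
        by (simp only: sqrt_coeff_convolution flip: sum_distrib_right)
      finally show "(\<Sum>l<n. \<Sum>m\<le>k. (sqrt_coeff m * (X ^\<^sub>m m) $$ (i, l)) *
          (sqrt_coeff (k - m) * (X ^\<^sub>m (k - m)) $$ (l, j)))
        = (of_bool (k = 0) - of_bool (k = 1)) * (X ^\<^sub>m k) $$ (i, j)" .
    qed
    finally have "(\<Sum>l<n. U $$ (i, l) * U $$ (l, j)) =
        (\<Sum>k. (of_bool (k = 0) - of_bool (k = 1)) * (X ^\<^sub>m k) $$ (i, j))"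
      by (simp add: sums_iff)
    also have "\<dots> = (\<Sum>k\<in>{0, 1}. (of_bool (k = 0) - of_bool (k = 1)) * (X ^\<^sub>m k) $$ (i, j))"
      by (rule suminf_finite) auto
    also have "\<dots> = (1\<^sub>m n - X) $$ (i, j)" using ij x by simp
    finally show "(U * U) $$ (i, j) = (1\<^sub>m n - X) $$ (i, j)"
      by (simp add: mult_mat_index_sum[OF U U ij])
  qed (use U x in auto)
  ultimately show ?thesis using U by (auto simp: psd_def)
qed

lemma transpose_smult_mat: "transpose_mat (c \<cdot>\<^sub>m A) = c \<cdot>\<^sub>m transpose_mat A"
  by (rule eq_matI) auto

lemma smult_mat_mult_vec:
  fixes A :: "real mat"
  assumes "A \<in> carrier_mat m n" "v \<in> carrier_vec n"
  shows "(c \<cdot>\<^sub>m A) *\<^sub>v v = c \<cdot>\<^sub>v (A *\<^sub>v v)"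
  using assms by (intro eq_vecI) (auto simp: scalar_prod_def sum_distrib_left mult_ac)

text \<open>Scaling reduces this to a contraction: \<open>s\<close> exceeds the sum of all absolute
  entries, so \<open>W\<close> is at most \<open>s\<close> times the identity as a form, and
  \<open>sqrt s\<close> times the root of \<open>1 - X = W / s\<close> is the root of
  \<open>W\<close>.\<close>

lemma psd_root_exists:
  assumes W: "psd n W"
  shows "\<exists>U. psd n U \<and> U * U = W"
proof -
  note w = psdD[OF W]
  define s where "s = 1 + (\<Sum>i<n. \<Sum>j<n. \<bar>W $$ (i, j)\<bar>)"
  have s: "s > 0" by (auto simp: s_def intro!: add_pos_nonneg sum_nonneg)
  define X where "X = 1\<^sub>m n - (1 / s) \<cdot>\<^sub>m W"
  have X: "X \<in> carrier_mat n n" "transpose_mat X = X"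
    using w(1) symmetric_mat_index[OF w(1,2)] by (auto simp: X_def intro!: eq_matI)
  have form: "v \<bullet> (X *\<^sub>v v) = v \<bullet> v - (v \<bullet> (W *\<^sub>v v)) / s" if v: "v \<in> carrier_vec n" for v
  proof -
    have Wv: "W *\<^sub>v v \<in> carrier_vec n" using w(1) v by (simp add: mult_mat_vec_carrier)
    have "X *\<^sub>v v = v - (1 / s) \<cdot>\<^sub>v (W *\<^sub>v v)"
      using w(1) v unfolding X_def
      by (subst minus_mult_distrib_mat_vec[of _ n n]) (auto simp: smult_mat_mult_vec[of _ n n] intro!: eq_vecI)
    then show ?thesis using v Wv by (simp add: scalar_prod_minus_distrib[where n = n])
  qed
  have "v \<bullet> (W *\<^sub>v v) \<le> s * (v \<bullet> v)" if v: "v \<in> carrier_vec n" for v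
  proof -
    have vv: "v \<bullet> v = (\<Sum>i<n. (vec_index v i)\<^sup>2)"
      using v by (simp add: scalar_prod_def lessThan_atLeast0 power2_eq_square)
    have sq: "(vec_index v i)\<^sup>2 \<le> v \<bullet> v" if "i < n" for i
      unfolding vv using that by (intro member_le_sum) auto
    have "v \<bullet> (W *\<^sub>v v) \<le> (\<Sum>i<n. \<Sum>j<n. \<bar>W $$ (i, j)\<bar> * (v \<bullet> v))"
      unfolding bilinear_form_sum[OF w(1) v v]
    proof (intro sum_mono)
      fix i j assume "i \<in> {..<n}" "j \<in> {..<n}"
      then have ij: "i < n" "j < n" by auto
      have "\<bar>vec_index v i * vec_index v j\<bar> \<le> v \<bullet> v"
        using sq[OF ij(1)] sq[OF ij(2)] sum_squares_bound[of "\<bar>vec_index v i\<bar>" "\<bar>vec_index v j\<bar>"]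
        by (simp add: abs_mult)
      then have "\<bar>W $$ (i, j)\<bar> * \<bar>vec_index v i * vec_index v j\<bar> \<le> \<bar>W $$ (i, j)\<bar> * (v \<bullet> v)"
        by (intro mult_left_mono) auto
      moreover have "vec_index v i * W $$ (i, j) * vec_index v j \<le> \<bar>W $$ (i, j)\<bar> * \<bar>vec_index v i * vec_index v j\<bar>"
        using abs_ge_self[of "vec_index v i * W $$ (i, j) * vec_index v j"] by (simp add: abs_mult mult_ac)
      ultimately show "vec_index v i * W $$ (i, j) * vec_index v j \<le> \<bar>W $$ (i, j)\<bar> * (v \<bullet> v)" by linarith
    qed
    also have "\<dots> = (s - 1) * (v \<bullet> v)" by (simp add: s_def sum_distrib_right)
    also have "\<dots> \<le> s * (v \<bullet> v)" using scalar_prod_self_ge_0[of v] by (intro mult_right_mono) auto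
    finally show ?thesis .
  qed
  then have "v \<bullet> (X *\<^sub>v v) \<ge> 0" if "v \<in> carrier_vec n" for v
    using form[OF that] that s by (simp add: divide_le_eq mult.commute)
  then have "psd n X" using X by (auto simp: psd_def)
  moreover have "v \<bullet> (X *\<^sub>v v) \<le> v \<bullet> v" if "v \<in> carrier_vec n" for v
    using form[OF that] w(5)[OF that] s by simp
  ultimately obtain U where U: "psd n U" "U * U = 1\<^sub>m n - X"
    using psd_root_exists_contraction by blast
  note u = psdD[OF U(1)]
  have "psd n (sqrt s \<cdot>\<^sub>m U)"
    using u s by (auto simp: psd_def transpose_smult_mat smult_mat_mult_vec[of _ n n])
  moreover have "(sqrt s \<cdot>\<^sub>m U) * (sqrt s \<cdot>\<^sub>m U) = s \<cdot>\<^sub>m (U * U)"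
    using u(1) s by (auto simp: mult_smult_assoc_mat[of _ n n _ n] mult_smult_distrib[of _ n n _ n] intro!: eq_matI)
  moreover have "s \<cdot>\<^sub>m (U * U) = W"
    unfolding U(2) X_def using w s by (intro eq_matI) auto
  ultimately show ?thesis by metis
qed

lemma psd_sqrt:
  assumes "psd n W"
  shows "psd n (psd_sqrt W)" "psd_sqrt W * psd_sqrt W = W"
proof -
  have "\<exists>!U. psd (dim_row W) U \<and> U * U = W"
    using psd_root_exists[OF assms] psd_root_unique psdD(3)[OF assms] by metis
  from theI'[OF this] show "psd n (psd_sqrt W)" "psd_sqrt W * psd_sqrt W = W"
    unfolding psd_sqrt_def[symmetric] using psdD(3)[OF assms] by auto
qed

text \<open>The root is symmetric, so \<open>W\<close> is the Gram matrix of its columns. Apart from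
  its dimensions, this is all that the rounding analysis uses about the root.\<close>

lemma col_psd_sqrt_scalar_prod:
  assumes "psd n W" "i < n" "j < n"
  shows "col (psd_sqrt W) i \<bullet> col (psd_sqrt W) j = W $$ (i, j)"
proof -
  note U = psd_sqrt[OF assms(1)] and u = psdD[OF psd_sqrt(1)[OF assms(1)]]
  have "col (psd_sqrt W) i = row (psd_sqrt W) i"
    using u assms(2) by (metis row_transpose)
  moreover have "(psd_sqrt W * psd_sqrt W) $$ (i, j) = row (psd_sqrt W) i \<bullet> col (psd_sqrt W) j"
    using u assms(2,3) by simp
  ultimately show ?thesis using U(2) by simp
qed

subsection \<open>Linear functionals of a Gaussian vector\<close>

abbreviation (input) gdot :: "nat \<Rightarrow> (nat \<Rightarrow> real) \<Rightarrow> (nat \<Rightarrow> real) \<Rightarrow> real" where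
  "gdot n a g \<equiv> (\<Sum>i<n. a i * g i)"

lemma prob_space_std_gaussian: "prob_space (std_gaussian n)"
  unfolding std_gaussian_def by (intro prob_space_PiM prob_space_normal_density) simp

lemma measurable_std_gaussian_component [measurable]:
  assumes "i < n" shows "(\<lambda>g. g i) \<in> borel_measurable (std_gaussian n)"
proof -
  have "(\<lambda>g. g i) \<in> measurable (std_gaussian n) (density lborel (\<lambda>t. ennreal (std_normal_density t)))"
    unfolding std_gaussian_def using assms by (intro measurable_component_singleton) auto
  then show ?thesis by (simp add: measurable_def)
qed

lemma measurable_gdot [measurable]: "gdot n a \<in> borel_measurable (std_gaussian n)"
  by (intro borel_measurable_sum borel_measurable_times measurable_std_gaussian_component) auto

lemma std_gaussian_component_distributed:
  assumes "i < n"
  shows "distributed (std_gaussian n) lborel (\<lambda>g. g i) std_normal_density"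
proof -
  let ?N = "density lborel (\<lambda>t. ennreal (std_normal_density t))"
  have "distr (std_gaussian n) lborel (\<lambda>g. g i) = distr (std_gaussian n) ?N (\<lambda>g. g i)"
    by (rule distr_cong) auto
  also have "\<dots> = ?N"
    unfolding std_gaussian_def using assms
    by (intro distr_PiM_component prob_space_normal_density) auto
  finally show ?thesis using assms by (simp add: distributed_def)
qed

lemma std_gaussian_components_indep:
  assumes "n > 0"
  shows "prob_space.indep_vars (std_gaussian n) (\<lambda>_. borel) (\<lambda>i g. g i) {..<n}"
proof -
  let ?N = "density lborel (\<lambda>t. ennreal (std_normal_density t))"
  interpret prob_space "std_gaussian n" by (rule prob_space_std_gaussian)
  have N: "prob_space ?N" by (intro prob_space_normal_density) simp
  have "distr (std_gaussian n) borel (\<lambda>g. g i) = ?N" if "i < n" for i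
  proof -
    have "distr (std_gaussian n) borel (\<lambda>g. g i) = distr (std_gaussian n) ?N (\<lambda>g. g i)"
      by (rule distr_cong) auto
    also have "\<dots> = ?N"
      unfolding std_gaussian_def using that N by (intro distr_PiM_component) auto
    finally show ?thesis .
  qed
  then have "(\<Pi>\<^sub>M i\<in>{..<n}. distr (std_gaussian n) borel (\<lambda>g. g i)) = std_gaussian n"
    unfolding std_gaussian_def by (intro PiM_cong) auto
  \<comment> \<open>Points of the product space are extensional, so restricting them to the index
    set changes nothing.\<close>
  moreover have "distr (std_gaussian n) (\<Pi>\<^sub>M i\<in>{..<n}. borel) (\<lambda>g. \<lambda>i\<in>{..<n}. g i) = std_gaussian n"
  proof -
    have "distr (std_gaussian n) (\<Pi>\<^sub>M i\<in>{..<n}. borel) (\<lambda>g. \<lambda>i\<in>{..<n}. g i)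
        = distr (std_gaussian n) (std_gaussian n) (\<lambda>g. g)"
    proof (rule distr_cong)
      show "sets (\<Pi>\<^sub>M i\<in>{..<n}. borel) = sets (std_gaussian n)"
        unfolding std_gaussian_def by (intro sets_PiM_cong) auto
      show "(\<lambda>i\<in>{..<n}. g i) = g" if "g \<in> space (std_gaussian n)" for g
        using that by (auto simp: std_gaussian_def space_PiM)
    qed simp
    then show ?thesis by simp
  qed
  ultimately show ?thesis
    using assms by (subst indep_vars_iff_distr_eq_PiM') (auto simp: measurable_std_gaussian_component)
qed

lemma gdot_distributed:
  assumes "(\<Sum>i<n. (a i)\<^sup>2) > 0"
  shows "distributed (std_gaussian n) lborel (gdot n a) (normal_density 0 (sqrt (\<Sum>i<n. (a i)\<^sup>2)))"
proof -
  interpret prob_space "std_gaussian n" by (rule prob_space_std_gaussian)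
  \<comment> \<open>The sum rule for independent normal variables needs a positive deviation for
    each summand; zero coefficients are therefore removed first.\<close>
  let ?I = "{i. i < n \<and> a i \<noteq> 0}"
  have nz: "?I \<noteq> {}"
  proof
    assume "?I = {}"
    then have "\<forall>i<n. a i = 0" by auto
    with assms show False by simp
  qed
  then have n: "n > 0" by auto
  have dist: "distributed (std_gaussian n) lborel (\<lambda>g. a i * g i) (normal_density 0 \<bar>a i\<bar>)" if "i \<in> ?I" for i
    using normal_density_affine[OF std_gaussian_component_distributed[of i n], of "a i" 0] that by simp
  have "indep_vars (\<lambda>_. borel) (\<lambda>i g. g i) ?I"
    by (rule indep_vars_subset[OF std_gaussian_components_indep[OF n]]) auto
  then have "indep_vars (\<lambda>_. borel) (\<lambda>i g. a i * g i) ?I"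
    by (rule indep_vars_compose2[where Y = "\<lambda>i x. a i * x"]) auto
  then have "distributed (std_gaussian n) lborel (\<lambda>g. \<Sum>i\<in>?I. a i * g i)
      (normal_density (\<Sum>i\<in>?I. 0) (sqrt (\<Sum>i\<in>?I. \<bar>a i\<bar>\<^sup>2)))"
    using nz dist by (intro sum_indep_normal) auto
  moreover have "(\<Sum>i\<in>?I. a i * g i) = gdot n a g" for g
    by (rule sum.mono_neutral_left) auto
  moreover have "(\<Sum>i\<in>?I. \<bar>a i\<bar>\<^sup>2) = (\<Sum>i<n. (a i)\<^sup>2)"
    by (simp, rule sum.mono_neutral_left) auto
  ultimately show ?thesis by simp
qed

text \<open>The zero functional has no density and is treated apart; otherwise this is the second
  moment of a centred normal variable.\<close>

lemma gdot_square_integral: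
  "integrable (std_gaussian n) (\<lambda>g. (gdot n a g)\<^sup>2)"
  "(\<integral>g. (gdot n a g)\<^sup>2 \<partial>std_gaussian n) = (\<Sum>i<n. (a i)\<^sup>2)"
proof -
  have "integrable (std_gaussian n) (\<lambda>g. (gdot n a g)\<^sup>2) \<and>
      (\<integral>g. (gdot n a g)\<^sup>2 \<partial>std_gaussian n) = (\<Sum>i<n. (a i)\<^sup>2)"
  proof (cases "(\<Sum>i<n. (a i)\<^sup>2) = 0")
    case True
    then have "\<forall>i<n. a i = 0" by (simp add: sum_nonneg_eq_0_iff)
    then have "gdot n a g = 0" for g by simp
    with True show ?thesis by (simp del: sum_power2_eq_zero_iff)
  next
    case False
    then have pos: "(\<Sum>i<n. (a i)\<^sup>2) > 0" using sum_nonneg[of "{..<n}" "\<lambda>i. (a i)\<^sup>2"] by simp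
    note D = gdot_distributed[OF pos]
    have s: "sqrt (\<Sum>i<n. (a i)\<^sup>2) > 0" using pos by simp
    show ?thesis
      using distributed_integrable[OF D, of "\<lambda>t. t\<^sup>2"] distributed_integral[OF D, of "\<lambda>t. t\<^sup>2"]
        integrable_normal_moment[OF s, of 0 2] integral_normal_moment_even[OF s, of 0 1] pos
      by (simp add: normal_density_nonneg)
  qed
  then show "integrable (std_gaussian n) (\<lambda>g. (gdot n a g)\<^sup>2)"
    "(\<integral>g. (gdot n a g)\<^sup>2 \<partial>std_gaussian n) = (\<Sum>i<n. (a i)\<^sup>2)" by auto
qed

lemma gdot_mult_integral:
  "integrable (std_gaussian n) (\<lambda>g. gdot n a g * gdot n b g)"
  "(\<integral>g. gdot n a g * gdot n b g \<partial>std_gaussian n) = (\<Sum>i<n. a i * b i)"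
proof -
  have *: "gdot n a g * gdot n b g
      = ((gdot n (\<lambda>i. a i + b i) g)\<^sup>2 - (gdot n a g)\<^sup>2 - (gdot n b g)\<^sup>2) / 2" for g
    by (simp add: ring_distribs sum.distrib power2_eq_square)
  show "integrable (std_gaussian n) (\<lambda>g. gdot n a g * gdot n b g)"
    unfolding * by (intro integrable_divide Bochner_Integration.integrable_diff gdot_square_integral)
  have "(\<integral>g. gdot n a g * gdot n b g \<partial>std_gaussian n)
      = ((\<Sum>i<n. (a i + b i)\<^sup>2) - (\<Sum>i<n. (a i)\<^sup>2) - (\<Sum>i<n. (b i)\<^sup>2)) / 2"
    unfolding * by (simp add: gdot_square_integral)
  also have "\<dots> = (\<Sum>i<n. a i * b i)"
    by (simp add: power2_eq_square ring_distribs sum.distrib sum_distrib_left[symmetric] mult.commute)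
  finally show "(\<integral>g. gdot n a g * gdot n b g \<partial>std_gaussian n) = (\<Sum>i<n. a i * b i)" .
qed

text \<open>The value is \<open>(4 / 3)\<close> to the power \<open>3 / 2\<close>. Any exponent
  factor below \<open>1 / 2\<close> would give a finite integral; with \<open>1 / 8\<close> the tail
  rate becomes \<open>1 / 16\<close>.\<close>

definition gauss_weight :: real where
  "gauss_weight = (\<integral>t. std_normal_density t * (t\<^sup>2 * exp (t\<^sup>2 / 8)) \<partial>lborel)"

lemma gauss_weight_nonneg: "gauss_weight \<ge> 0"
  unfolding gauss_weight_def by (intro Bochner_Integration.integral_nonneg) auto

lemma gdot_weight_integral:
  assumes "(\<Sum>i<n. (a i)\<^sup>2) = 1"
  shows "integrable (std_gaussian n) (\<lambda>g. (gdot n a g)\<^sup>2 * exp ((gdot n a g)\<^sup>2 / 8))"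
    "(\<integral>g. (gdot n a g)\<^sup>2 * exp ((gdot n a g)\<^sup>2 / 8) \<partial>std_gaussian n) = gauss_weight"
proof -
  have D: "distributed (std_gaussian n) lborel (gdot n a) std_normal_density"
    using gdot_distributed[of a n] assms by simp
  \<comment> \<open>The exponents combine to \<open>- 3 / 8 * t^2\<close>, which belongs to a normal
    density of variance \<open>4 / 3\<close>; the outer \<open>sqrt (4 / 3)\<close> corrects the
    normalization.\<close>
  have eq: "std_normal_density t * (t\<^sup>2 * exp (t\<^sup>2 / 8))
      = sqrt (4 / 3) * (normal_density 0 (sqrt (4 / 3)) t * (t - 0) ^ 2)" for t
  proof -
    have "exp (- t\<^sup>2 / 2) * exp (t\<^sup>2 / 8) = exp (- t\<^sup>2 * 3 / 8)"
      by (simp flip: exp_add)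
    moreover have "sqrt (2 * pi * (4 / 3)) = sqrt (2 * pi) * sqrt (4 / 3)"
      by (rule real_sqrt_mult)
    ultimately show ?thesis by (simp add: normal_density_def)
  qed
  have "integrable lborel (\<lambda>t. std_normal_density t * (t\<^sup>2 * exp (t\<^sup>2 / 8)))"
    unfolding eq by (intro integrable_mult_right integrable_normal_moment) auto
  then show "integrable (std_gaussian n) (\<lambda>g. (gdot n a g)\<^sup>2 * exp ((gdot n a g)\<^sup>2 / 8))"
    using distributed_integrable[OF D, of "\<lambda>t. t\<^sup>2 * exp (t\<^sup>2 / 8)"] by simp
  show "(\<integral>g. (gdot n a g)\<^sup>2 * exp ((gdot n a g)\<^sup>2 / 8) \<partial>std_gaussian n) = gauss_weight"
    unfolding gauss_weight_def by (rule distributed_integral[OF D, symmetric]) auto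
qed

subsection \<open>Truncated Gaussian moments\<close>

lemma clip_bounds: "\<bar>clip x\<bar> \<le> 1" "\<bar>clip x\<bar> \<le> \<bar>x\<bar>"
  by (auto simp: clip_def)

lemma clip_0 [simp]: "clip 0 = 0"
  by (simp add: clip_def)

lemma measurable_clip [measurable]: "clip \<in> borel_measurable borel"
  unfolding clip_def by measurable

lemma abs_mult_clip_le: "0 \<le> p \<Longrightarrow> \<bar>p * clip x\<bar> \<le> p"
  using mult_left_mono[OF clip_bounds(1)[of x], of p] by (simp add: abs_mult)

lemma abs_scaled_clip_le: "p > 0 \<Longrightarrow> \<bar>p * clip (x / p)\<bar> \<le> \<bar>x\<bar>"
  using mult_left_mono[OF clip_bounds(2)[of "x / p"], of p] by (simp add: abs_mult)

text \<open>If neither argument is truncated, the error is 0. In general \<open>clip\<close> scales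
  each argument by a factor in \<open>[0, 1]\<close>, so the error never exceeds the product
  itself.\<close>

lemma clip_mult_error:
  "\<bar>clip x * clip y - x * y\<bar> \<le> \<bar>x * y\<bar> * (of_bool (\<bar>x\<bar> > 1) + of_bool (\<bar>y\<bar> > 1))"
proof (cases "\<bar>x\<bar> > 1 \<or> \<bar>y\<bar> > 1")
  case True
  have *: "\<exists>t. 0 \<le> t \<and> t \<le> 1 \<and> clip z = t * z" for z
  proof (cases "\<bar>z\<bar> \<le> 1")
    case True then show ?thesis by (intro exI[of _ 1]) (auto simp: clip_def)
  next
    case False then show ?thesis by (intro exI[of _ "1 / \<bar>z\<bar>"]) (auto simp: clip_def)
  qed
  obtain s t where st: "0 \<le> s" "s \<le> 1" "clip x = s * x" "0 \<le> t" "t \<le> 1" "clip y = t * y"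
    using *[of x] *[of y] by auto
  have "0 \<le> s * t" "s * t \<le> 1" using st by (auto simp: mult_le_one)
  have "clip x * clip y - x * y = - ((1 - s * t) * (x * y))" by (simp add: st algebra_simps)
  then have "\<bar>clip x * clip y - x * y\<bar> = (1 - s * t) * \<bar>x * y\<bar>"
    using \<open>s * t \<le> 1\<close> by (simp add: abs_mult)
  also have "\<dots> \<le> 1 * \<bar>x * y\<bar>" using \<open>0 \<le> s * t\<close> by (intro mult_right_mono) auto
  also have "\<dots> \<le> \<bar>x * y\<bar> * (of_bool (\<bar>x\<bar> > 1) + of_bool (\<bar>y\<bar> > 1))"
    using True mult_left_mono[of 1 "of_bool (\<bar>x\<bar> > 1) + of_bool (\<bar>y\<bar> > 1)" "\<bar>x * y\<bar>"] by auto
  finally show ?thesis .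
qed (auto simp: clip_def)

text \<open>On the event one has \<open>1 \<le> exp ((s^2 - \<tau>^2) / 16)\<close>. The
  arithmetic-geometric mean inequality squares the factor \<open>exp (s^2 / 16)\<close>, whence the
  weight \<open>1 / 8\<close>; the term in \<open>t\<close> gets the same weight only to make both
  terms alike.\<close>

lemma abs_mult_tail_le:
  fixes s t \<tau> :: real
  assumes "\<tau> \<ge> 0"
  shows "\<bar>s * t\<bar> * of_bool (\<bar>s\<bar> > \<tau>) \<le> exp (- \<tau>\<^sup>2 / 16) * (s\<^sup>2 * exp (s\<^sup>2 / 8) + t\<^sup>2 * exp (t\<^sup>2 / 8)) / 2"
proof (cases "\<bar>s\<bar> > \<tau>")
  case True
  define e where "e = exp (s\<^sup>2 / 16)"
  have ee: "exp (s\<^sup>2 / 8) = e\<^sup>2" by (simp add: e_def power2_eq_square flip: exp_add)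
  have "\<tau>\<^sup>2 \<le> s\<^sup>2" using True assms by (metis abs_le_square_iff abs_of_nonneg less_imp_le)
  then have "exp (\<tau>\<^sup>2 / 16) \<le> e" by (simp add: e_def)
  then have 1: "1 \<le> exp (- \<tau>\<^sup>2 / 16) * e" by (simp add: exp_minus field_simps)
  have "\<bar>s * t\<bar> = \<bar>s\<bar> * \<bar>t\<bar> * 1" by (simp add: abs_mult)
  also have "\<dots> \<le> \<bar>s\<bar> * \<bar>t\<bar> * (exp (- \<tau>\<^sup>2 / 16) * e)"
    by (intro mult_left_mono 1) auto
  also have "\<dots> = exp (- \<tau>\<^sup>2 / 16) * ((\<bar>s\<bar> * e) * \<bar>t\<bar>)" by simp
  also have "\<dots> \<le> exp (- \<tau>\<^sup>2 / 16) * ((s\<^sup>2 * e\<^sup>2 + t\<^sup>2) / 2)"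
  proof (intro mult_left_mono)
    show "(\<bar>s\<bar> * e) * \<bar>t\<bar> \<le> (s\<^sup>2 * e\<^sup>2 + t\<^sup>2) / 2"
      using sum_squares_bound[of "\<bar>s\<bar> * e" "\<bar>t\<bar>"] by (simp add: power_mult_distrib)
  qed simp
  also have "\<dots> \<le> exp (- \<tau>\<^sup>2 / 16) * ((s\<^sup>2 * e\<^sup>2 + t\<^sup>2 * exp (t\<^sup>2 / 8)) / 2)"
    using mult_left_mono[of 1 "exp (t\<^sup>2 / 8)" "t\<^sup>2"] by (intro mult_left_mono divide_right_mono add_left_mono) auto
  finally show ?thesis using True by (simp add: ee)
qed auto

lemma gdot_divide: "gdot n (\<lambda>i. a i / r) g = gdot n a g / r"
  by (simp add: sum_divide_distrib)

lemma integrable_clip_prod: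
  "integrable (std_gaussian n) (\<lambda>g. p * clip (gdot n a g / s) * (q * clip (gdot n b g / t)))"
proof -
  interpret prob_space "std_gaussian n" by (rule prob_space_std_gaussian)
  show ?thesis
  proof (rule integrable_const_bound[where B = "\<bar>p\<bar> * \<bar>q\<bar>"])
    show "AE g in std_gaussian n. norm (p * clip (gdot n a g / s) * (q * clip (gdot n b g / t))) \<le> \<bar>p\<bar> * \<bar>q\<bar>"
      using clip_bounds(1) by (auto simp: abs_mult intro!: mult_mono mult_left_le)
  qed measurable
qed

lemma integrable_abs_clip:
  "integrable (std_gaussian n) (\<lambda>g. \<bar>p * clip (gdot n a g / s)\<bar>)"
proof -
  interpret prob_space "std_gaussian n" by (rule prob_space_std_gaussian)
  show ?thesis
  proof (rule integrable_const_bound[where B = "\<bar>p\<bar>"])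
    show "AE g in std_gaussian n. norm \<bar>p * clip (gdot n a g / s)\<bar> \<le> \<bar>p\<bar>"
      using clip_bounds(1) by (auto simp: abs_mult intro!: mult_left_le)
  qed measurable
qed

text \<open>Without truncation the factors \<open>p1\<close> and \<open>p2\<close> cancel and the
  mean is exact. The conditions on \<open>\<tau>\<close> say that truncation forces the normalized
  functional beyond \<open>\<tau>\<close>. The column of the homogenizing sign is included through
  \<open>p1 = 1\<close>.\<close>

lemma gauss_clip_error:
  assumes r: "r > 0" "(\<Sum>i<n. (a i)\<^sup>2) = r\<^sup>2" and q: "q > 0" "(\<Sum>i<n. (b i)\<^sup>2) = q\<^sup>2"
    and pos: "p1 > 0" "p2 > 0" "T > 0" "\<tau> \<ge> 0" and \<tau>: "r * \<tau> \<le> p1 * T" "q * \<tau> \<le> p2 * T"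
  shows "\<bar>(\<integral>g. p1 * clip (gdot n a g / (p1 * T)) * (p2 * clip (gdot n b g / (p2 * T))) \<partial>std_gaussian n)
      - (\<Sum>i<n. a i * b i) / T\<^sup>2\<bar> \<le> r * q / T\<^sup>2 * (2 * gauss_weight * exp (- \<tau>\<^sup>2 / 16))"
proof -
  let ?G = "std_gaussian n"
  define s where "s = gdot n (\<lambda>i. a i / r)"
  define t where "t = gdot n (\<lambda>i. b i / q)"
  define F where "F = (\<lambda>g. p1 * clip (gdot n a g / (p1 * T)) * (p2 * clip (gdot n b g / (p2 * T))))"
  define h where "h = (\<lambda>x :: real. x\<^sup>2 * exp (x\<^sup>2 / 8))"
  have sr: "gdot n a g = r * s g" and tq: "gdot n b g = q * t g" for g
    unfolding s_def t_def gdot_divide using r q by simp_all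
  have na: "(\<Sum>i<n. (a i / r)\<^sup>2) = 1" and nb: "(\<Sum>i<n. (b i / q)\<^sup>2) = 1"
    using r q by (simp_all add: power_divide flip: sum_divide_distrib)
  have ih: "integrable ?G (\<lambda>g. h (s g))" "(\<integral>g. h (s g) \<partial>?G) = gauss_weight"
    "integrable ?G (\<lambda>g. h (t g))" "(\<integral>g. h (t g) \<partial>?G) = gauss_weight"
    unfolding h_def s_def t_def
    by (rule gdot_weight_integral(1)[OF na], rule gdot_weight_integral(2)[OF na],
        rule gdot_weight_integral(1)[OF nb], rule gdot_weight_integral(2)[OF nb])
  have iF: "integrable ?G F" unfolding F_def by (rule integrable_clip_prod)
  have ixy: "integrable ?G (\<lambda>g. gdot n a g * gdot n b g / T\<^sup>2)"
    by (intro integrable_divide gdot_mult_integral)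
  have pw: "\<bar>F g - gdot n a g * gdot n b g / T\<^sup>2\<bar>
      \<le> r * q / T\<^sup>2 * (exp (- \<tau>\<^sup>2 / 16) * (h (s g) + h (t g)))" for g
  proof -
    define x where "x = gdot n a g / (p1 * T)"
    define y where "y = gdot n b g / (p2 * T)"
    have "p1 * p2 * (x * y) = gdot n a g * gdot n b g / T\<^sup>2"
      using pos by (simp add: x_def y_def field_simps power2_eq_square)
    also have "\<dots> = r * q / T\<^sup>2 * (s g * t g)" by (simp add: sr tq)
    finally have xy: "p1 * p2 * (x * y) = r * q / T\<^sup>2 * (s g * t g)"
      "gdot n a g * gdot n b g / T\<^sup>2 = p1 * p2 * (x * y)"
      using pos by (simp_all add: x_def y_def field_simps power2_eq_square)
    have "\<bar>s g\<bar> > \<tau>" if "\<bar>x\<bar> > 1"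
    proof -
      have "p1 * T < r * \<bar>s g\<bar>" using that pos r by (simp add: x_def sr abs_mult field_simps)
      then have "r * \<tau> < r * \<bar>s g\<bar>" using \<tau>(1) by linarith
      then show ?thesis using r by simp
    qed
    then have 1: "of_bool (\<bar>x\<bar> > 1) \<le> (of_bool (\<bar>s g\<bar> > \<tau>) :: real)" by auto
    have "\<bar>t g\<bar> > \<tau>" if "\<bar>y\<bar> > 1"
    proof -
      have "p2 * T < q * \<bar>t g\<bar>" using that pos q by (simp add: y_def tq abs_mult field_simps)
      then have "q * \<tau> < q * \<bar>t g\<bar>" using \<tau>(2) by linarith
      then show ?thesis using q by simp
    qed
    then have 2: "of_bool (\<bar>y\<bar> > 1) \<le> (of_bool (\<bar>t g\<bar> > \<tau>) :: real)" by auto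
    have "\<bar>F g - gdot n a g * gdot n b g / T\<^sup>2\<bar> = p1 * p2 * \<bar>clip x * clip y - x * y\<bar>"
    proof -
      have "F g - gdot n a g * gdot n b g / T\<^sup>2 = p1 * p2 * (clip x * clip y - x * y)"
        unfolding xy(2) by (simp add: F_def x_def y_def algebra_simps)
      then show ?thesis using pos by (simp add: abs_mult)
    qed
    also have "\<dots> \<le> p1 * p2 * (\<bar>x * y\<bar> * (of_bool (\<bar>s g\<bar> > \<tau>) + of_bool (\<bar>t g\<bar> > \<tau>)))"
      using pos 1 2 by (intro mult_left_mono order_trans[OF clip_mult_error] add_mono) auto
    also have "\<dots> = \<bar>p1 * p2 * (x * y)\<bar> * (of_bool (\<bar>s g\<bar> > \<tau>) + of_bool (\<bar>t g\<bar> > \<tau>))"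
      using pos by (simp add: abs_mult)
    also have "\<dots> = r * q / T\<^sup>2 * (\<bar>s g * t g\<bar> * of_bool (\<bar>s g\<bar> > \<tau>) + \<bar>t g * s g\<bar> * of_bool (\<bar>t g\<bar> > \<tau>))"
      unfolding xy using r q by (simp add: abs_mult algebra_simps add_divide_distrib)
    \<comment> \<open>The tail bound is applied with each functional as the large one; the two
      halves add up to the full weight of both.\<close>
    also have "\<dots> \<le> r * q / T\<^sup>2 * (exp (- \<tau>\<^sup>2 / 16) * (h (s g) + h (t g)))"
      using abs_mult_tail_le[OF pos(4), of "s g" "t g"] abs_mult_tail_le[OF pos(4), of "t g" "s g"] r q
      by (intro mult_left_mono) (simp_all add: h_def algebra_simps)
    finally show ?thesis .
  qed
  have "\<bar>(\<integral>g. F g \<partial>?G) - (\<Sum>i<n. a i * b i) / T\<^sup>2\<bar>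
      = \<bar>\<integral>g. F g - gdot n a g * gdot n b g / T\<^sup>2 \<partial>?G\<bar>"
    using iF ixy by (simp add: gdot_mult_integral)
  also have "\<dots> \<le> (\<integral>g. \<bar>F g - gdot n a g * gdot n b g / T\<^sup>2\<bar> \<partial>?G)"
    by (rule integral_abs_bound)
  also have "\<dots> \<le> (\<integral>g. r * q / T\<^sup>2 * (exp (- \<tau>\<^sup>2 / 16) * (h (s g) + h (t g))) \<partial>?G)"
    using iF ixy ih pw by (intro integral_mono) auto
  also have "\<dots> = r * q / T\<^sup>2 * (2 * gauss_weight * exp (- \<tau>\<^sup>2 / 16))"
    using ih by simp
  finally show ?thesis unfolding F_def .
qed

text \<open>Discarding the truncation leaves a first absolute moment, which
  \<open>|G| \<le> (r + G^2 / r) / 2\<close> bounds by the second moment \<open>r^2\<close>.\<close>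

lemma gauss_abs_clip_le:
  assumes r: "r > 0" "(\<Sum>i<n. (a i)\<^sup>2) = r\<^sup>2" and pos: "p > 0" "T > 0"
  shows "(\<integral>g. \<bar>p * clip (gdot n a g / (p * T))\<bar> \<partial>std_gaussian n) \<le> r / T"
proof -
  interpret prob_space "std_gaussian n" by (rule prob_space_std_gaussian)
  have pw: "\<bar>p * clip (gdot n a g / (p * T))\<bar> \<le> (r + (gdot n a g)\<^sup>2 / r) / (2 * T)" for g
  proof -
    have "\<bar>p * clip (gdot n a g / (p * T))\<bar> \<le> \<bar>gdot n a g\<bar> / T"
      using abs_scaled_clip_le[of p "gdot n a g / T"] pos by (simp add: mult.commute)
    also have "\<dots> \<le> (r + (gdot n a g)\<^sup>2 / r) / (2 * T)"
    proof -
      have "2 * \<bar>gdot n a g\<bar> * r \<le> r\<^sup>2 + (gdot n a g)\<^sup>2"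
        using sum_squares_bound[of "\<bar>gdot n a g\<bar>" r] by simp
      then have "2 * \<bar>gdot n a g\<bar> \<le> r + (gdot n a g)\<^sup>2 / r"
        using r(1) by (simp add: field_simps power2_eq_square)
      then show ?thesis using pos by (simp add: field_simps)
    qed
    finally show ?thesis .
  qed
  have "(\<integral>g. \<bar>p * clip (gdot n a g / (p * T))\<bar> \<partial>std_gaussian n)
      \<le> (\<integral>g. (r + (gdot n a g)\<^sup>2 / r) / (2 * T) \<partial>std_gaussian n)"
    using gdot_square_integral(1) pw
    by (intro integral_mono integrable_abs_clip integrable_divide Bochner_Integration.integrable_add integrable_const)
  also have "\<dots> = (r + r) / (2 * T)"
    using gdot_square_integral[of n a] r by (simp add: prob_space power2_eq_square)
  finally show ?thesis by simp
qed

subsection \<open>The law of the output given the Gaussian vector\<close>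

lemma pmf_sample_ternary:
  assumes "\<bar>y\<bar> \<le> 1"
  shows "pmf (sample_ternary y) v = \<bar>y\<bar> * of_bool (v = sgn y) + (1 - \<bar>y\<bar>) * of_bool (v = 0)"
  using assms unfolding sample_ternary_def map_pmf_def
  by (simp add: pmf_bind indicator_def of_bool_def)

lemma expectation_sample_ternary:
  fixes f :: "real \<Rightarrow> real"
  assumes "\<bar>y\<bar> \<le> 1"
  shows "measure_pmf.expectation (sample_ternary y) f = \<bar>y\<bar> * f (sgn y) + (1 - \<bar>y\<bar>) * f 0"
  using assms by (simp add: sample_ternary_def)

lemma set_sample_ternary: "set_pmf (sample_ternary y) \<subseteq> {-1, 0, 1}"
  by (auto simp: sample_ternary_def sgn_if)

text \<open>A law of this family is determined by its mean, and an independent mask preserves the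
  sign while multiplying the probability of a nonzero value by \<open>p\<close>.\<close>

lemma sample_ternary_thinned:
  assumes "0 \<le> p" "p \<le> 1" "\<bar>y\<bar> \<le> 1"
  shows "do {e \<leftarrow> map_pmf of_bool (bernoulli_pmf p); sample_ternary (e * y)} = sample_ternary (p * y)"
proof (rule pmf_eqI)
  fix v
  have "pmf (do {e \<leftarrow> map_pmf of_bool (bernoulli_pmf p); sample_ternary (e * y)}) v
      = pmf (sample_ternary y) v * p + pmf (sample_ternary 0) v * (1 - p)"
    using assms(1,2) by (simp add: pmf_bind)
  also have "\<dots> = pmf (sample_ternary (p * y)) v"
    using assms by (cases "p = 0"; cases "y = 0")
      (auto simp: pmf_sample_ternary abs_mult mult_le_one sgn_mult algebra_simps)
  finally show "pmf (do {e \<leftarrow> map_pmf of_bool (bernoulli_pmf p); sample_ternary (e * y)}) v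
      = pmf (sample_ternary (p * y)) v" .
qed

lemma sample_ternary_masked:
  assumes "0 \<le> p" "p \<le> 1" "T > 0"
  shows "do {e \<leftarrow> map_pmf of_bool (bernoulli_pmf p); sample_ternary (clip (e / p * w / T))}
    = sample_ternary (p * clip (w / (p * T)))"
proof -
  \<comment> \<open>For \<open>e = 0\<close> both arguments are 0, for \<open>e = 1\<close> they
    agree. With \<open>p = 0\<close> the convention for division makes both vanish.\<close>
  have "do {e \<leftarrow> map_pmf of_bool (bernoulli_pmf p); sample_ternary (clip (e / p * w / T))}
      = do {e \<leftarrow> map_pmf of_bool (bernoulli_pmf p); sample_ternary (e * clip (w / (p * T)))}"
    by (rule bind_pmf_cong) auto
  then show ?thesis using sample_ternary_thinned[OF assms(1,2) clip_bounds(1)] by simp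
qed

text \<open>The conditional mean of the ternary sample with number \<open>k\<close>. The value 0
  beyond the dimension makes the bound by 1 hold for every index, in the form that the measurability
  lemmas ask for.\<close>

definition masked_mean :: "real mat \<Rightarrow> real \<Rightarrow> real \<Rightarrow> (nat \<Rightarrow> real) \<Rightarrow> nat \<Rightarrow> real" where
  "masked_mean W C T g k =
     (let u = col (psd_sqrt W) k; p = keep_prob C u
      in if k < dim_row W then p * clip (gdot (dim_row W) (vec_index u) g / (p * T)) else 0)"

abbreviation sign_mean :: "real mat \<Rightarrow> real \<Rightarrow> (nat \<Rightarrow> real) \<Rightarrow> real" where
  "sign_mean W T g \<equiv> clip (gdot (dim_row W) (vec_index (col (psd_sqrt W) 0)) g / T)"

text \<open>The Gaussian vector enters the law of the output only through the conditional means
  \<open>s\<close> and \<open>y\<close>. A Boolean coin in place of the sign makes expectations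
  two-term mixtures.\<close>

definition signed_vec_pmf :: "nat \<Rightarrow> real \<Rightarrow> (nat \<Rightarrow> real) \<Rightarrow> real vec pmf" where
  "signed_vec_pmf d s y = do {
     b \<leftarrow> bernoulli_pmf ((1 + s) / 2);
     map_pmf (\<lambda>x. (if b then 1 else -1) \<cdot>\<^sub>v vec d (\<lambda>i. x (i + 1))) (Pi_pmf {1..d} 0 (\<lambda>k. sample_ternary (y k)))}"

lemma scalar_prod_vec_gdot:
  assumes "u \<in> carrier_vec n" shows "u \<bullet> vec n g = gdot n (vec_index u) g"
  using assms by (simp add: scalar_prod_def lessThan_atLeast0)

text \<open>Sampling all masks and then all entries is the same as doing both coordinate by
  coordinate, because the product law commutes with \<open>bind\<close>; each coordinate is then a
  thinned ternary sample.\<close>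

lemma rounding_pmf_eq:
  assumes W: "psd (1 + d) W" and p: "\<And>k. k \<in> {1..d} \<Longrightarrow> keep_prob C (col (psd_sqrt W) k) \<in> {0..1}" and T: "T > 0"
  shows "rounding_pmf d W C T (vec (d + 1) g) = signed_vec_pmf d (sign_mean W T g) (masked_mean W C T g)"
proof -
  define u where "u = col (psd_sqrt W)"
  have dim: "dim_row W = d + 1" using psdD(3)[OF W] by simp
  have u: "u k \<in> carrier_vec (d + 1)" for k
    unfolding u_def using psdD(3)[OF psd_sqrt(1)[OF W]] by (intro carrier_vecI) simp
  have ug: "(c \<cdot>\<^sub>v u k) \<bullet> vec (d + 1) g = c * gdot (d + 1) (vec_index (u k)) g" for c k
    unfolding scalar_prod_vec_gdot[OF u, symmetric] by (rule smult_scalar_prod_distrib[OF u]) simp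
  have "(Pi_pmf {1..d} 0 (\<lambda>k. map_pmf of_bool (bernoulli_pmf (keep_prob C (u k)))) \<bind>
      (\<lambda>eps. Pi_pmf {1..d} 0 (\<lambda>k. sample_ternary (clip (((eps k / keep_prob C (u k)) \<cdot>\<^sub>v u k) \<bullet> vec (d + 1) g / T)))))
    = Pi_pmf {1..d} 0 (\<lambda>k. map_pmf of_bool (bernoulli_pmf (keep_prob C (u k))) \<bind>
        (\<lambda>e. sample_ternary (clip (e / keep_prob C (u k) * gdot (d + 1) (vec_index (u k)) g / T))))"
    unfolding ug by (rule Pi_pmf_bind[symmetric]) simp
  also have "\<dots> = Pi_pmf {1..d} 0 (\<lambda>k. sample_ternary (masked_mean W C T g k))"
  proof (intro Pi_pmf_cong refl)
    fix k assume k: "k \<in> {1..d}"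
    then have m: "masked_mean W C T g k =
        keep_prob C (u k) * clip (gdot (d + 1) (vec_index (u k)) g / (keep_prob C (u k) * T))"
      unfolding masked_mean_def Let_def dim u_def by auto
    show "map_pmf of_bool (bernoulli_pmf (keep_prob C (u k))) \<bind>
        (\<lambda>e. sample_ternary (clip (e / keep_prob C (u k) * gdot (d + 1) (vec_index (u k)) g / T)))
      = sample_ternary (masked_mean W C T g k)"
      unfolding m by (rule sample_ternary_masked) (use p[folded u_def, OF k] T in auto)
  qed
  finally have eq: "(Pi_pmf {1..d} 0 (\<lambda>k. map_pmf of_bool (bernoulli_pmf (keep_prob C (u k)))) \<bind>
      (\<lambda>eps. Pi_pmf {1..d} 0 (\<lambda>k. sample_ternary (clip (((eps k / keep_prob C (u k)) \<cdot>\<^sub>v u k) \<bullet> vec (d + 1) g / T)))))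
    = Pi_pmf {1..d} 0 (\<lambda>k. sample_ternary (masked_mean W C T g k))" .
  have "rounding_pmf d W C T (vec (d + 1) g) = do {
      x0 \<leftarrow> sample_binary (clip (gdot (d + 1) (vec_index (u 0)) g / T));
      x \<leftarrow> Pi_pmf {1..d} 0 (\<lambda>k. sample_ternary (masked_mean W C T g k));
      return_pmf (sgn x0 \<cdot>\<^sub>v vec d (\<lambda>i. x (i + 1)))}"
    unfolding rounding_pmf_def Let_def u_def[symmetric] eq[symmetric] scalar_prod_vec_gdot[OF u]
    by (simp add: bind_assoc_pmf)
  also have "\<dots> = signed_vec_pmf d (sign_mean W T g) (masked_mean W C T g)"
    unfolding signed_vec_pmf_def sample_binary_def dim u_def bind_map_pmf
    by (intro bind_pmf_cong refl) (simp add: map_pmf_def)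
  finally show ?thesis .
qed

section \<open>Finite support, measurability and integration over the Gaussian vector\<close>

definition ternary_vecs :: "nat \<Rightarrow> real vec set" where
  "ternary_vecs d = {v \<in> carrier_vec d. \<forall>i<d. vec_index v i \<in> {-1, 0, 1}}"

lemma finite_ternary_vecs: "finite (ternary_vecs d)"
proof (rule finite_subset)
  show "ternary_vecs d \<subseteq> vec d ` ({..<d} \<rightarrow>\<^sub>E {-1, 0, 1})"
  proof
    fix v assume "v \<in> ternary_vecs d"
    then have "v = vec d (restrict (vec_index v) {..<d})" "restrict (vec_index v) {..<d} \<in> {..<d} \<rightarrow>\<^sub>E {-1, 0, 1}"
      by (auto simp: ternary_vecs_def)
    then show "v \<in> vec d ` ({..<d} \<rightarrow>\<^sub>E {-1, 0, 1})" by blast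
  qed
qed (intro finite_imageI finite_PiE, auto)

lemma Pi_sample_ternary_support:
  fixes d :: nat
  assumes "x \<in> set_pmf (Pi_pmf {1..d} 0 (\<lambda>k. sample_ternary (y k)))"
  shows "x k \<in> {-1, 0, 1}"
proof -
  have "x \<in> PiE_dflt {1..d} 0 (set_pmf \<circ> (\<lambda>k. sample_ternary (y k)))"
    using assms by (simp only: set_Pi_pmf finite_atLeastAtMost)
  then have "x k \<in> (if k \<in> {1..d} then set_pmf (sample_ternary (y k)) else {0})"
    unfolding PiE_dflt_def by simp
  then show ?thesis using set_sample_ternary[of "y k"] by (auto split: if_splits)
qed

lemma finite_Pi_sample_ternary: "finite (set_pmf (Pi_pmf {1..d :: nat} 0 (\<lambda>k. sample_ternary (y k))))"
  unfolding set_Pi_pmf[OF finite_atLeastAtMost]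
  by (intro finite_PiE_dflt) (auto intro: finite_subset[OF set_sample_ternary])

lemma set_signed_vec_pmf: "set_pmf (signed_vec_pmf d s y) \<subseteq> ternary_vecs d"
proof
  fix v assume "v \<in> set_pmf (signed_vec_pmf d s y)"
  then obtain b x where x: "x \<in> set_pmf (Pi_pmf {1..d} 0 (\<lambda>k. sample_ternary (y k)))"
    and v: "v = (if b then 1 else -1) \<cdot>\<^sub>v vec d (\<lambda>i. x (i + 1))"
    unfolding signed_vec_pmf_def set_bind_pmf set_map_pmf by blast
  show "v \<in> ternary_vecs d"
    using Pi_sample_ternary_support[OF x] by (auto simp: v ternary_vecs_def)
qed

lemma expectation_signed_vec_pmf:
  fixes f :: "real vec \<Rightarrow> real"
  assumes "\<bar>s\<bar> \<le> 1"
  shows "measure_pmf.expectation (signed_vec_pmf d s y) f =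
    (1 + s) / 2 * measure_pmf.expectation (Pi_pmf {1..d} 0 (\<lambda>k. sample_ternary (y k))) (\<lambda>x. f (1 \<cdot>\<^sub>v vec d (\<lambda>i. x (i + 1)))) +
    (1 - s) / 2 * measure_pmf.expectation (Pi_pmf {1..d} 0 (\<lambda>k. sample_ternary (y k))) (\<lambda>x. f (- 1 \<cdot>\<^sub>v vec d (\<lambda>i. x (i + 1))))"
  unfolding signed_vec_pmf_def using assms
  by (subst pmf_expectation_bind[of UNIV])
    (simp_all only: set_map_pmf finite_imageI[OF finite_Pi_sample_ternary] finite UNIV_bool[symmetric] subset_UNIV,
      simp_all add: field_simps UNIV_bool)

text \<open>The index set of the sum does not depend on \<open>y\<close>, although the support does.
  In this form the expectation is visibly measurable in \<open>y\<close>.\<close>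

lemma Pi_expectation_sum:
  fixes f :: "(nat \<Rightarrow> real) \<Rightarrow> real"
  assumes "\<And>k. \<bar>y k\<bar> \<le> 1"
  shows "measure_pmf.expectation (Pi_pmf {1..d} 0 (\<lambda>k. sample_ternary (y k))) f =
    (\<Sum>x\<in>PiE_dflt {1..d} 0 (\<lambda>_. {-1, 0, 1}). f x *
      (\<Prod>k\<in>{1..d}. \<bar>y k\<bar> * of_bool (x k = sgn (y k)) + (1 - \<bar>y k\<bar>) * of_bool (x k = 0)))"
proof -
  have "measure_pmf.expectation (Pi_pmf {1..d} 0 (\<lambda>k. sample_ternary (y k))) f =
      (\<Sum>x\<in>PiE_dflt {1..d} 0 (\<lambda>_. {-1, 0, 1}). f x * pmf (Pi_pmf {1..d} 0 (\<lambda>k. sample_ternary (y k))) x)"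
  proof (rule integral_measure_pmf_real)
    show "finite (PiE_dflt {1..d} (0::real) (\<lambda>_. {-1, 0, 1}))" by (intro finite_PiE_dflt) auto
    show "x \<in> PiE_dflt {1..d} 0 (\<lambda>_. {-1, 0, 1})"
      if "x \<in> set_pmf (Pi_pmf {1..d} 0 (\<lambda>k. sample_ternary (y k)))" for x
      using Pi_sample_ternary_support[OF that] subsetD[OF set_Pi_pmf_subset that]
      unfolding PiE_dflt_def by blast
  qed
  also have "\<dots> = (\<Sum>x\<in>PiE_dflt {1..d} 0 (\<lambda>_. {-1, 0, 1}). f x *
      (\<Prod>k\<in>{1..d}. \<bar>y k\<bar> * of_bool (x k = sgn (y k)) + (1 - \<bar>y k\<bar>) * of_bool (x k = 0)))"
  proof (intro sum.cong refl arg_cong2[where f = "(*)"])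
    fix x :: "nat \<Rightarrow> real" assume "x \<in> PiE_dflt {1..d} 0 (\<lambda>_. {-1, 0, 1})"
    then have "\<And>k. k \<notin> {1..d} \<Longrightarrow> x k = 0" unfolding PiE_dflt_def by blast
    then show "pmf (Pi_pmf {1..d} 0 (\<lambda>k. sample_ternary (y k))) x =
      (\<Prod>k\<in>{1..d}. \<bar>y k\<bar> * of_bool (x k = sgn (y k)) + (1 - \<bar>y k\<bar>) * of_bool (x k = 0))"
      using assms by (subst pmf_Pi') (simp_all add: pmf_sample_ternary)
  qed
  finally show ?thesis .
qed

lemma measurable_expectation_signed_vec_pmf:
  fixes f :: "real vec \<Rightarrow> real"
  assumes [measurable]: "s \<in> borel_measurable M" "\<And>k. (\<lambda>g. y g k) \<in> borel_measurable M"
    and b: "\<And>g. \<bar>s g\<bar> \<le> 1" "\<And>g k. \<bar>y g k\<bar> \<le> 1"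
  shows "(\<lambda>g. measure_pmf.expectation (signed_vec_pmf d (s g) (y g)) f) \<in> borel_measurable M"
  unfolding expectation_signed_vec_pmf[OF b(1)] Pi_expectation_sum[OF b(2)] by measurable

lemma measurable_signed_vec_pmf:
  assumes "s \<in> borel_measurable M" "\<And>k. (\<lambda>g. y g k) \<in> borel_measurable M"
    and "\<And>g. \<bar>s g\<bar> \<le> 1" "\<And>g k. \<bar>y g k\<bar> \<le> 1"
  shows "(\<lambda>g. measure_pmf (signed_vec_pmf d (s g) (y g))) \<in> measurable M (subprob_algebra (count_space UNIV))"
proof (rule measurable_subprob_algebra)
  fix A :: "real vec set"
  have "(\<lambda>g. ennreal (measure_pmf.expectation (signed_vec_pmf d (s g) (y g)) (indicator A))) \<in> borel_measurable M"
    using measurable_expectation_signed_vec_pmf[OF assms] by measurable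
  then show "(\<lambda>g. emeasure (measure_pmf (signed_vec_pmf d (s g) (y g))) A) \<in> borel_measurable M"
    by (simp add: measure_pmf.emeasure_eq_measure)
qed (auto intro: prob_space_imp_subprob_space measure_pmf.prob_space_axioms)

lemma integral_bind_signed_vec_pmf:
  fixes f :: "real vec \<Rightarrow> real" and d :: nat
  assumes "prob_space M" and "s \<in> borel_measurable M" "\<And>k. (\<lambda>g. y g k) \<in> borel_measurable M"
    and "\<And>g. \<bar>s g\<bar> \<le> 1" "\<And>g k. \<bar>y g k\<bar> \<le> 1"
  defines "X \<equiv> Giry_Monad.bind M (\<lambda>g. measure_pmf (signed_vec_pmf d (s g) (y g)))"
  shows "(\<integral>x. f x \<partial>X) = (\<integral>g. measure_pmf.expectation (signed_vec_pmf d (s g) (y g)) f \<partial>M)"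
    "prob_space X" "sets X = UNIV"
proof -
  interpret prob_space M by fact
  note K = measurable_signed_vec_pmf[OF assms(2-5), of d]
  have ne: "space M \<noteq> {}" by (rule not_empty)
  show "prob_space X" unfolding X_def
    by (rule prob_space_bind[OF _ K]) (auto simp: measure_pmf.prob_space_axioms)
  show sX: "sets X = UNIV" unfolding X_def by (subst sets_bind[OF _ ne]) (auto intro: sets_measure_pmf)
  have AE: "AE x in X. x \<in> ternary_vecs d"
    unfolding X_def by (subst AE_bind[OF K]) (use set_signed_vec_pmf in \<open>simp_all add: AE_measure_pmf_iff subset_iff\<close>)
  \<comment> \<open>Integration against a mixture is available for bounded functions, and
    \<open>f\<close> is arbitrary. The output almost surely lies in a finite set, so
    \<open>f\<close> may be cut off outside it.\<close>
  define f' where "f' = (\<lambda>v. f v * indicator (ternary_vecs d) v)"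
  define b where "b = (\<Sum>v\<in>ternary_vecs d. \<bar>f v\<bar>)"
  have b: "\<bar>f' v\<bar> \<le> b" for v
    using finite_ternary_vecs[of d] member_le_sum[of v "ternary_vecs d" "\<lambda>v. \<bar>f v\<bar>"]
    by (cases "v \<in> ternary_vecs d") (auto simp: f'_def b_def intro!: sum_nonneg)
  have meas: "f' \<in> borel_measurable X" "f \<in> borel_measurable X"
    using sX by (auto simp: measurable_def)
  have "(\<integral>x. f x \<partial>X) = (\<integral>x. f' x \<partial>X)"
    using AE meas by (intro integral_cong_AE) (auto simp: f'_def)
  also have "\<dots> = (\<integral>g. measure_pmf.expectation (signed_vec_pmf d (s g) (y g)) f' \<partial>M)"
    unfolding X_def
    by (rule integral_bind[where K = "count_space UNIV" and B = b and B' = 1])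
      (use b K in \<open>auto intro: finite_measure_axioms\<close>)
  also have "\<dots> = (\<integral>g. measure_pmf.expectation (signed_vec_pmf d (s g) (y g)) f \<partial>M)"
    by (intro Bochner_Integration.integral_cong refl integral_cong_AE)
      (use subsetD[OF set_signed_vec_pmf] in \<open>auto simp: AE_measure_pmf_iff f'_def indicator_def\<close>)
  finally show "(\<integral>x. f x \<partial>X) = (\<integral>g. measure_pmf.expectation (signed_vec_pmf d (s g) (y g)) f \<partial>M)" .
qed

section \<open>Conditional moments, expected objective and sparsity\<close>

lemma Pi_sample_ternary_moments:
  fixes y :: "nat \<Rightarrow> real"
  assumes y: "\<And>k. \<bar>y k\<bar> \<le> 1" and k: "k \<in> {1..d}"
  defines "R \<equiv> Pi_pmf {1..d} 0 (\<lambda>k. sample_ternary (y k))"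
  shows "measure_pmf.expectation R (\<lambda>x. x k) = y k"
    "measure_pmf.expectation R (\<lambda>x. x k * x k) = \<bar>y k\<bar>"
    "l \<in> {1..d} \<Longrightarrow> k \<noteq> l \<Longrightarrow> measure_pmf.expectation R (\<lambda>x. x k * x l) = y k * y l"
proof -
  have marg: "measure_pmf.expectation R (\<lambda>x. f (x j)) = \<bar>y j\<bar> * f (sgn (y j)) + (1 - \<bar>y j\<bar>) * f 0"
    if "j \<in> {1..d}" for j and f :: "real \<Rightarrow> real"
  proof -
    have "measure_pmf.expectation R (\<lambda>x. f (x j)) = measure_pmf.expectation (map_pmf (\<lambda>x. x j) R) f"
      by simp
    also have "map_pmf (\<lambda>x. x j) R = sample_ternary (y j)"
      unfolding R_def using that by (subst Pi_pmf_component) auto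
    finally show ?thesis by (simp add: expectation_sample_ternary[OF y])
  qed
  have mean: "measure_pmf.expectation R (\<lambda>x. x j) = y j" if "j \<in> {1..d}" for j
    using marg[OF that, of "\<lambda>t. t"] by (simp add: abs_mult_sgn)
  then show "measure_pmf.expectation R (\<lambda>x. x k) = y k" using k .
  show "measure_pmf.expectation R (\<lambda>x. x k * x k) = \<bar>y k\<bar>"
    using marg[OF k, of "\<lambda>t. t * t"] by (cases "y k = 0") (auto simp: sgn_if)
  show "measure_pmf.expectation R (\<lambda>x. x k * x l) = y k * y l" if l: "l \<in> {1..d}" "k \<noteq> l"
  proof -
    have "prob_space.indep_vars (measure_pmf R) (\<lambda>_. count_space UNIV) (\<lambda>j x. x j) {1..d}"
      unfolding R_def by (rule indep_vars_Pi_pmf) simp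
    then have "prob_space.indep_vars (measure_pmf R) (\<lambda>_. count_space UNIV) (\<lambda>j x. x j) {k, l}"
      by (rule prob_space.indep_vars_subset[OF measure_pmf.prob_space_axioms]) (use k l in auto)
    then have "prob_space.indep_vars (measure_pmf R) (\<lambda>_. borel) (\<lambda>j x. x j) {k, l}"
      by (rule prob_space.indep_vars_compose2[OF measure_pmf.prob_space_axioms, where Y = "\<lambda>_ t. t"]) auto
    then have "measure_pmf.expectation R (\<lambda>x. \<Prod>j\<in>{k, l}. x j) = (\<Prod>j\<in>{k, l}. measure_pmf.expectation R (\<lambda>x. x j))"
      unfolding R_def
      by (intro prob_space.indep_vars_lebesgue_integral[OF measure_pmf.prob_space_axioms] integrable_measure_pmf_finite finite_Pi_sample_ternary) auto
    then show ?thesis using mean[OF k] mean[OF l(1)] l(2) by simp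
  qed
qed

lemma sbqp_objective_sum:
  assumes "P \<in> carrier_mat d d" "c \<in> carrier_vec d" "x \<in> carrier_vec d"
  shows "sbqp_objective c P x = (\<Sum>i<d. \<Sum>j<d. P $$ (i, j) * (vec_index x i * vec_index x j))
    - 2 * (\<Sum>i<d. vec_index c i * vec_index x i)"
  unfolding sbqp_objective_def bilinear_form_sum[OF assms(1,3,3)] using assms
  by (simp add: scalar_prod_def lessThan_atLeast0 mult_ac)

text \<open>A sign \<open>t\<close> with \<open>t * t = 1\<close> leaves the quadratic part
  unchanged; in the linear part it is replaced by its mean
  \<open>(1 + s) / 2 - (1 - s) / 2 = s\<close>.\<close>

lemma expectation_sbqp_objective:
  fixes y :: "nat \<Rightarrow> real"
  assumes P: "P \<in> carrier_mat d d" and c: "c \<in> carrier_vec d" and s: "\<bar>s\<bar> \<le> 1" and y: "\<And>k. \<bar>y k\<bar> \<le> 1"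
  shows "measure_pmf.expectation (signed_vec_pmf d s y) (sbqp_objective c P) =
    (\<Sum>i<d. \<Sum>j<d. P $$ (i, j) * (if i = j then \<bar>y (Suc i)\<bar> else y (Suc i) * y (Suc j)))
    - 2 * (\<Sum>i<d. vec_index c i * (s * y (Suc i)))"
proof -
  define R where "R = Pi_pmf {1..d} 0 (\<lambda>k. sample_ternary (y k))"
  have int: "integrable (measure_pmf R) f" for f :: "_ \<Rightarrow> real"
    unfolding R_def by (intro integrable_measure_pmf_finite finite_Pi_sample_ternary)
  have E: "measure_pmf.expectation R (\<lambda>x. sbqp_objective c P (t \<cdot>\<^sub>v vec d (\<lambda>i. x (i + 1))))
    = (\<Sum>i<d. \<Sum>j<d. P $$ (i, j) * (if i = j then \<bar>y (Suc i)\<bar> else y (Suc i) * y (Suc j)))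
      - 2 * t * (\<Sum>i<d. vec_index c i * y (Suc i))" if t: "t * t = 1" for t
  proof -
    have "sbqp_objective c P (t \<cdot>\<^sub>v vec d (\<lambda>i. x (i + 1))) =
        (\<Sum>i<d. \<Sum>j<d. P $$ (i, j) * (x (Suc i) * x (Suc j)))
        - 2 * t * (\<Sum>i<d. vec_index c i * x (Suc i))" for x
    proof -
      let ?v = "t \<cdot>\<^sub>v vec d (\<lambda>i. x (i + 1))"
      have v: "vec_index ?v i = t * x (Suc i)" if "i < d" for i using that by simp
      have vv: "vec_index ?v i * vec_index ?v j = x (Suc i) * x (Suc j)" if "i < d" "j < d" for i j
        unfolding v[OF that(1)] v[OF that(2)] using t by (metis mult.left_commute mult.assoc mult_1)
      have "(\<Sum>i<d. \<Sum>j<d. P $$ (i, j) * (vec_index ?v i * vec_index ?v j)) = (\<Sum>i<d. \<Sum>j<d. P $$ (i, j) * (x (Suc i) * x (Suc j)))"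
        using vv by (intro sum.cong refl) (simp add: mult.assoc)
      moreover have "(\<Sum>i<d. vec_index c i * vec_index ?v i) = t * (\<Sum>i<d. vec_index c i * x (Suc i))"
        unfolding sum_distrib_left by (intro sum.cong refl) (simp add: v)
      ultimately show ?thesis by (subst sbqp_objective_sum[OF P c]) simp_all
    qed
    then have "measure_pmf.expectation R (\<lambda>x. sbqp_objective c P (t \<cdot>\<^sub>v vec d (\<lambda>i. x (i + 1)))) =
        (\<Sum>i<d. \<Sum>j<d. P $$ (i, j) * measure_pmf.expectation R (\<lambda>x. x (Suc i) * x (Suc j)))
        - 2 * t * (\<Sum>i<d. vec_index c i * measure_pmf.expectation R (\<lambda>x. x (Suc i)))"
      using int by (simp add: Bochner_Integration.integral_diff Bochner_Integration.integral_sum)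
    also have "\<dots> = (\<Sum>i<d. \<Sum>j<d. P $$ (i, j) * (if i = j then \<bar>y (Suc i)\<bar> else y (Suc i) * y (Suc j)))
      - 2 * t * (\<Sum>i<d. vec_index c i * y (Suc i))"
      unfolding R_def using Pi_sample_ternary_moments[OF y]
      by (intro arg_cong2[where f = "(-)"] arg_cong2[where f = "(*)"] sum.cong refl) auto
    finally show ?thesis .
  qed
  define A where "A = (\<Sum>i<d. \<Sum>j<d. P $$ (i, j) * (if i = j then \<bar>y (Suc i)\<bar> else y (Suc i) * y (Suc j)))"
  define L where "L = (\<Sum>i<d. vec_index c i * y (Suc i))"
  have "1 * 1 = (1 :: real)" "- 1 * - 1 = (1 :: real)" by simp_all
  note E1 = E[OF this(1), folded A_def L_def] and E2 = E[OF this(2), folded A_def L_def]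
  have sL: "(\<Sum>i<d. vec_index c i * (s * y (Suc i))) = s * L"
    by (simp add: L_def sum_distrib_left mult.left_commute)
  show ?thesis
    unfolding expectation_signed_vec_pmf[OF s] R_def[symmetric] E1 E2 sL A_def[symmetric]
    by (simp add: field_simps)
qed

text \<open>Chernoff's bound with the exponential moment \<open>(3/2)\<^sup>N\<close> of the number \<open>N\<close> of nonzero entries.\<close>

lemma infeasible_prob_le:
  fixes y :: "nat \<Rightarrow> real"
  assumes s: "\<bar>s\<bar> \<le> 1" and y: "\<And>k. \<bar>y k\<bar> \<le> 1" and sum: "(\<Sum>k\<in>{1..d}. \<bar>y k\<bar>) \<le> 2 / 3 * real \<sigma>"
  shows "measure_pmf.expectation (signed_vec_pmf d s y) (\<lambda>v. of_bool (\<not> sbqp_feasible d \<sigma> v))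
    \<le> exp (- ((ln (3 / 2) - 1 / 3) * real \<sigma>))"
proof -
  define R where "R = Pi_pmf {1..d} 0 (\<lambda>k. sample_ternary (y k))"
  \<comment> \<open>With a base \<open>b > 1\<close> the argument gives the exponent
    \<open>((b - 1) * 2 / 3 - ln b) * \<sigma>\<close>, which is least at
    \<open>b = 3 / 2\<close>.\<close>
  define h where "h = (\<lambda>x :: nat \<Rightarrow> real. \<Prod>k\<in>{1..d}. if x k = 0 then 1 else 3 / 2 :: real)"
  have int: "integrable (measure_pmf R) f" for f :: "_ \<Rightarrow> real"
    unfolding R_def by (intro integrable_measure_pmf_finite finite_Pi_sample_ternary)
  have "measure_pmf.expectation R h = (\<Prod>k\<in>{1..d}. measure_pmf.expectation (sample_ternary (y k)) (\<lambda>t. if t = 0 then 1 else 3 / 2))"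
    unfolding h_def R_def
    by (rule expectation_prod_Pi_pmf)
      (auto intro!: integrable_measure_pmf_finite finite_subset[OF set_sample_ternary])
  also have "\<dots> = (\<Prod>k\<in>{1..d}. 1 + \<bar>y k\<bar> / 2)"
    by (intro prod.cong refl) (auto simp: expectation_sample_ternary[OF y] sgn_if field_simps)
  also have "\<dots> \<le> (\<Prod>k\<in>{1..d}. exp (\<bar>y k\<bar> / 2))"
    by (intro prod_mono conjI exp_ge_add_one_self add_nonneg_nonneg) auto
  also have "\<dots> = exp ((\<Sum>k\<in>{1..d}. \<bar>y k\<bar>) / 2)" by (simp add: exp_sum sum_divide_distrib)
  also have "\<dots> \<le> exp (real \<sigma> / 3)" using sum by simp
  finally have Eh: "measure_pmf.expectation R h \<le> exp (real \<sigma> / 3)" .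
  have half: "measure_pmf.expectation R (\<lambda>x. of_bool (\<not> sbqp_feasible d \<sigma> (t \<cdot>\<^sub>v vec d (\<lambda>i. x (i + 1)))))
      \<le> exp (- ((ln (3 / 2) - 1 / 3) * real \<sigma>))" if t: "t \<in> {1, -1}" for t
  proof -
    have "measure_pmf.expectation R (\<lambda>x. of_bool (\<not> sbqp_feasible d \<sigma> (t \<cdot>\<^sub>v vec d (\<lambda>i. x (i + 1)))))
        \<le> measure_pmf.expectation R (\<lambda>x. (2 / 3) ^ \<sigma> * h x)"
    proof (rule integral_mono_AE[OF int int], unfold AE_measure_pmf_iff, intro ballI)
      fix x assume "x \<in> set_pmf R"
      then have x: "x k \<in> {-1, 0, 1}" for k unfolding R_def by (rule Pi_sample_ternary_support)
      let ?v = "t \<cdot>\<^sub>v vec d (\<lambda>i. x (i + 1))"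
      have hx: "h x = (3 / 2) ^ card {k \<in> {1..d}. x k \<noteq> 0}"
        unfolding h_def by (subst prod.If_cases) (auto simp: Collect_neg_eq[symmetric] Int_def)
      have c: "card {i. i < d \<and> vec_index ?v i \<noteq> 0} = card {k \<in> {1..d}. x k \<noteq> 0}"
      proof (rule bij_betw_same_card[of Suc], rule bij_betwI[where g = "\<lambda>k. k - 1"])
      qed (use t in auto)
      show "of_bool (\<not> sbqp_feasible d \<sigma> ?v) \<le> (2 / 3) ^ \<sigma> * h x"
      proof (cases "sbqp_feasible d \<sigma> ?v")
        case False
        \<comment> \<open>The entries are admissible in any case, so infeasibility can only come
          from too many nonzero entries.\<close>
        moreover have "?v \<in> carrier_vec d" by simp
        moreover have "vec_index ?v i \<in> {-1, 0, 1}" if "i < d" for i using x[of "Suc i"] t that by auto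
        ultimately have "\<sigma> \<le> card {k \<in> {1..d}. x k \<noteq> 0}" unfolding sbqp_feasible_def c by auto
        then have "(3 / 2 :: real) ^ \<sigma> \<le> h x" unfolding hx by (intro power_increasing) auto
        then have "(2 / 3) ^ \<sigma> * (3 / 2 :: real) ^ \<sigma> \<le> (2 / 3) ^ \<sigma> * h x" by (intro mult_left_mono) auto
        then show ?thesis using False by (simp flip: power_mult_distrib)
      qed (auto simp: h_def intro!: mult_nonneg_nonneg prod_nonneg)
    qed
    also have "\<dots> \<le> (2 / 3) ^ \<sigma> * exp (real \<sigma> / 3)" using Eh by simp
    also have "(2 / 3 :: real) ^ \<sigma> = exp (- ln (3 / 2) * real \<sigma>)"
    proof -
      have "(2 / 3 :: real) = exp (- ln (3 / 2))" by (simp add: exp_minus)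
      then show ?thesis by (metis exp_of_nat_mult mult.commute)
    qed
    also have "\<dots> * exp (real \<sigma> / 3) = exp (- ((ln (3 / 2) - 1 / 3) * real \<sigma>))"
      by (simp add: algebra_simps flip: exp_add)
    finally show ?thesis .
  qed
  have "0 \<le> (1 + s) / 2" "0 \<le> (1 - s) / 2" using s by auto
  then have "measure_pmf.expectation (signed_vec_pmf d s y) (\<lambda>v. of_bool (\<not> sbqp_feasible d \<sigma> v))
    \<le> (1 + s) / 2 * exp (- ((ln (3 / 2) - 1 / 3) * real \<sigma>)) + (1 - s) / 2 * exp (- ((ln (3 / 2) - 1 / 3) * real \<sigma>))"
    unfolding expectation_signed_vec_pmf[OF s] R_def[symmetric]
    by (intro add_mono mult_left_mono half) auto
  also have "\<dots> = exp (- ((ln (3 / 2) - 1 / 3) * real \<sigma>))" by (simp add: field_simps)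
  finally show ?thesis .
qed

text \<open>Cubing reduces this to \<open>e < 27 / 8\<close>.\<close>

lemma ln_three_halves_gt: "ln (3 / 2) - 1 / 3 > (0 :: real)"
proof -
  have "exp (1 / 3 :: real) ^ 3 = exp 1" by (simp flip: exp_of_nat_mult)
  also have "\<dots> < (3 / 2) ^ 3" using e_less_272 by (simp add: power3_eq_cube)
  finally have "exp (1 / 3 :: real) < 3 / 2" using power_less_imp_less_base by fastforce
  also have "3 / 2 = exp (ln (3 / 2 :: real))" by simp
  finally show ?thesis unfolding exp_less_cancel_iff by simp
qed

subsection \<open>The semidefinite relaxation\<close>

text \<open>For \<open>T \<le> 1\<close> no cancellation is needed: the terms \<open>w / T\<^sup>2\<close> and \<open>v / T\<^sup>2\<close> are themselves covered by
  \<open>(3 \<sigma> + \<sigma>\<^sup>2) / T\<^sup>2\<close>, and the remaining ones are at most a multiple of \<open>\<sigma>\<^sup>2\<close>, which the truncation error dominates.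
  For \<open>T > 1\<close> the point is that the \<open>\<alpha> i\<close> vanish or are at least \<open>C\<close>, so that at most
  \<open>min {d, \<sigma> / C\<^sup>2}\<close> of them contribute.\<close>

lemma rounding_error_sum:
  fixes \<alpha> v f q :: "nat \<Rightarrow> real" and w e :: "nat \<Rightarrow> nat \<Rightarrow> real" and d \<sigma> :: nat
  assumes \<alpha>: "\<And>i. i < d \<Longrightarrow> \<alpha> i = 0 \<or> \<alpha> i \<ge> C" "\<And>i. i < d \<Longrightarrow> 0 \<le> \<alpha> i \<and> \<alpha> i \<le> 1"
    "(\<Sum>i<d. (\<alpha> i)\<^sup>2) \<le> real \<sigma>"
    and w: "(\<Sum>i<d. \<Sum>j<d. \<bar>w i j\<bar>) \<le> (real \<sigma>)\<^sup>2" and v: "(\<Sum>i<d. \<bar>v i\<bar>) \<le> real \<sigma>"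
    and par: "0 < \<sigma>" "\<sigma> \<le> d" "0 < C" "C \<le> 1" "0 < T" "0 \<le> M"
    and e: "\<And>i j. i < d \<Longrightarrow> j < d \<Longrightarrow> i \<noteq> j \<Longrightarrow> \<bar>e i j\<bar> \<le> 2 / 3 * (\<alpha> i)\<^sup>2 * (2 / 3 * (\<alpha> j)\<^sup>2)"
    "\<And>i j. i < d \<Longrightarrow> j < d \<Longrightarrow> i \<noteq> j \<Longrightarrow> \<bar>e i j - w i j / T\<^sup>2\<bar>
        \<le> \<alpha> i * \<alpha> j / T\<^sup>2 * (2 * M * exp (- (C\<^sup>2 * (1 / 6 * T)\<^sup>2))) + \<bar>w i j\<bar> / T\<^sup>2"
    and f: "\<And>i. i < d \<Longrightarrow> \<bar>f i\<bar> \<le> 2 / 3 * (\<alpha> i)\<^sup>2"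
    "\<And>i. i < d \<Longrightarrow> \<bar>f i - v i / T\<^sup>2\<bar>
        \<le> \<alpha> i / T\<^sup>2 * (2 * M * exp (- (C\<^sup>2 * (1 / 6 * T)\<^sup>2))) + \<bar>v i\<bar> / T\<^sup>2"
    and q: "\<And>i. i < d \<Longrightarrow> q i \<le> 2 / 3 * (\<alpha> i)\<^sup>2" "\<And>i. i < d \<Longrightarrow> q i \<le> \<alpha> i / T"
  shows "(\<Sum>i<d. q i) + (\<Sum>i<d. \<Sum>j<d. if i = j then 0 else \<bar>e i j - w i j / T\<^sup>2\<bar>)
      + 2 * (\<Sum>i<d. \<bar>f i - v i / T\<^sup>2\<bar>)
    \<le> trunc_error (M + 1) (1 / 6) T C \<sigma> d + 1 / T\<^sup>2 * (3 * real \<sigma> + (real \<sigma>)\<^sup>2)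
      + sqrt 3 / (sqrt 2 * T) * min (real d) (real \<sigma> / C\<^sup>2)"
proof -
  define m where "m = min (real d) (real \<sigma> / C\<^sup>2)"
  define E where "E = exp (- (C\<^sup>2 * (1 / 6 * T)\<^sup>2))"
  have C2: "0 < C\<^sup>2" "C\<^sup>2 \<le> 1" using par by (auto simp: power_le_one)
  have E: "E > 0" by (simp add: E_def)
  have m\<sigma>: "real \<sigma> \<le> m"
  proof -
    have "real \<sigma> * C\<^sup>2 \<le> real \<sigma> * 1" using C2 by (intro mult_left_mono) auto
    then show ?thesis using par C2 by (simp add: m_def le_divide_eq)
  qed
  have m1: "1 \<le> m" using m\<sigma> par(1) by linarith
  have tr: "trunc_error (M + 1) (1 / 6) T C \<sigma> d = (M + 1) * real \<sigma> * E * (m / (C * (1 / 6 * T)) + 1 / 6 * T / C)"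
    unfolding trunc_error_def E_def m_def by simp
  have sC: "sqrt 3 / (sqrt 2 * T) * m \<ge> m / T"
  proof -
    have "sqrt 3 \<ge> sqrt 2" by simp
    then have "1 \<le> sqrt 3 / sqrt 2" by simp
    then have "1 * (m / T) \<le> sqrt 3 / sqrt 2 * (m / T)" using m1 par by (intro mult_right_mono) auto
    then show ?thesis by simp
  qed
  \<comment> \<open>Both cases draw only on the first summand of the truncation error; the scale
    \<open>1 / 6\<close> produces the factor 6.\<close>
  have lower: "trunc_error (M + 1) (1 / 6) T C \<sigma> d \<ge> (M + 1) * real \<sigma> * E * (6 * m / (C * T))"
  proof -
    have "6 * m / (C * T) \<le> m / (C * (1 / 6 * T)) + 1 / 6 * T / C" using par by (simp add: field_simps)
    then show ?thesis unfolding tr using par E by (intro mult_left_mono) auto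
  qed
  show ?thesis
  proof (cases "T \<le> 1")
    case True
    have sp: "(\<Sum>i<d. 2 / 3 * (\<alpha> i)\<^sup>2) \<le> 2 / 3 * real \<sigma>"
      using \<alpha>(3) unfolding sum_distrib_left[symmetric] by linarith
    have sp0: "(\<Sum>i<d. 2 / 3 * (\<alpha> i)\<^sup>2) \<ge> 0" by (intro sum_nonneg) auto
    have "(\<Sum>i<d. q i) \<le> 2 / 3 * real \<sigma>"
      using sum_mono[of "{..<d}" q "\<lambda>i. 2 / 3 * (\<alpha> i)\<^sup>2"] q(1) sp by fastforce
    moreover have "(\<Sum>i<d. \<Sum>j<d. if i = j then 0 else \<bar>e i j - w i j / T\<^sup>2\<bar>) \<le> (2 / 3 * real \<sigma>)\<^sup>2 + (real \<sigma>)\<^sup>2 / T\<^sup>2"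
    proof -
      have "(\<Sum>i<d. \<Sum>j<d. if i = j then 0 else \<bar>e i j - w i j / T\<^sup>2\<bar>)
          \<le> (\<Sum>i<d. \<Sum>j<d. 2 / 3 * (\<alpha> i)\<^sup>2 * (2 / 3 * (\<alpha> j)\<^sup>2) + \<bar>w i j\<bar> / T\<^sup>2)"
      proof (intro sum_mono)
        fix i j assume "i \<in> {..<d}" "j \<in> {..<d}"
        then have "i < d" "j < d" by auto
        moreover have "\<bar>e i j - w i j / T\<^sup>2\<bar> \<le> \<bar>e i j\<bar> + \<bar>w i j\<bar> / T\<^sup>2"
          using abs_triangle_ineq4[of "e i j" "w i j / T\<^sup>2"] by (simp add: abs_divide)
        ultimately show "(if i = j then 0 else \<bar>e i j - w i j / T\<^sup>2\<bar>) \<le> 2 / 3 * (\<alpha> i)\<^sup>2 * (2 / 3 * (\<alpha> j)\<^sup>2) + \<bar>w i j\<bar> / T\<^sup>2"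
          using e(1)[of i j] by auto
      qed
      also have "\<dots> = (\<Sum>i<d. 2 / 3 * (\<alpha> i)\<^sup>2)\<^sup>2 + (\<Sum>i<d. \<Sum>j<d. \<bar>w i j\<bar>) / T\<^sup>2"
        unfolding sum.distrib power2_eq_square[of "sum _ _"] sum_product by (simp add: sum_divide_distrib)
      also have "\<dots> \<le> (2 / 3 * real \<sigma>)\<^sup>2 + (real \<sigma>)\<^sup>2 / T\<^sup>2"
        using w sp sp0 by (intro add_mono divide_right_mono power_mono) auto
      finally show ?thesis .
    qed
    moreover have "(\<Sum>i<d. \<bar>f i - v i / T\<^sup>2\<bar>) \<le> 2 / 3 * real \<sigma> + real \<sigma> / T\<^sup>2"
    proof -
      have "(\<Sum>i<d. \<bar>f i - v i / T\<^sup>2\<bar>) \<le> (\<Sum>i<d. 2 / 3 * (\<alpha> i)\<^sup>2 + \<bar>v i\<bar> / T\<^sup>2)"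
      proof (intro sum_mono)
        fix i assume "i \<in> {..<d}"
        then show "\<bar>f i - v i / T\<^sup>2\<bar> \<le> 2 / 3 * (\<alpha> i)\<^sup>2 + \<bar>v i\<bar> / T\<^sup>2"
          using f(1)[of i] abs_triangle_ineq4[of "f i" "v i / T\<^sup>2"] by (simp add: abs_divide)
      qed
      also have "\<dots> = (\<Sum>i<d. 2 / 3 * (\<alpha> i)\<^sup>2) + (\<Sum>i<d. \<bar>v i\<bar>) / T\<^sup>2"
        by (simp add: sum.distrib sum_divide_distrib)
      also have "\<dots> \<le> 2 / 3 * real \<sigma> + real \<sigma> / T\<^sup>2"
        using v sp by (intro add_mono divide_right_mono) auto
      finally show ?thesis .
    qed
    \<comment> \<open>The means contribute at most
      \<open>2 / 3 * \<sigma> + 4 / 9 * \<sigma>^2 + 4 / 3 * \<sigma>\<close>, which is below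
      \<open>3 * \<sigma>^2\<close>. As \<open>C T \<le> 1\<close>, the exponential is at least
      \<open>1 / 2\<close>, and the summand 1 in \<open>M + 1\<close> yields
      \<open>1 / 2 * 6 = 3\<close>.\<close>
    moreover have "3 * (real \<sigma>)\<^sup>2 \<le> trunc_error (M + 1) (1 / 6) T C \<sigma> d"
    proof -
      have "(C * T)\<^sup>2 \<le> 1" using par True by (simp add: power_mult_distrib power_le_one mult_le_one)
      then have "- (1 / 36) \<le> - (C\<^sup>2 * (1 / 6 * T)\<^sup>2)" by (simp add: power_mult_distrib power_divide)
      then have "1 / 2 \<le> E" unfolding E_def
        using exp_ge_add_one_self[of "- (C\<^sup>2 * (1 / 6 * T)\<^sup>2)"] by linarith
      have "real \<sigma> \<le> m / (C * T)"
      proof -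
        have "C * T \<le> 1" "0 < C * T" using par True by (simp_all add: mult_le_one)
        then have "m * (C * T) \<le> m * 1" using m1 by (intro mult_left_mono) auto
        then have "m \<le> m / (C * T)" using \<open>0 < C * T\<close> by (simp add: le_divide_eq)
        then show ?thesis using m\<sigma> by linarith
      qed
      then have "1 * real \<sigma> * (1 / 2) * (6 * real \<sigma>) \<le> (M + 1) * real \<sigma> * E * (6 * (m / (C * T)))"
        using par \<open>1 / 2 \<le> E\<close> by (intro mult_mono) auto
      then show ?thesis using lower by (simp add: power2_eq_square)
    qed
    moreover have "real \<sigma> \<le> (real \<sigma>)\<^sup>2" using par(1) by (simp add: power2_eq_square)
    moreover have "0 \<le> real \<sigma> / T\<^sup>2" by simp
    moreover have "0 \<le> sqrt 3 / (sqrt 2 * T) * m" using m1 par by (intro mult_nonneg_nonneg) auto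
    moreover have "1 / T\<^sup>2 * (3 * real \<sigma> + (real \<sigma>)\<^sup>2) = 3 * (real \<sigma> / T\<^sup>2) + (real \<sigma>)\<^sup>2 / T\<^sup>2"
      by (simp add: add_divide_distrib)
    moreover have "(2 / 3 * real \<sigma>)\<^sup>2 = 4 / 9 * (real \<sigma>)\<^sup>2" by (simp add: power_mult_distrib power2_eq_square)
    ultimately show ?thesis unfolding m_def[symmetric] by linarith
  next
    case False
    define A where "A = 2 * M * E"
    have A: "A \<ge> 0" using par E by (simp add: A_def)
    define S where "S = {i. i < d \<and> \<alpha> i \<noteq> 0}"
    have S: "finite S" "S \<subseteq> {..<d}" by (auto simp: S_def)
    have "real (card S) * C\<^sup>2 \<le> (\<Sum>i\<in>S. (\<alpha> i)\<^sup>2)"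
    proof -
      have "(\<Sum>i\<in>S. C\<^sup>2) \<le> (\<Sum>i\<in>S. (\<alpha> i)\<^sup>2)"
        using \<alpha>(1) par by (intro sum_mono power_mono) (auto simp: S_def)
      then show ?thesis by simp
    qed
    also have \<alpha>S: "(\<Sum>i\<in>S. (\<alpha> i)\<^sup>2) = (\<Sum>i<d. (\<alpha> i)\<^sup>2)"
      by (rule sum.mono_neutral_left) (auto simp: S_def)
    finally have "real (card S) * C\<^sup>2 \<le> real \<sigma>" using \<alpha>(3) by linarith
    moreover have "card S \<le> d" using card_mono[OF _ S(2)] by simp
    ultimately have cS: "real (card S) \<le> m" using C2 by (simp add: m_def le_divide_eq)
    have s\<alpha>: "(\<Sum>i<d. \<alpha> i) = (\<Sum>i\<in>S. \<alpha> i)" by (rule sum.mono_neutral_right) (auto simp: S_def)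
    have s0: "0 \<le> (\<Sum>i<d. \<alpha> i)" using \<alpha>(2) by (intro sum_nonneg) auto
    \<comment> \<open>Cauchy-Schwarz over the nonzero terms only, whose number is at most
      \<open>m\<close>.\<close>
    have sq: "(\<Sum>i<d. \<alpha> i)\<^sup>2 \<le> m * real \<sigma>"
    proof -
      have "(\<Sum>i<d. \<alpha> i)\<^sup>2 \<le> (\<Sum>i\<in>S. (\<alpha> i)\<^sup>2) * card S"
        unfolding s\<alpha> by (rule sum_squared_le_sum_of_squares)
      also have "\<dots> \<le> real \<sigma> * m" using \<alpha>(3) cS unfolding \<alpha>S by (intro mult_mono) (auto intro: sum_nonneg)
      finally show ?thesis by (simp add: mult.commute)
    qed
    have sC': "(\<Sum>i<d. \<alpha> i) \<le> real \<sigma> / C"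
    proof -
      have "(\<Sum>i<d. \<alpha> i * C) \<le> (\<Sum>i<d. (\<alpha> i)\<^sup>2)"
        using \<alpha> by (intro sum_mono) (fastforce simp: power2_eq_square intro: mult_left_mono)
      then show ?thesis using \<alpha>(3) par by (simp add: le_divide_eq sum_distrib_right)
    qed
    have "(\<Sum>i<d. q i) \<le> m / T"
    proof -
      have "(\<Sum>i<d. q i) \<le> (\<Sum>i<d. \<alpha> i / T)" using q(2) by (intro sum_mono) auto
      also have "\<dots> = (\<Sum>i\<in>S. \<alpha> i) / T" by (simp add: s\<alpha> flip: sum_divide_distrib)
      also have "\<dots> \<le> (\<Sum>i\<in>S. 1) / T"
        using \<alpha>(2) par by (intro divide_right_mono sum_mono) (auto simp: S_def)
      also have "\<dots> \<le> m / T" using cS par by (intro divide_right_mono) auto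
      finally show ?thesis .
    qed
    moreover have "(\<Sum>i<d. \<Sum>j<d. if i = j then 0 else \<bar>e i j - w i j / T\<^sup>2\<bar>) \<le> m * real \<sigma> / T\<^sup>2 * A + (real \<sigma>)\<^sup>2 / T\<^sup>2"
    proof -
      have "(\<Sum>i<d. \<Sum>j<d. if i = j then 0 else \<bar>e i j - w i j / T\<^sup>2\<bar>)
          \<le> (\<Sum>i<d. \<Sum>j<d. \<alpha> i * \<alpha> j / T\<^sup>2 * A + \<bar>w i j\<bar> / T\<^sup>2)"
        using e(2) \<alpha>(2) A unfolding A_def E_def by (intro sum_mono) auto
      also have "\<dots> = (\<Sum>i<d. \<Sum>j<d. \<alpha> i * \<alpha> j) / T\<^sup>2 * A + (\<Sum>i<d. \<Sum>j<d. \<bar>w i j\<bar>) / T\<^sup>2"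
        by (simp only: sum.distrib sum_divide_distrib sum_distrib_right)
      also have "(\<Sum>i<d. \<Sum>j<d. \<alpha> i * \<alpha> j) = (\<Sum>i<d. \<alpha> i)\<^sup>2"
        by (simp only: power2_eq_square sum_product)
      also have "(\<Sum>i<d. \<alpha> i)\<^sup>2 / T\<^sup>2 * A + (\<Sum>i<d. \<Sum>j<d. \<bar>w i j\<bar>) / T\<^sup>2 \<le> m * real \<sigma> / T\<^sup>2 * A + (real \<sigma>)\<^sup>2 / T\<^sup>2"
        using w sq A by (intro add_mono divide_right_mono mult_right_mono) auto
      finally show ?thesis .
    qed
    moreover have "(\<Sum>i<d. \<bar>f i - v i / T\<^sup>2\<bar>) \<le> real \<sigma> / C / T\<^sup>2 * A + real \<sigma> / T\<^sup>2"
    proof -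
      have "(\<Sum>i<d. \<bar>f i - v i / T\<^sup>2\<bar>) \<le> (\<Sum>i<d. \<alpha> i / T\<^sup>2 * A + \<bar>v i\<bar> / T\<^sup>2)"
        using f(2) unfolding A_def E_def by (intro sum_mono) auto
      also have "\<dots> = (\<Sum>i<d. \<alpha> i) / T\<^sup>2 * A + (\<Sum>i<d. \<bar>v i\<bar>) / T\<^sup>2"
        by (simp only: sum.distrib sum_divide_distrib sum_distrib_right)
      also have "\<dots> \<le> real \<sigma> / C / T\<^sup>2 * A + real \<sigma> / T\<^sup>2"
        using v sC' A by (intro add_mono divide_right_mono mult_right_mono) auto
      finally show ?thesis .
    qed
    \<comment> \<open>Since \<open>1 \<le> m\<close> and \<open>C \<le> 1\<close>, the bracket is at
      most \<open>3 * m / C\<close>, and \<open>T > 1\<close> allows \<open>T\<close> for its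
      square. The factor 2 in \<open>A\<close> turns 3 into the 6 of \<open>lower\<close>.\<close>
    moreover have "m * real \<sigma> / T\<^sup>2 * A + 2 * (real \<sigma> / C / T\<^sup>2 * A) \<le> trunc_error (M + 1) (1 / 6) T C \<sigma> d"
    proof -
      have "m * real \<sigma> / T\<^sup>2 * A + 2 * (real \<sigma> / C / T\<^sup>2 * A) = real \<sigma> * A * ((m + 2 / C) / T\<^sup>2)"
        using par by (simp add: field_simps)
      also have "\<dots> \<le> real \<sigma> * A * (3 * m / (C * T))"
      proof (intro mult_left_mono)
        have "m * C \<le> m * 1" using m1 par by (intro mult_left_mono) auto
        then have "m \<le> m / C" using par by (simp add: le_divide_eq)
        moreover have "2 / C \<le> 2 * m / C" using m1 par by (intro divide_right_mono) auto
        ultimately have "m + 2 / C \<le> 3 * m / C" by simp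
        then have "(m + 2 / C) / T\<^sup>2 \<le> 3 * m / C / T\<^sup>2" by (intro divide_right_mono) auto
        also have "\<dots> \<le> 3 * m / C / T"
          using False m1 par by (intro divide_left_mono) (auto simp: power2_eq_square)
        finally show "(m + 2 / C) / T\<^sup>2 \<le> 3 * m / (C * T)" by simp
      qed (use A in auto)
      also have "\<dots> = M * (real \<sigma> * E * (6 * m / (C * T)))" by (simp add: A_def)
      also have "\<dots> \<le> (M + 1) * (real \<sigma> * E * (6 * m / (C * T)))"
        using E m1 par by (intro mult_right_mono mult_nonneg_nonneg) auto
      finally show ?thesis using lower by (simp add: mult.assoc)
    qed
    moreover have "1 / T\<^sup>2 * (3 * real \<sigma> + (real \<sigma>)\<^sup>2) = 3 * (real \<sigma> / T\<^sup>2) + (real \<sigma>)\<^sup>2 / T\<^sup>2"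
      by (simp add: add_divide_distrib)
    moreover have "0 \<le> real \<sigma> / T\<^sup>2" by simp
    ultimately show ?thesis using sC unfolding m_def[symmetric] by linarith
  qed
qed

section \<open>The relaxation in coordinates and its comparison with the sparse problem\<close>

lemma mat_trace_sum: "mat_trace A = (\<Sum>i<dim_row A. A $$ (i, i))"
  by (simp add: mat_trace_def diag_mat_def interv_sum_list_conv_sum_set_nat lessThan_atLeast0)

lemma mat_delete_0_index:
  assumes "W \<in> carrier_mat (1 + d) (1 + d)" "i < d" "j < d"
  shows "mat_delete W 0 0 $$ (i, j) = W $$ (Suc i, Suc j)"
  using assms by (simp add: mat_delete_def)

lemma sdp_feasible_iff:
  "sdp_feasible d \<sigma> W \<longleftrightarrow> psd (1 + d) W \<and> W $$ (0, 0) = 1 \<and>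
    (\<Sum>i<d. W $$ (Suc i, Suc i)) \<le> real \<sigma> \<and>
    (\<Sum>i<d. \<Sum>j<d. \<bar>W $$ (Suc i, Suc j)\<bar>) \<le> (real \<sigma>)\<^sup>2 \<and> (\<forall>i<d. W $$ (Suc i, Suc i) \<le> 1)"
proof (cases "psd (1 + d) W")
  case True
  note W = psdD(1)[OF True]
  have "mat_trace (mat_delete W 0 0) = (\<Sum>i<d. W $$ (Suc i, Suc i))"
    using W mat_delete_dim[of W 0 0] by (simp add: mat_trace_sum mat_delete_0_index[OF W])
  moreover have "(\<Sum>i<d. \<Sum>j<d. \<bar>mat_delete W 0 0 $$ (i, j)\<bar>) = (\<Sum>i<d. \<Sum>j<d. \<bar>W $$ (Suc i, Suc j)\<bar>)"
    by (simp add: mat_delete_0_index[OF W])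
  ultimately show ?thesis
    unfolding sdp_feasible_def Let_def by (simp add: mat_delete_0_index[OF W] cong: conj_cong)
qed (simp add: sdp_feasible_def)

lemma sum_border:
  fixes F :: "nat \<Rightarrow> nat \<Rightarrow> real"
  shows "(\<Sum>i<1 + d. \<Sum>j<1 + d. F i j) = F 0 0 + (\<Sum>j<d. F 0 (Suc j)) + (\<Sum>i<d. F (Suc i) 0)
    + (\<Sum>i<d. \<Sum>j<d. F (Suc i) (Suc j))"
  by (simp only: plus_1_eq_Suc sum.lessThan_Suc_shift sum.distrib add_ac)

text \<open>Evaluate the form \<open>W\<close> at \<open>(- s, sgn W\<^sub>0\<^sub>1, \<dots>, sgn W\<^sub>0\<^sub>d)\<close>, where \<open>s\<close> is the left-hand side.\<close>

lemma sdp_first_row_sum: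
  assumes "sdp_feasible d \<sigma> W"
  shows "(\<Sum>i<d. \<bar>W $$ (0, Suc i)\<bar>) \<le> real \<sigma>"
proof -
  have W: "psd (1 + d) W" "W $$ (0, 0) = 1" "(\<Sum>i<d. \<Sum>j<d. \<bar>W $$ (Suc i, Suc j)\<bar>) \<le> (real \<sigma>)\<^sup>2"
    using assms by (auto simp: sdp_feasible_iff)
  note w = psdD[OF W(1)]
  define s where "s = (\<Sum>i<d. \<bar>W $$ (0, Suc i)\<bar>)"
  define y where "y = vec (1 + d) (\<lambda>k. if k = 0 then - s else sgn (W $$ (0, k)))"
  have y: "y \<in> carrier_vec (1 + d)" "vec_index y 0 = - s" "\<And>i. i < d \<Longrightarrow> vec_index y (Suc i) = sgn (W $$ (0, Suc i))"
    by (auto simp: y_def)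
  have s0: "s \<ge> 0" by (auto simp: s_def intro: sum_nonneg)
  have row: "(\<Sum>i<d. W $$ (0, Suc i) * vec_index y (Suc i)) = s"
    unfolding s_def by (intro sum.cong refl) (simp add: y(3) abs_sgn)
  have sym: "W $$ (Suc i, 0) = W $$ (0, Suc i)" if "i < d" for i
    using symmetric_mat_index[OF w(1,2), of "Suc i" 0] that by simp
  \<comment> \<open>The corner gives \<open>s^2\<close> and each border \<open>- s^2\<close>; the
    remaining block is at most \<open>\<sigma>^2\<close>, so
    \<open>s^2 \<le> \<sigma>^2\<close>.\<close>
  have "y \<bullet> (W *\<^sub>v y) = s * s - s * (\<Sum>i<d. W $$ (0, Suc i) * vec_index y (Suc i))
      - s * (\<Sum>i<d. W $$ (0, Suc i) * vec_index y (Suc i))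
      + (\<Sum>i<d. \<Sum>j<d. vec_index y (Suc i) * W $$ (Suc i, Suc j) * vec_index y (Suc j))"
    unfolding bilinear_form_sum[OF w(1) y(1) y(1)]
    unfolding sum_border y(2) W(2) by (simp add: sym sum_distrib_left sum_negf mult_ac)
  also have "(\<Sum>i<d. \<Sum>j<d. vec_index y (Suc i) * W $$ (Suc i, Suc j) * vec_index y (Suc j))
      \<le> (\<Sum>i<d. \<Sum>j<d. \<bar>W $$ (Suc i, Suc j)\<bar>)"
  proof (intro sum_mono)
    fix i j assume "i \<in> {..<d}" "j \<in> {..<d}"
    then have "\<bar>vec_index y (Suc i)\<bar> \<le> 1" "\<bar>vec_index y (Suc j)\<bar> \<le> 1" by (auto simp: y(3) abs_sgn_eq)
    then have "\<bar>vec_index y (Suc i)\<bar> * \<bar>W $$ (Suc i, Suc j)\<bar> * \<bar>vec_index y (Suc j)\<bar> \<le> 1 * \<bar>W $$ (Suc i, Suc j)\<bar> * 1"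
      by (intro mult_mono) auto
    then show "vec_index y (Suc i) * W $$ (Suc i, Suc j) * vec_index y (Suc j) \<le> \<bar>W $$ (Suc i, Suc j)\<bar>"
      by (metis abs_mult abs_le_D1 mult_1 mult_1_right)
  qed
  finally have "0 \<le> (real \<sigma>)\<^sup>2 - s * s" using w(5)[OF y(1)] W(3) row by simp
  then have "s\<^sup>2 \<le> (real \<sigma>)\<^sup>2" by (simp add: power2_eq_square)
  then show ?thesis using power2_le_imp_le[of s "real \<sigma>"] by (simp add: s_def)
qed

lemma Q_mat_index:
  assumes "P \<in> carrier_mat d d" "c \<in> carrier_vec d"
  shows "Q_mat c P \<in> carrier_mat (1 + d) (1 + d)" "Q_mat c P $$ (0, 0) = 0"
    "i < d \<Longrightarrow> Q_mat c P $$ (0, Suc i) = - vec_index c i"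
    "i < d \<Longrightarrow> Q_mat c P $$ (Suc i, 0) = - vec_index c i"
    "i < d \<Longrightarrow> j < d \<Longrightarrow> Q_mat c P $$ (Suc i, Suc j) = P $$ (i, j)"
  using assms by (auto simp: Q_mat_def mat_of_rows_def mat_of_cols_def four_block_mat_def Let_def)

lemma trace_Q_mat:
  assumes P: "P \<in> carrier_mat d d" and c: "c \<in> carrier_vec d" and W: "psd (1 + d) W"
  shows "mat_trace (Q_mat c P * W) = (\<Sum>i<d. \<Sum>j<d. P $$ (i, j) * W $$ (Suc i, Suc j))
    - 2 * (\<Sum>i<d. vec_index c i * W $$ (0, Suc i))"
proof -
  note w = psdD[OF W] and Q = Q_mat_index[OF P c]
  have sym: "W $$ (Suc i, 0) = W $$ (0, Suc i)" "j < d \<Longrightarrow> W $$ (Suc j, Suc i) = W $$ (Suc i, Suc j)" if "i < d" for i j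
    using symmetric_mat_index[OF w(1,2)] that by auto
  have "mat_trace (Q_mat c P * W) = (\<Sum>i<1 + d. \<Sum>j<1 + d. Q_mat c P $$ (i, j) * W $$ (j, i))"
    using Q(1) by (auto simp: mat_trace_sum mult_mat_index_sum[OF Q(1) w(1)])
  also have "\<dots> = (\<Sum>i<d. \<Sum>j<d. P $$ (i, j) * W $$ (Suc i, Suc j)) - 2 * (\<Sum>i<d. vec_index c i * W $$ (0, Suc i))"
    unfolding sum_border by (simp add: Q sym sum_negf)
  finally show ?thesis .
qed

lemma abs_index_le_max_norm_mat:
  assumes "i < dim_row A" "j < dim_col A"
  shows "\<bar>A $$ (i, j)\<bar> \<le> max_norm_mat A"
  unfolding max_norm_mat_def using assms
  by (intro Max_ge imageI elements_matI[OF _ assms refl] carrier_matI refl) (simp add: elements_mat_def)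

lemma max_norm_Q_mat:
  assumes "P \<in> carrier_mat d d" "c \<in> carrier_vec d"
  shows "i < d \<Longrightarrow> j < d \<Longrightarrow> \<bar>P $$ (i, j)\<bar> \<le> max_norm_mat (Q_mat c P)"
    "i < d \<Longrightarrow> \<bar>vec_index c i\<bar> \<le> max_norm_mat (Q_mat c P)" "0 \<le> max_norm_mat (Q_mat c P)"
  using abs_index_le_max_norm_mat[of "Suc i" "Q_mat c P" "Suc j"] abs_index_le_max_norm_mat[of 0 "Q_mat c P" "Suc i"]
    abs_index_le_max_norm_mat[of 0 "Q_mat c P" 0] Q_mat_index[OF assms] by auto

text \<open>Boundedness from below makes the infimum in \<open>sdp_value\<close> a true lower bound
  for the value of every feasible matrix.\<close>

lemma sdp_objective_ge:
  assumes P: "P \<in> carrier_mat d d" and c: "c \<in> carrier_vec d" and W: "sdp_feasible d \<sigma> W"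
  shows "sdp_objective c P W \<ge> - (max_norm_mat (Q_mat c P) * (real \<sigma>)\<^sup>2) - 2 * (max_norm_mat (Q_mat c P) * real \<sigma>)"
proof -
  let ?B = "max_norm_mat (Q_mat c P)"
  note B = max_norm_Q_mat[OF P c]
  have psd: "psd (1 + d) W" and w: "(\<Sum>i<d. \<Sum>j<d. \<bar>W $$ (Suc i, Suc j)\<bar>) \<le> (real \<sigma>)\<^sup>2"
    using W by (auto simp: sdp_feasible_iff)
  have "- (\<Sum>i<d. \<Sum>j<d. P $$ (i, j) * W $$ (Suc i, Suc j)) \<le> (\<Sum>i<d. \<Sum>j<d. ?B * \<bar>W $$ (Suc i, Suc j)\<bar>)"
    unfolding sum_negf[symmetric]
  proof (intro sum_mono)
    fix i j assume "i \<in> {..<d}" "j \<in> {..<d}"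
    then have "\<bar>P $$ (i, j)\<bar> * \<bar>W $$ (Suc i, Suc j)\<bar> \<le> ?B * \<bar>W $$ (Suc i, Suc j)\<bar>"
      using B(1) by (intro mult_right_mono) auto
    then show "- (P $$ (i, j) * W $$ (Suc i, Suc j)) \<le> ?B * \<bar>W $$ (Suc i, Suc j)\<bar>"
      by (metis abs_le_D2 abs_mult)
  qed
  also have "\<dots> \<le> ?B * (real \<sigma>)\<^sup>2"
    using w B(3) by (simp add: mult_left_mono flip: sum_distrib_left)
  finally have 1: "- (\<Sum>i<d. \<Sum>j<d. P $$ (i, j) * W $$ (Suc i, Suc j)) \<le> ?B * (real \<sigma>)\<^sup>2" .
  have "(\<Sum>i<d. vec_index c i * W $$ (0, Suc i)) \<le> (\<Sum>i<d. ?B * \<bar>W $$ (0, Suc i)\<bar>)"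
  proof (intro sum_mono)
    fix i assume "i \<in> {..<d}"
    then have "\<bar>vec_index c i\<bar> * \<bar>W $$ (0, Suc i)\<bar> \<le> ?B * \<bar>W $$ (0, Suc i)\<bar>"
      using B(2) by (intro mult_right_mono) auto
    then show "vec_index c i * W $$ (0, Suc i) \<le> ?B * \<bar>W $$ (0, Suc i)\<bar>"
      by (metis abs_le_D1 abs_mult)
  qed
  also have "\<dots> \<le> ?B * real \<sigma>"
    using sdp_first_row_sum[OF W] B(3) by (simp add: mult_left_mono flip: sum_distrib_left)
  finally show ?thesis using 1 by (simp add: sdp_objective_def trace_Q_mat[OF P c psd])
qed

text \<open>The rank-one matrix built from the vector \<open>(1, x)\<close> is feasible and has the
  objective value of \<open>x\<close>. For entries in \<open>{-1, 0, 1}\<close> its trace constraint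
  counts the nonzero entries.\<close>

lemma sdp_value_le_sbqp_objective:
  assumes P: "P \<in> carrier_mat d d" and c: "c \<in> carrier_vec d" and x: "sbqp_feasible d \<sigma> x"
  shows "sdp_value d \<sigma> c P \<le> sbqp_objective c P x"
proof -
  have xc: "x \<in> carrier_vec d" and xi: "\<And>i. i < d \<Longrightarrow> vec_index x i \<in> {-1, 0, 1}"
    and card: "card {i. i < d \<and> vec_index x i \<noteq> 0} \<le> \<sigma>"
    using x by (auto simp: sbqp_feasible_def)
  define z where "z = (\<lambda>i. if i = 0 then 1 else vec_index x (i - 1))"
  define W where "W = mat (1 + d) (1 + d) (\<lambda>(i, j). z i * z j)"
  have W: "W $$ (0, 0) = 1" "\<And>i. i < d \<Longrightarrow> W $$ (0, Suc i) = vec_index x i"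
    "\<And>i j. i < d \<Longrightarrow> j < d \<Longrightarrow> W $$ (Suc i, Suc j) = vec_index x i * vec_index x j"
    and Wc: "W \<in> carrier_mat (1 + d) (1 + d)"
    by (simp_all add: W_def z_def)
  have psd: "psd (1 + d) W"
    unfolding psd_def
  proof (intro conjI ballI)
    show "transpose_mat W = W" by (rule eq_matI) (auto simp: W_def)
    fix v :: "real vec" assume v: "v \<in> carrier_vec (1 + d)"
    have "v \<bullet> (W *\<^sub>v v) = (\<Sum>i<1 + d. vec_index v i * z i)\<^sup>2"
      unfolding bilinear_form_sum[OF Wc v v] power2_eq_square sum_product
      by (intro sum.cong refl) (simp add: W_def)
    then show "0 \<le> v \<bullet> (W *\<^sub>v v)" by simp
  qed (rule Wc)
  have abs_sum: "(\<Sum>i<d. \<bar>vec_index x i\<bar>) = real (card {i. i < d \<and> vec_index x i \<noteq> 0})"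
  proof -
    have "(\<Sum>i<d. \<bar>vec_index x i\<bar>) = (\<Sum>i<d. of_bool (vec_index x i \<noteq> 0))"
      using xi by (intro sum.cong refl) fastforce
    also have "\<dots> = real (card ({..<d} \<inter> {i. vec_index x i \<noteq> 0}))" by (simp add: sum_of_bool_eq)
    also have "{..<d} \<inter> {i. vec_index x i \<noteq> 0} = {i. i < d \<and> vec_index x i \<noteq> 0}" by auto
    finally show ?thesis .
  qed
  have "sdp_feasible d \<sigma> W"
    unfolding sdp_feasible_iff
  proof (intro conjI psd W(1) allI impI)
    have "(\<Sum>i<d. W $$ (Suc i, Suc i)) = (\<Sum>i<d. \<bar>vec_index x i\<bar>)"
      using xi by (intro sum.cong refl) (fastforce simp: W)
    then show "(\<Sum>i<d. W $$ (Suc i, Suc i)) \<le> real \<sigma>" using abs_sum card by simp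
    have "(\<Sum>i<d. \<Sum>j<d. \<bar>W $$ (Suc i, Suc j)\<bar>) = (\<Sum>i<d. \<bar>vec_index x i\<bar>)\<^sup>2"
      by (simp add: W abs_mult power2_eq_square sum_product)
    then show "(\<Sum>i<d. \<Sum>j<d. \<bar>W $$ (Suc i, Suc j)\<bar>) \<le> (real \<sigma>)\<^sup>2"
      using card by (simp add: abs_sum)
    show "W $$ (Suc i, Suc i) \<le> 1" if "i < d" for i
      using xi[OF that] that by (auto simp: W)
  qed
  moreover have "sdp_objective c P W = sbqp_objective c P x"
    unfolding sdp_objective_def trace_Q_mat[OF P c psd] sbqp_objective_sum[OF P c xc] by (simp add: W)
  moreover have "bdd_below (sdp_objective c P ` {W. sdp_feasible d \<sigma> W})"
    using sdp_objective_ge[OF P c] by (intro bdd_belowI2) auto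
  ultimately show ?thesis
    unfolding sdp_value_def by (metis (mono_tags, lifting) cINF_lower mem_Collect_eq)
qed

subsection \<open>The expected objective and the feasibility probability\<close>

lemma scalar_prod_self_sum:
  fixes u :: "real vec"
  assumes "u \<in> carrier_vec n" shows "u \<bullet> u = (\<Sum>i<n. (vec_index u i)\<^sup>2)"
  using assms by (simp add: scalar_prod_def lessThan_atLeast0 power2_eq_square)

lemma l2_norm_col_psd_sqrt:
  assumes "psd n W" "k < n"
  shows "(l2_norm_vec (col (psd_sqrt W) k))\<^sup>2 = W $$ (k, k)" "l2_norm_vec (col (psd_sqrt W) k) \<ge> 0"
  using col_psd_sqrt_scalar_prod[OF assms(1,2,2)] psd_diag_nonneg[OF assms]
  by (simp_all add: l2_norm_vec_def)

section \<open>The rounding of a fixed feasible matrix\<close>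

locale sbqp_rounding =
  fixes d \<sigma> :: nat and P W :: "real mat" and c :: "real vec" and C T :: real
  assumes P: "P \<in> carrier_mat d d" "\<forall>i<d. P $$ (i, i) \<ge> 0" and c: "c \<in> carrier_vec d"
    and W: "sdp_feasible d \<sigma> W" and par: "0 < \<sigma>" "\<sigma> \<le> d" "0 < C" "C \<le> 1" "0 < T"
begin

abbreviation "root_col \<equiv> col (psd_sqrt W)"

text \<open>Plays the part of \<open>\<alpha>\<close> in \<open>rounding_error_sum\<close>;
  coordinate \<open>i\<close> belongs to column \<open>Suc i\<close> of the root. It makes the
  keeping probability \<open>2 / 3\<close> times a square, with no case distinction.\<close>

definition kept_norm :: "nat \<Rightarrow> real" where
  "kept_norm i = (if l2_norm_vec (root_col (Suc i)) \<ge> C then l2_norm_vec (root_col (Suc i)) else 0)"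

lemma W_facts:
  "psd (1 + d) W" "W $$ (0, 0) = 1" "(\<Sum>i<d. W $$ (Suc i, Suc i)) \<le> real \<sigma>"
  "(\<Sum>i<d. \<Sum>j<d. \<bar>W $$ (Suc i, Suc j)\<bar>) \<le> (real \<sigma>)\<^sup>2" "i < d \<Longrightarrow> W $$ (Suc i, Suc i) \<le> 1"
  "dim_row W = 1 + d"
  using W psdD(3)[of "1 + d" W] unfolding sdp_feasible_iff by auto

lemma root_col_carrier: "root_col k \<in> carrier_vec (1 + d)"
  using psdD(3)[OF psd_sqrt(1)[OF W_facts(1)]] by (intro carrier_vecI) simp

lemma root_col_sq_sum: "k < 1 + d \<Longrightarrow> (\<Sum>l<1 + d. (vec_index (root_col k) l)\<^sup>2) = (l2_norm_vec (root_col k))\<^sup>2"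
  unfolding l2_norm_col_psd_sqrt[OF W_facts(1)] scalar_prod_self_sum[OF root_col_carrier, symmetric]
  by (rule col_psd_sqrt_scalar_prod[OF W_facts(1)])

lemma root_col_prod_sum:
  assumes "k < 1 + d" "l < 1 + d"
  shows "(\<Sum>i<1 + d. vec_index (root_col k) i * vec_index (root_col l) i) = W $$ (k, l)"
  using col_psd_sqrt_scalar_prod[OF W_facts(1) assms] root_col_carrier[of l]
  by (simp only: scalar_prod_def lessThan_atLeast0 carrier_vecD)

lemma root_col_0_norm: "l2_norm_vec (root_col 0) = 1"
  using l2_norm_col_psd_sqrt[OF W_facts(1), of 0] W_facts(2) power2_eq_1_iff[of "l2_norm_vec (root_col 0)"] by auto

lemma kept_norm_facts:
  assumes "i < d"
  shows "kept_norm i = 0 \<or> kept_norm i \<ge> C" "0 \<le> kept_norm i" "kept_norm i \<le> 1"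
    "(kept_norm i)\<^sup>2 \<le> W $$ (Suc i, Suc i)" "keep_prob C (root_col (Suc i)) = 2 / 3 * (kept_norm i)\<^sup>2"
proof -
  note n = l2_norm_col_psd_sqrt[OF W_facts(1), of "Suc i"]
  have "(l2_norm_vec (root_col (Suc i)))\<^sup>2 \<le> 1" using n W_facts(5)[OF assms] assms by simp
  then have "l2_norm_vec (root_col (Suc i)) \<le> 1" using power2_le_imp_le[of "l2_norm_vec (root_col (Suc i))" 1] by simp
  then show "kept_norm i = 0 \<or> kept_norm i \<ge> C" "0 \<le> kept_norm i" "kept_norm i \<le> 1"
    "(kept_norm i)\<^sup>2 \<le> W $$ (Suc i, Suc i)" "keep_prob C (root_col (Suc i)) = 2 / 3 * (kept_norm i)\<^sup>2"
    using n assms psd_diag_nonneg[OF W_facts(1), of "Suc i"] by (auto simp: kept_norm_def keep_prob_def)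
qed

lemma kept_norm_sq_sum: "(\<Sum>i<d. (kept_norm i)\<^sup>2) \<le> real \<sigma>"
  using sum_mono[of "{..<d}" "\<lambda>i. (kept_norm i)\<^sup>2" "\<lambda>i. W $$ (Suc i, Suc i)"] kept_norm_facts(4) W_facts(3)
  by fastforce

lemma masked_mean_Suc:
  assumes "i < d"
  shows "masked_mean W C T g (Suc i) = 2 / 3 * (kept_norm i)\<^sup>2 *
    clip (gdot (1 + d) (vec_index (root_col (Suc i))) g / (2 / 3 * (kept_norm i)\<^sup>2 * T))"
  unfolding masked_mean_def Let_def W_facts(6) kept_norm_facts(5)[OF assms] using assms by simp

lemma sign_mean_eq: "sign_mean W T g = 1 * clip (gdot (1 + d) (vec_index (root_col 0)) g / (1 * T))"
  unfolding W_facts(6) by simp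

lemma keep_prob_bounds:
  assumes "k < 1 + d" shows "keep_prob C (root_col k) \<in> {0..1}"
proof (cases k)
  case 0
  then show ?thesis using par by (simp add: keep_prob_def root_col_0_norm)
next
  case (Suc i)
  then have i: "i < d" using assms by simp
  have "(kept_norm i)\<^sup>2 \<le> 1" using kept_norm_facts(2,3)[OF i] by (simp add: power_le_one)
  then show ?thesis unfolding Suc kept_norm_facts(5)[OF i] by simp
qed

lemma abs_masked_mean_le: "\<bar>masked_mean W C T g k\<bar> \<le> 1"
  using keep_prob_bounds[of k] clip_bounds(1)
  by (auto simp: masked_mean_def Let_def W_facts(6) abs_mult intro!: mult_le_one)

lemma measurable_masked_mean: "(\<lambda>g. masked_mean W C T g k) \<in> borel_measurable (std_gaussian (1 + d))"
  unfolding masked_mean_def Let_def W_facts(6) by measurable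

lemma measurable_sign_mean: "sign_mean W T \<in> borel_measurable (std_gaussian (1 + d))"
  unfolding sign_mean_eq by measurable

lemma rounding_output_eq:
  "rounding_output d W C T =
    Giry_Monad.bind (std_gaussian (1 + d)) (\<lambda>g. measure_pmf (signed_vec_pmf d (sign_mean W T g) (masked_mean W C T g)))"
  unfolding rounding_output_def using rounding_pmf_eq[OF W_facts(1) keep_prob_bounds par(5)]
  by (simp add: add.commute)

lemma rounding_output_integral:
  fixes f :: "real vec \<Rightarrow> real"
  shows "(\<integral>x. f x \<partial>rounding_output d W C T) = (\<integral>g. measure_pmf.expectation
      (signed_vec_pmf d (sign_mean W T g) (masked_mean W C T g)) f \<partial>std_gaussian (1 + d))"
    "prob_space (rounding_output d W C T)" "sets (rounding_output d W C T) = UNIV"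
  unfolding rounding_output_eq
  by (rule integral_bind_signed_vec_pmf[OF prob_space_std_gaussian measurable_sign_mean measurable_masked_mean
      clip_bounds(1) abs_masked_mean_le])+

abbreviation "pair_mean i j \<equiv> (\<integral>g. masked_mean W C T g (Suc i) * masked_mean W C T g (Suc j) \<partial>std_gaussian (1 + d))"
abbreviation "abs_mean i \<equiv> (\<integral>g. \<bar>masked_mean W C T g (Suc i)\<bar> \<partial>std_gaussian (1 + d))"
abbreviation "sign_pair_mean i \<equiv> (\<integral>g. sign_mean W T g * masked_mean W C T g (Suc i) \<partial>std_gaussian (1 + d))"

lemma integrable_means:
  assumes "i < d"
  shows "j < d \<Longrightarrow> integrable (std_gaussian (1 + d)) (\<lambda>g. masked_mean W C T g (Suc i) * masked_mean W C T g (Suc j))"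
    "integrable (std_gaussian (1 + d)) (\<lambda>g. \<bar>masked_mean W C T g (Suc i)\<bar>)"
    "integrable (std_gaussian (1 + d)) (\<lambda>g. sign_mean W T g * masked_mean W C T g (Suc i))"
  unfolding sign_mean_eq by (simp_all only: masked_mean_Suc assms integrable_clip_prod integrable_abs_clip)

lemma expected_objective:
  "(\<integral>x. sbqp_objective c P x \<partial>rounding_output d W C T) =
    (\<Sum>i<d. \<Sum>j<d. P $$ (i, j) * (if i = j then abs_mean i else pair_mean i j)) - 2 * (\<Sum>i<d. vec_index c i * sign_pair_mean i)"
proof -
  define F where "F = (\<lambda>i j g. P $$ (i, j) * (if i = j then \<bar>masked_mean W C T g (Suc i)\<bar>
      else masked_mean W C T g (Suc i) * masked_mean W C T g (Suc j)))"
  define H where "H = (\<lambda>i g. vec_index c i * (sign_mean W T g * masked_mean W C T g (Suc i)))"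
  have iF: "integrable (std_gaussian (1 + d)) (F i j)" if "i < d" "j < d" for i j
    using integrable_means(1)[OF that] integrable_means(2)[OF that(1)] unfolding F_def by (cases "i = j") simp_all
  have iH: "integrable (std_gaussian (1 + d)) (H i)" if "i < d" for i
    using integrable_means(3)[OF that] unfolding H_def by (rule integrable_mult_right)
  have iSF: "integrable (std_gaussian (1 + d)) (\<lambda>g. \<Sum>i<d. \<Sum>j<d. F i j g)"
    and iSH: "integrable (std_gaussian (1 + d)) (\<lambda>g. \<Sum>i<d. H i g)"
    using iF iH by (auto intro!: Bochner_Integration.integrable_sum)
  have "(\<integral>x. sbqp_objective c P x \<partial>rounding_output d W C T) =
      (\<integral>g. (\<Sum>i<d. \<Sum>j<d. F i j g) - 2 * (\<Sum>i<d. H i g) \<partial>std_gaussian (1 + d))"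
    unfolding rounding_output_integral(1) F_def H_def
    by (intro Bochner_Integration.integral_cong refl expectation_sbqp_objective P(1) c clip_bounds abs_masked_mean_le)
  also have "\<dots> = (\<integral>g. (\<Sum>i<d. \<Sum>j<d. F i j g) \<partial>std_gaussian (1 + d)) - 2 * (\<integral>g. (\<Sum>i<d. H i g) \<partial>std_gaussian (1 + d))"
    by (simp only: Bochner_Integration.integral_diff[OF iSF integrable_mult_right[OF iSH]] integral_mult_right_zero)
  also have "(\<integral>g. (\<Sum>i<d. H i g) \<partial>std_gaussian (1 + d)) = (\<Sum>i<d. \<integral>g. H i g \<partial>std_gaussian (1 + d))"
    by (rule Bochner_Integration.integral_sum) (use iH in auto)
  also have "(\<Sum>i<d. \<integral>g. H i g \<partial>std_gaussian (1 + d)) = (\<Sum>i<d. vec_index c i * sign_pair_mean i)"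
    unfolding H_def by (simp only: integral_mult_right_zero)
  also have "(\<integral>g. (\<Sum>i<d. \<Sum>j<d. F i j g) \<partial>std_gaussian (1 + d)) = (\<Sum>i<d. \<Sum>j<d. \<integral>g. F i j g \<partial>std_gaussian (1 + d))"
    by (subst Bochner_Integration.integral_sum)
      (use iF in \<open>auto intro!: Bochner_Integration.integrable_sum Bochner_Integration.integral_sum sum.cong\<close>)
  also have "\<dots> = (\<Sum>i<d. \<Sum>j<d. P $$ (i, j) * (if i = j then abs_mean i else pair_mean i j))"
    unfolding F_def by (intro sum.cong refl) auto
  finally show ?thesis .
qed

text \<open>These are the hypotheses of \<open>rounding_error_sum\<close>. A dropped column has mean
  0, so the whole entry of \<open>W\<close> is its error; kept columns suffer only from truncation.
  The bounds free of \<open>T\<close> serve the case \<open>T \<le> 1\<close>.\<close>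

lemma mean_error_bounds:
  assumes i: "i < d"
  defines "A \<equiv> 2 * gauss_weight * exp (- (C\<^sup>2 * (1 / 6 * T)\<^sup>2))"
  shows "j < d \<Longrightarrow> \<bar>pair_mean i j\<bar> \<le> 2 / 3 * (kept_norm i)\<^sup>2 * (2 / 3 * (kept_norm j)\<^sup>2)"
    "j < d \<Longrightarrow> \<bar>pair_mean i j - W $$ (Suc i, Suc j) / T\<^sup>2\<bar> \<le> kept_norm i * kept_norm j / T\<^sup>2 * A + \<bar>W $$ (Suc i, Suc j)\<bar> / T\<^sup>2"
    "\<bar>sign_pair_mean i\<bar> \<le> 2 / 3 * (kept_norm i)\<^sup>2"
    "\<bar>sign_pair_mean i - W $$ (0, Suc i) / T\<^sup>2\<bar> \<le> kept_norm i / T\<^sup>2 * A + \<bar>W $$ (0, Suc i)\<bar> / T\<^sup>2"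
    "abs_mean i \<le> 2 / 3 * (kept_norm i)\<^sup>2" "abs_mean i \<le> kept_norm i / T"
proof -
  interpret prob_space "std_gaussian (1 + d)" by (rule prob_space_std_gaussian)
  \<comment> \<open>Truncation of a kept column needs a normalized value above
    \<open>2 / 3 * |u_k| * T\<close>, which is at least this \<open>\<tau>\<close>. Then
    \<open>\<tau>^2 / 16 = C^2 * (T / 6)^2\<close>, the origin of the scale
    \<open>1 / 6\<close>.\<close>
  define \<tau> where "\<tau> = 2 / 3 * C * T"
  have \<tau>: "\<tau> \<ge> 0" "A = 2 * gauss_weight * exp (- \<tau>\<^sup>2 / 16)"
    using par by (simp_all add: \<tau>_def A_def power_mult_distrib power_divide)
  have bd: "\<bar>masked_mean W C T g (Suc k)\<bar> \<le> 2 / 3 * (kept_norm k)\<^sup>2" if "k < d" for g k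
    unfolding masked_mean_Suc[OF that] by (rule abs_mult_clip_le) simp
  have zero: "masked_mean W C T g (Suc k) = 0" if "k < d" "kept_norm k = 0" for g k
    using masked_mean_Suc[OF that(1)] that(2) by simp
  have norm: "(\<Sum>l<1 + d. (vec_index (root_col (Suc k)) l)\<^sup>2) = (kept_norm k)\<^sup>2" "0 < kept_norm k" "0 < 2 / 3 * (kept_norm k)\<^sup>2"
    "kept_norm k * \<tau> \<le> 2 / 3 * (kept_norm k)\<^sup>2 * T"
    if k: "k < d" and nz: "kept_norm k \<noteq> 0" for k
  proof -
    have "kept_norm k = l2_norm_vec (root_col (Suc k))" using nz by (auto simp: kept_norm_def split: if_splits)
    then show "(\<Sum>l<1 + d. (vec_index (root_col (Suc k)) l)\<^sup>2) = (kept_norm k)\<^sup>2" using root_col_sq_sum[of "Suc k"] k by simp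
    have "kept_norm k \<ge> C" using kept_norm_facts(1)[OF k] nz by simp
    then have "2 / 3 * T * kept_norm k * C \<le> 2 / 3 * T * kept_norm k * kept_norm k"
      using par by (intro mult_left_mono) auto
    then show "kept_norm k * \<tau> \<le> 2 / 3 * (kept_norm k)\<^sup>2 * T" by (simp add: \<tau>_def power2_eq_square mult_ac)
    show "0 < kept_norm k" "0 < 2 / 3 * (kept_norm k)\<^sup>2" using \<open>kept_norm k \<ge> C\<close> par by auto
  qed
  have abs_int: "\<bar>\<integral>g. F g \<partial>std_gaussian (1 + d)\<bar> \<le> b"
    if "integrable (std_gaussian (1 + d)) F" "\<And>g. \<bar>F g\<bar> \<le> b" for F and b :: real
  proof -
    have "\<bar>\<integral>g. F g \<partial>std_gaussian (1 + d)\<bar> \<le> (\<integral>g. \<bar>F g\<bar> \<partial>std_gaussian (1 + d))" by (rule integral_abs_bound)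
    also have "\<dots> \<le> b" using that by (intro integral_le_const) auto
    finally show ?thesis .
  qed
  have ge0: "0 \<le> 2 / 3 * (kept_norm k)\<^sup>2" for k by simp
  show "\<bar>pair_mean i j\<bar> \<le> 2 / 3 * (kept_norm i)\<^sup>2 * (2 / 3 * (kept_norm j)\<^sup>2)" if j: "j < d"
    using bd[OF i] bd[OF j] by (intro abs_int integrable_means i j) (simp only: abs_mult mult_mono ge0 abs_ge_zero)
  show "\<bar>sign_pair_mean i\<bar> \<le> 2 / 3 * (kept_norm i)\<^sup>2"
  proof (intro abs_int integrable_means i)
    fix g
    have "\<bar>sign_mean W T g\<bar> * \<bar>masked_mean W C T g (Suc i)\<bar> \<le> 1 * (2 / 3 * (kept_norm i)\<^sup>2)"
      using bd[OF i] clip_bounds(1) by (intro mult_mono) auto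
    then show "\<bar>sign_mean W T g * masked_mean W C T g (Suc i)\<bar> \<le> 2 / 3 * (kept_norm i)\<^sup>2"
      by (simp only: abs_mult mult_1)
  qed
  show "abs_mean i \<le> 2 / 3 * (kept_norm i)\<^sup>2"
    using bd[OF i] by (intro integral_le_const integrable_means i) auto
  show "abs_mean i \<le> kept_norm i / T"
  proof (cases "kept_norm i = 0")
    case False
    show ?thesis unfolding masked_mean_Suc[OF i]
      by (rule gauss_abs_clip_le[OF norm(2,1,3)[OF i False] par(5)])
  qed (simp add: zero[OF i])
  show "\<bar>pair_mean i j - W $$ (Suc i, Suc j) / T\<^sup>2\<bar> \<le> kept_norm i * kept_norm j / T\<^sup>2 * A + \<bar>W $$ (Suc i, Suc j)\<bar> / T\<^sup>2"
    if j: "j < d"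
  proof (cases "kept_norm i = 0 \<or> kept_norm j = 0")
    case True
    then show ?thesis using zero[OF i] zero[OF j] by auto
  next
    case False
    then have nz: "kept_norm i \<noteq> 0" "kept_norm j \<noteq> 0" by auto
    have "\<bar>pair_mean i j - (\<Sum>l<1 + d. vec_index (root_col (Suc i)) l * vec_index (root_col (Suc j)) l) / T\<^sup>2\<bar>
        \<le> kept_norm i * kept_norm j / T\<^sup>2 * A"
      unfolding masked_mean_Suc[OF i] masked_mean_Suc[OF j] \<tau>(2)
      by (rule gauss_clip_error[OF norm(2,1)[OF i nz(1)] norm(2,1)[OF j nz(2)] norm(3)[OF i nz(1)] norm(3)[OF j nz(2)]
            par(5) \<tau>(1) norm(4)[OF i nz(1)] norm(4)[OF j nz(2)]])
    also have "(\<Sum>l<1 + d. vec_index (root_col (Suc i)) l * vec_index (root_col (Suc j)) l) = W $$ (Suc i, Suc j)"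
      using i j by (intro root_col_prod_sum) auto
    finally show ?thesis by (rule order_trans) simp
  qed
  show "\<bar>sign_pair_mean i - W $$ (0, Suc i) / T\<^sup>2\<bar> \<le> kept_norm i / T\<^sup>2 * A + \<bar>W $$ (0, Suc i)\<bar> / T\<^sup>2"
  proof (cases "kept_norm i = 0")
    case True
    then show ?thesis using zero[OF i] by auto
  next
    case False
    have u0: "(\<Sum>l<1 + d. (vec_index (root_col 0) l)\<^sup>2) = 1\<^sup>2" using root_col_sq_sum[of 0] root_col_0_norm by simp
    \<comment> \<open>The column with number 0 is a unit vector and is never masked, so its
      truncation level is \<open>T\<close>, and \<open>C \<le> 1\<close> puts \<open>\<tau>\<close>
      below it.\<close>
    have "C * T \<le> 1 * T" using par by (intro mult_right_mono) auto
    then have "1 * \<tau> \<le> 1 * T" using par by (simp add: \<tau>_def)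
    have one: "0 < (1 :: real)" by simp
    from gauss_clip_error[OF one u0 norm(2,1)[OF i False] one norm(3)[OF i False]
            par(5) \<tau>(1) \<open>1 * \<tau> \<le> 1 * T\<close> norm(4)[OF i False]]
    have "\<bar>sign_pair_mean i - (\<Sum>l<1 + d. vec_index (root_col 0) l * vec_index (root_col (Suc i)) l) / T\<^sup>2\<bar> \<le> 1 * kept_norm i / T\<^sup>2 * A"
      unfolding masked_mean_Suc[OF i] sign_mean_eq \<tau>(2) .
    also have "(\<Sum>l<1 + d. vec_index (root_col 0) l * vec_index (root_col (Suc i)) l) = W $$ (0, Suc i)"
      using i by (intro root_col_prod_sum) auto
    finally show ?thesis by (rule order_trans) simp
  qed
qed

lemma expected_objective_le:
  "(\<integral>x. sbqp_objective c P x \<partial>rounding_output d W C T)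
      - max_norm_mat (Q_mat c P) * (trunc_error (gauss_weight + 1) (1 / 6) T C \<sigma> d + 1 / T\<^sup>2 * (3 * real \<sigma> + (real \<sigma>)\<^sup>2)
             + sqrt 3 / (sqrt 2 * T) * min (real d) (real \<sigma> / C\<^sup>2))
    \<le> 1 / T\<^sup>2 * mat_trace (Q_mat c P * W)"
proof -
  note B = max_norm_Q_mat[OF P(1) c]
  let ?B = "max_norm_mat (Q_mat c P)"
  let ?w = "\<lambda>i j. W $$ (Suc i, Suc j)" and ?v = "\<lambda>i. W $$ (0, Suc i)"
  let ?R = "(\<Sum>i<d. abs_mean i) + (\<Sum>i<d. \<Sum>j<d. if i = j then 0 else \<bar>pair_mean i j - ?w i j / T\<^sup>2\<bar>) + 2 * (\<Sum>i<d. \<bar>sign_pair_mean i - ?v i / T\<^sup>2\<bar>)"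
  let ?S = "trunc_error (gauss_weight + 1) (1 / 6) T C \<sigma> d + 1 / T\<^sup>2 * (3 * real \<sigma> + (real \<sigma>)\<^sup>2)
             + sqrt 3 / (sqrt 2 * T) * min (real d) (real \<sigma> / C\<^sup>2)"
  have le: "?R \<le> ?S"
    by (intro rounding_error_sum[where \<alpha> = kept_norm])
      (use kept_norm_facts kept_norm_sq_sum W_facts(4) sdp_first_row_sum[OF W] par gauss_weight_nonneg mean_error_bounds in auto)
  have entry: "P $$ (i, j) * (if i = j then abs_mean i else pair_mean i j) - P $$ (i, j) * ?w i j / T\<^sup>2
      \<le> ?B * ((if i = j then abs_mean i else 0) + (if i = j then 0 else \<bar>pair_mean i j - ?w i j / T\<^sup>2\<bar>))" if ij: "i < d" "j < d" for i j
  proof (cases "i = j")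
    case True
    \<comment> \<open>Here the nonnegative diagonal of \<open>P\<close> enters: the subtracted term
      may be dropped, and only the first absolute moment remains.\<close>
    have "0 \<le> P $$ (i, i) * ?w i i / T\<^sup>2"
      using P(2) ij psd_diag_nonneg[OF W_facts(1), of "Suc i"] by simp
    moreover have "P $$ (i, i) * abs_mean i \<le> ?B * abs_mean i"
      using B(1)[OF ij(1,1)] by (intro mult_right_mono Bochner_Integration.integral_nonneg) auto
    ultimately show ?thesis using True by simp
  next
    case False
    have "P $$ (i, j) * pair_mean i j - P $$ (i, j) * ?w i j / T\<^sup>2 \<le> \<bar>P $$ (i, j)\<bar> * \<bar>pair_mean i j - ?w i j / T\<^sup>2\<bar>"
      using abs_ge_self[of "P $$ (i, j) * (pair_mean i j - ?w i j / T\<^sup>2)"] by (simp only: abs_mult) (simp add: right_diff_distrib)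
    also have "\<dots> \<le> ?B * \<bar>pair_mean i j - ?w i j / T\<^sup>2\<bar>" using B(1)[OF ij] by (intro mult_right_mono) auto
    finally show ?thesis using False by simp
  qed
  have entry0: "vec_index c i * ?v i / T\<^sup>2 - vec_index c i * sign_pair_mean i \<le> ?B * \<bar>sign_pair_mean i - ?v i / T\<^sup>2\<bar>" if i: "i < d" for i
  proof -
    have "vec_index c i * ?v i / T\<^sup>2 - vec_index c i * sign_pair_mean i \<le> \<bar>vec_index c i\<bar> * \<bar>sign_pair_mean i - ?v i / T\<^sup>2\<bar>"
      using abs_ge_minus_self[of "vec_index c i * (sign_pair_mean i - ?v i / T\<^sup>2)"] by (simp only: abs_mult) (simp add: right_diff_distrib)
    also have "\<dots> \<le> ?B * \<bar>sign_pair_mean i - ?v i / T\<^sup>2\<bar>" using B(2)[OF i] by (intro mult_right_mono) auto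
    finally show ?thesis .
  qed
  have "(\<integral>x. sbqp_objective c P x \<partial>rounding_output d W C T) - 1 / T\<^sup>2 * mat_trace (Q_mat c P * W)
    = (\<Sum>i<d. \<Sum>j<d. P $$ (i, j) * (if i = j then abs_mean i else pair_mean i j) - P $$ (i, j) * ?w i j / T\<^sup>2)
      + 2 * (\<Sum>i<d. vec_index c i * ?v i / T\<^sup>2 - vec_index c i * sign_pair_mean i)"
    unfolding expected_objective trace_Q_mat[OF P(1) c W_facts(1)] sum_subtractf sum_divide_distrib[symmetric]
    by (simp add: right_diff_distrib)
  also have "\<dots> \<le> (\<Sum>i<d. \<Sum>j<d. ?B * ((if i = j then abs_mean i else 0) + (if i = j then 0 else \<bar>pair_mean i j - ?w i j / T\<^sup>2\<bar>)))
      + 2 * (\<Sum>i<d. ?B * \<bar>sign_pair_mean i - ?v i / T\<^sup>2\<bar>)"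
    by (intro add_mono sum_mono mult_left_mono entry entry0) auto
  also have "\<dots> = ?B * ?R"
  proof -
    have "(\<Sum>i<d. \<Sum>j<d. if i = j then abs_mean i else 0) = (\<Sum>i<d. abs_mean i)" by (intro sum.cong refl) simp
    then show ?thesis
      unfolding sum_distrib_left[symmetric] sum.distrib by (simp only: distrib_left mult.left_commute)
  qed
  also have "\<dots> \<le> ?B * ?S" using le B(3) by (rule mult_left_mono)
  finally show ?thesis by linarith
qed

text \<open>The conditional bound on infeasibility is uniform in the Gaussian vector and therefore
  survives integration.\<close>

lemma rounding_output_feasible_prob:
  "\<P>(x in rounding_output d W C T. sbqp_feasible d \<sigma> x) \<ge> 1 - exp (- ((ln (3 / 2) - 1 / 3) * real \<sigma>))"
proof -
  let ?X = "rounding_output d W C T"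
  interpret X: prob_space ?X by (rule rounding_output_integral(2))
  interpret G: prob_space "std_gaussian (1 + d)" by (rule prob_space_std_gaussian)
  have sets: "sets ?X = UNIV" by (rule rounding_output_integral(3))
  then have space: "space ?X = UNIV" using sets.top[of ?X] sets.sets_into_space[of UNIV ?X] by auto
  let ?bad = "{x. \<not> sbqp_feasible d \<sigma> x}"
  have "measure ?X ?bad = (\<integral>x. indicator ?bad x \<partial>?X)" using sets space by simp
  also have "\<dots> = (\<integral>x. of_bool (\<not> sbqp_feasible d \<sigma> x) \<partial>?X)"
    by (intro Bochner_Integration.integral_cong) (auto simp: indicator_def)
  also have "\<dots> = (\<integral>g. measure_pmf.expectation (signed_vec_pmf d (sign_mean W T g) (masked_mean W C T g))
      (\<lambda>x. of_bool (\<not> sbqp_feasible d \<sigma> x)) \<partial>std_gaussian (1 + d))"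
    by (rule rounding_output_integral(1))
  also have "\<dots> \<le> exp (- ((ln (3 / 2) - 1 / 3) * real \<sigma>))"
  proof (rule G.integral_le_const)
    have le: "measure_pmf.expectation (signed_vec_pmf d (sign_mean W T g) (masked_mean W C T g))
        (\<lambda>x. of_bool (\<not> sbqp_feasible d \<sigma> x)) \<le> exp (- ((ln (3 / 2) - 1 / 3) * real \<sigma>))" for g
    proof (rule infeasible_prob_le[OF clip_bounds(1) abs_masked_mean_le])
      have "(\<Sum>k\<in>{1..d}. \<bar>masked_mean W C T g k\<bar>) = (\<Sum>i<d. \<bar>masked_mean W C T g (Suc i)\<bar>)"
        by (simp add: sum.atLeast1_atMost_eq)
      also have "\<dots> \<le> (\<Sum>i<d. 2 / 3 * (kept_norm i)\<^sup>2)"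
      proof (intro sum_mono)
        fix i assume "i \<in> {..<d}"
        then have "i < d" by simp
        then show "\<bar>masked_mean W C T g (Suc i)\<bar> \<le> 2 / 3 * (kept_norm i)\<^sup>2"
          unfolding masked_mean_Suc[OF \<open>i < d\<close>] by (intro abs_mult_clip_le) simp
      qed
      also have "\<dots> \<le> 2 / 3 * real \<sigma>" using kept_norm_sq_sum unfolding sum_distrib_left[symmetric] by linarith
      finally show "(\<Sum>k\<in>{1..d}. \<bar>masked_mean W C T g k\<bar>) \<le> 2 / 3 * real \<sigma>" .
    qed
    then show "AE g in std_gaussian (1 + d). measure_pmf.expectation (signed_vec_pmf d (sign_mean W T g) (masked_mean W C T g))
        (\<lambda>x. of_bool (\<not> sbqp_feasible d \<sigma> x)) \<le> exp (- ((ln (3 / 2) - 1 / 3) * real \<sigma>))" by simp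
    show "integrable (std_gaussian (1 + d)) (\<lambda>g. measure_pmf.expectation (signed_vec_pmf d (sign_mean W T g) (masked_mean W C T g))
        (\<lambda>x. of_bool (\<not> sbqp_feasible d \<sigma> x)) :: real)"
      using le
      by (intro G.integrable_const_bound[where B = "exp (- ((ln (3 / 2) - 1 / 3) * real \<sigma>))"]
          measurable_expectation_signed_vec_pmf[OF measurable_sign_mean measurable_masked_mean
            clip_bounds(1) abs_masked_mean_le]) (auto simp: Bochner_Integration.integral_nonneg)
  qed
  finally have "measure ?X ?bad \<le> exp (- ((ln (3 / 2) - 1 / 3) * real \<sigma>))" .
  moreover have "\<P>(x in ?X. sbqp_feasible d \<sigma> x) = 1 - measure ?X ?bad"
  proof -
    have "{x \<in> space ?X. sbqp_feasible d \<sigma> x} = space ?X - ?bad" using space by auto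
    then show ?thesis using X.prob_compl[of ?bad] sets by simp
  qed
  ultimately show ?thesis by simp
qed

end

theorem theorem1:
  shows "\<exists>K \<kappa> c0 K1 K2 :: real. K > 0 \<and> \<kappa> > 0 \<and> c0 > 0 \<and> K1 > 0 \<and> K2 > 0 \<and>
    (\<forall>(d :: nat) (\<sigma> :: nat) (P :: real mat) (c :: real vec)
      (W :: real mat) (xopt :: real vec) (\<epsilon> :: real) (C :: real) (T :: real).
      P \<in> carrier_mat d d \<longrightarrow> transpose_mat P = P \<longrightarrow> (\<forall>i<d. P $$ (i, i) \<ge> 0) \<longrightarrow>
      c \<in> carrier_vec d \<longrightarrow> 0 < \<sigma> \<longrightarrow> \<sigma> \<le> d \<longrightarrow>
      sdp_eps_optimal d \<sigma> c P \<epsilon> W \<longrightarrow> sbqp_optimal d \<sigma> c P xopt \<longrightarrow>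
      0 < C \<longrightarrow> C \<le> 1 \<longrightarrow> 0 < T \<longrightarrow>
      (let B = max_norm_mat (Q_mat c P); X = rounding_output d W C T in
        (\<integral>x. sbqp_objective c P x \<partial>X)
            - B * (trunc_error K \<kappa> T C \<sigma> d + 1 / T\<^sup>2 * (3 * real \<sigma> + (real \<sigma>)\<^sup>2)
                   + sqrt 3 / (sqrt 2 * T) * min (real d) (real \<sigma> / C\<^sup>2))
          \<le> 1 / T\<^sup>2 * mat_trace (Q_mat c P * W)
        \<and> 1 / T\<^sup>2 * mat_trace (Q_mat c P * W)
          \<le> 1 / T\<^sup>2 * (sbqp_objective c P xopt + \<epsilon>)
        \<and> \<P>(x in X. sbqp_feasible d \<sigma> x)
          \<ge> 1 - K1 / real d - K2 * exp (- (c0 * real \<sigma>))))"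
\<comment> \<open>\<open>gauss_weight\<close> pays for truncation and the added 1 for the case
  \<open>T \<le> 1\<close>; \<open>1 / 6\<close> is the scale from \<open>\<tau>\<close>, and the
  rate is the Chernoff exponent at base \<open>3 / 2\<close>.\<close>
proof (rule exI[of _ "gauss_weight + 1"], rule exI[of _ "1 / 6 :: real"], rule exI[of _ "ln (3 / 2) - 1 / 3 :: real"],
    rule exI[of _ "1 :: real"], rule exI[of _ "1 :: real"], intro conjI allI impI)
  show "0 < gauss_weight + 1" using gauss_weight_nonneg by linarith
  show "0 < ln (3 / 2) - (1 / 3 :: real)" by (rule ln_three_halves_gt)
  fix d \<sigma> :: nat and P W :: "real mat" and c xopt :: "real vec" and \<epsilon> C T :: real
  assume P: "P \<in> carrier_mat d d" "\<forall>i<d. P $$ (i, i) \<ge> 0" and c: "c \<in> carrier_vec d"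
    and par: "0 < \<sigma>" "\<sigma> \<le> d" "0 < C" "C \<le> 1" "0 < T"
    and opt: "sdp_eps_optimal d \<sigma> c P \<epsilon> W" "sbqp_optimal d \<sigma> c P xopt"
  interpret sbqp_rounding d \<sigma> P W c C T
    using P c par opt(1) by unfold_locales (simp_all add: sdp_eps_optimal_def)
  have "mat_trace (Q_mat c P * W) \<le> sbqp_objective c P xopt + \<epsilon>"
    using opt sdp_value_le_sbqp_objective[OF P(1) c, of \<sigma> xopt]
    by (simp add: sdp_eps_optimal_def sbqp_optimal_def sdp_objective_def)
  then have "1 / T\<^sup>2 * mat_trace (Q_mat c P * W) \<le> 1 / T\<^sup>2 * (sbqp_objective c P xopt + \<epsilon>)"
    by (intro mult_left_mono) auto
  moreover have "1 - 1 / real d - 1 * exp (- ((ln (3 / 2) - 1 / 3) * real \<sigma>))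
      \<le> 1 - exp (- ((ln (3 / 2) - 1 / 3) * real \<sigma>))" by simp
  ultimately show "let B = max_norm_mat (Q_mat c P); X = rounding_output d W C T in
        (\<integral>x. sbqp_objective c P x \<partial>X)
            - B * (trunc_error (gauss_weight + 1) (1 / 6) T C \<sigma> d + 1 / T\<^sup>2 * (3 * real \<sigma> + (real \<sigma>)\<^sup>2)
                   + sqrt 3 / (sqrt 2 * T) * min (real d) (real \<sigma> / C\<^sup>2))
          \<le> 1 / T\<^sup>2 * mat_trace (Q_mat c P * W)
        \<and> 1 / T\<^sup>2 * mat_trace (Q_mat c P * W)
          \<le> 1 / T\<^sup>2 * (sbqp_objective c P xopt + \<epsilon>)
        \<and> \<P>(x in X. sbqp_feasible d \<sigma> x)
          \<ge> 1 - 1 / real d - 1 * exp (- ((ln (3 / 2) - 1 / 3) * real \<sigma>))"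
    unfolding Let_def
    using expected_objective_le rounding_output_feasible_prob order_trans by blast
qed simp_all

end
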